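(* In a raw type theory, let $I=\langle\mathsf{M}_1\mapsto e_1,\ldots,\mathsf{M}_n\mapsto e_n\rangle$ and $J=\langle\mathsf{M}_1\mapsto f_1,\ldots,\mathsf{M}_n\mapsto f_n\rangle$ be derivable instantiations of $\Xi=[\mathsf{M}_1:\mathcal{B}_1,\ldots,\mathsf{M}_n:\mathcal{B}_n]$ over $\Theta;\Gamma$ which are judgementally equal. Suppose $\Xi$ is a well-formed metavariable context and $\Gamma$ is a well-formed variable context over $\Theta$. If an object judgement $\Xi;\Gamma\vdash\mathcal{J}$ is derivable, then so is $\Theta;\Gamma\vdash(I\equiv J)_*\mathcal{J}$.
   Context: Setting: finitary type theories with hypothetical judgements $\Theta;\Gamma\vdash\mathcal{J}$ and boundaries; $\mathcal{B}[e]$ fills a boundary placeholder with head $e$, and $\mathcal{B}[e_1\equiv e_2]$ fills an object boundary with an equation ($(\Box\ \mathsf{type})[A_1\equiv A_2]$ is $A_1\equiv A_2$, $(\Box:A)[t_1\equiv t_2]$ is $t_1\equiv t_2:A$, and filling passes under abstractions). An instantiation $I$ of $\Xi$ acts by $I_*$, replacing each $\mathsf{M}_i(\vec t)$ by $e_i$ with arguments substituted; $I_{(k)}$ is its restriction to the first $k-1$ metavariables; $I$ is derivable when $\Theta;\Gamma\vdash(I_{(k)*}\mathcal{B}_k)[e_k]$ for all $k$. $I$ and $J$ are judgementally equal when $\Theta;\Gamma\vdash(I_{(k)*}\mathcal{B}_k)[e_k\equiv f_k]$ is derivable for every $k$ with $\mathcal{B}_k$ an object (type or term) boundary. Well-formedness: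 the empty metavariable context is well-formed, and $\Theta,\mathsf{M}:\mathcal{B}$ is well-formed if $\Theta$ is, $\Theta;\emptyset\vdash\mathcal{B}$, and $\mathsf{M}$ is fresh; the empty variable context is well-formed over $\Theta$, and $\Gamma,\mathsf{a}:A$ is well-formed if $\Gamma$ is, $\Theta;\Gamma\vdash A\ \mathsf{type}$, and $\mathsf{a}$ is fresh. The notation $(I\equiv J)_*$ is defined by $(I\equiv J)_*(A\ \mathsf{type})=(I_*A\equiv J_*A)$, $(I\equiv J)_*(t:A)=(I_*t\equiv J_*t:I_*A)$, and $(I\equiv J)_*(\{x:A\}\mathcal{J})=\{x:I_*A\}\,(I\equiv J)_*\mathcal{J}$. A raw type theory is a family of raw rules with deductive system given by structural rules, instantiations of specific rules, and congruence rules for specific object rules.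
   Formalization: The formal theorem adds the naming convention that no metavariable of Ξ occurs in the types of Γ; without it the claim fails, e.g. Ξ=[M: type], Θ=[M: type, N: type], Γ=[a:M], I=J=⟨M↦N⟩, judgement a:M. *)

theory Defs
  imports Main
begin

text \<open>
  Raw syntax is locally nameless: free variables and metavariables are names (both from the
  infinite type \<^typ>\<open>nat\<close>), bound variables are de Bruijn indices.  All syntactic
  classes share one datatype of pre-expressions; scoping, classes and arities are imposed by
  \<open>raw_arg\<close> below.  The type \<open>'s\<close> supplies the symbols.
\<close>

type_synonym var = nat
type_synonym mvar = nat

datatype sclass = Ty | Tm | EqTy | EqTm

datatype 's expr =
    FV var
  | BV nat
  | Sym 's "'s expr list"
  | MApp mvar "'s expr list"
  | StarTy
  | StarTm
  | Abs "'s expr"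

text \<open>
  Judgements and boundaries.  The head of an equation is always the dummy star, hence it is not
  recorded in \<open>EqTyJ\<close>, \<open>EqTmJ\<close>.  The datatypes are polymorphic in
  the expressions so that the generated map and set functions can be used for operations that do
  not depend on the binding depth.
\<close>

datatype 'e jthesis = TyJ 'e | TmJ 'e 'e | EqTyJ 'e 'e | EqTmJ 'e 'e 'e
  \<comment> \<open>\<open>A type\<close>, \<open>t : A\<close>, \<open>A \<equiv> B\<close>, \<open>s \<equiv> t : A\<close>\<close>
datatype 'e bthesis = TyB | TmB 'e | EqTyB 'e 'e | EqTmB 'e 'e 'e
datatype 'e jdg = JTh "'e jthesis" | JAbs 'e "'e jdg"
datatype 'e bdry = BTh "'e bthesis" | BAbs 'e "'e bdry"

type_synonym 's vctx = "(var \<times> 's expr) list"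
type_synonym 's mctx = "(mvar \<times> 's expr bdry) list"
type_synonym 's inst = "(mvar \<times> 's expr) list"
type_synonym 's rule = "'s mctx \<times> 's expr jthesis"

type_synonym arity = "sclass \<times> nat"
type_synonym 's signature = "'s \<Rightarrow> (sclass \<times> arity list) option"

primrec bthesis_of :: "'e jthesis \<Rightarrow> 'e bthesis" where
  "bthesis_of (TyJ A) = TyB"
| "bthesis_of (TmJ t A) = TmB A"
| "bthesis_of (EqTyJ A B) = EqTyB A B"
| "bthesis_of (EqTmJ s t A) = EqTmB s t A"

primrec obj_bthesis :: "'e bthesis \<Rightarrow> bool" where
  "obj_bthesis TyB = True"
| "obj_bthesis (TmB A) = True"
| "obj_bthesis (EqTyB A B) = False"
| "obj_bthesis (EqTmB s t A) = False"

primrec obj_bdry :: "'e bdry \<Rightarrow> bool" where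
  "obj_bdry (BTh b) = obj_bthesis b"
| "obj_bdry (BAbs A B) = obj_bdry B"

primrec obj_jdg :: "'e jdg \<Rightarrow> bool" where
  "obj_jdg (JTh j) = obj_bthesis (bthesis_of j)"
| "obj_jdg (JAbs A J) = obj_jdg J"


subsection \<open>Free variables, metavariables, and substitution for bound variables\<close>

fun fv :: "'s expr \<Rightarrow> var set" where
  "fv (FV a) = {a}"
| "fv (BV i) = {}"
| "fv (Sym S es) = (\<Union>e\<in>set es. fv e)"
| "fv (MApp M ts) = (\<Union>t\<in>set ts. fv t)"
| "fv StarTy = {}"
| "fv StarTm = {}"
| "fv (Abs e) = fv e"

fun mvars :: "'s expr \<Rightarrow> mvar set" where
  "mvars (FV a) = {}"
| "mvars (BV i) = {}"
| "mvars (Sym S es) = (\<Union>e\<in>set es. mvars e)"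
| "mvars (MApp M ts) = insert M (\<Union>t\<in>set ts. mvars t)"
| "mvars StarTy = {}"
| "mvars StarTm = {}"
| "mvars (Abs e) = mvars e"

fun lift :: "nat \<Rightarrow> 's expr \<Rightarrow> 's expr" where
  "lift k (FV a) = FV a"
| "lift k (BV i) = (if i < k then BV i else BV (Suc i))"
| "lift k (Sym S es) = Sym S (map (lift k) es)"
| "lift k (MApp M ts) = MApp M (map (lift k) ts)"
| "lift k StarTy = StarTy"
| "lift k StarTm = StarTm"
| "lift k (Abs e) = Abs (lift (Suc k) e)"

text \<open>\<open>bsubst 0 t e\<close> is \<open>e[t/x]\<close>, where \<open>x\<close> is the outermost bound variable of \<open>{x} e\<close>.\<close>

fun bsubst :: "nat \<Rightarrow> 's expr \<Rightarrow> 's expr \<Rightarrow> 's expr" where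
  "bsubst k t (FV a) = FV a"
| "bsubst k t (BV i) = (if i < k then BV i else if i = k then t else BV (i - 1))"
| "bsubst k t (Sym S es) = Sym S (map (bsubst k t) es)"
| "bsubst k t (MApp M ts) = MApp M (map (bsubst k t) ts)"
| "bsubst k t StarTy = StarTy"
| "bsubst k t StarTm = StarTm"
| "bsubst k t (Abs e) = Abs (bsubst (Suc k) (lift 0 t) e)"

fun jdg_bsubst :: "nat \<Rightarrow> 's expr \<Rightarrow> 's expr jdg \<Rightarrow> 's expr jdg" where
  "jdg_bsubst k t (JTh j) = JTh (map_jthesis (bsubst k t) j)"
| "jdg_bsubst k t (JAbs A J) = JAbs (bsubst k t A) (jdg_bsubst (Suc k) (lift 0 t) J)"

fun bdry_bsubst :: "nat \<Rightarrow> 's expr \<Rightarrow> 's expr bdry \<Rightarrow> 's expr bdry" where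
  "bdry_bsubst k t (BTh b) = BTh (map_bthesis (bsubst k t) b)"
| "bdry_bsubst k t (BAbs A B) = BAbs (bsubst k t A) (bdry_bsubst (Suc k) (lift 0 t) B)"

text \<open>
  Iterated substitution \<open>e[t\<^sub>1/x\<^sub>1, \<dots>, t\<^sub>m/x\<^sub>m]\<close> in the body of an argument
  \<open>{x\<^sub>1}\<dots>{x\<^sub>m} e\<close>, respectively in the body of an abstracted boundary.  For a boundary
  \<open>{x\<^sub>1:A\<^sub>1}\<dots>{x\<^sub>m:A\<^sub>m} b\<close> the function \<open>bdry_doms\<close> lists the types
  \<open>A\<^sub>j[t\<^sub>1/x\<^sub>1, \<dots>, t\<^sub>j\<^sub>-\<^sub>1/x\<^sub>j\<^sub>-\<^sub>1]\<close>.
  The values on arguments that are not sufficiently abstracted are irrelevant.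
\<close>

fun arg_app :: "'s expr \<Rightarrow> 's expr list \<Rightarrow> 's expr" where
  "arg_app (Abs e) (t # ts) = arg_app (bsubst 0 t e) ts"
| "arg_app e _ = e"

fun bdry_app :: "'s expr bdry \<Rightarrow> 's expr list \<Rightarrow> 's expr bdry" where
  "bdry_app (BAbs A B) (t # ts) = bdry_app (bdry_bsubst 0 t B) ts"
| "bdry_app B _ = B"

fun bdry_doms :: "'s expr bdry \<Rightarrow> 's expr list \<Rightarrow> 's expr list" where
  "bdry_doms (BAbs A B) (t # ts) = A # bdry_doms (bdry_bsubst 0 t B) ts"
| "bdry_doms B _ = []"


subsection \<open>Well-scoped raw syntax over a signature\<close>

primrec bthesis_class :: "'e bthesis \<Rightarrow> sclass" where
  "bthesis_class TyB = Ty"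
| "bthesis_class (TmB A) = Tm"
| "bthesis_class (EqTyB A B) = EqTy"
| "bthesis_class (EqTmB s t A) = EqTm"

primrec bdry_arity :: "'e bdry \<Rightarrow> arity" where
  "bdry_arity (BTh b) = (bthesis_class b, 0)"
| "bdry_arity (BAbs A B) = (fst (bdry_arity B), Suc (snd (bdry_arity B)))"

definition mctx_arities :: "'s mctx \<Rightarrow> mvar \<Rightarrow> arity option" where
  "mctx_arities \<Theta> = map_of (map (\<lambda>(M, B). (M, bdry_arity B)) \<Theta>)"

text \<open>
  \<open>raw_arg \<Sigma> \<theta> \<gamma> k (c, n) e\<close>: \<open>e\<close> is an argument of class \<open>c\<close> abstracted by \<open>n\<close> variables, with
  metavariables from \<open>\<theta>\<close>, free variables from \<open>\<gamma>\<close> and at most \<open>k\<close> dangling bound variables.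
\<close>

inductive raw_arg ::
  "'s signature \<Rightarrow> (mvar \<Rightarrow> arity option) \<Rightarrow> var set \<Rightarrow> nat \<Rightarrow> arity \<Rightarrow> 's expr \<Rightarrow> bool"
  for \<Sigma> \<theta> \<gamma> where
  "a \<in> \<gamma> \<Longrightarrow> raw_arg \<Sigma> \<theta> \<gamma> k (Tm, 0) (FV a)"
| "i < k \<Longrightarrow> raw_arg \<Sigma> \<theta> \<gamma> k (Tm, 0) (BV i)"
| "\<Sigma> S = Some (c, \<alpha>) \<Longrightarrow> list_all2 (raw_arg \<Sigma> \<theta> \<gamma> k) \<alpha> es \<Longrightarrow> raw_arg \<Sigma> \<theta> \<gamma> k (c, 0) (Sym S es)"
| "\<theta> M = Some (c, length ts) \<Longrightarrow> c \<in> {Ty, Tm} \<Longrightarrow> \<forall>t\<in>set ts. raw_arg \<Sigma> \<theta> \<gamma> k (Tm, 0) t \<Longrightarrow>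
    raw_arg \<Sigma> \<theta> \<gamma> k (c, 0) (MApp M ts)"
| "raw_arg \<Sigma> \<theta> \<gamma> k (EqTy, 0) StarTy"
| "raw_arg \<Sigma> \<theta> \<gamma> k (EqTm, 0) StarTm"
| "raw_arg \<Sigma> \<theta> \<gamma> (Suc k) (c, n) e \<Longrightarrow> raw_arg \<Sigma> \<theta> \<gamma> k (c, Suc n) (Abs e)"

abbreviation "raw_ty \<Sigma> \<theta> \<gamma> k \<equiv> raw_arg \<Sigma> \<theta> \<gamma> k (Ty, 0)"
abbreviation "raw_tm \<Sigma> \<theta> \<gamma> k \<equiv> raw_arg \<Sigma> \<theta> \<gamma> k (Tm, 0)"

primrec raw_jthesis ::
  "'s signature \<Rightarrow> (mvar \<Rightarrow> arity option) \<Rightarrow> var set \<Rightarrow> nat \<Rightarrow> 's expr jthesis \<Rightarrow> bool" where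
  "raw_jthesis \<Sigma> \<theta> \<gamma> k (TyJ A) \<longleftrightarrow> raw_ty \<Sigma> \<theta> \<gamma> k A"
| "raw_jthesis \<Sigma> \<theta> \<gamma> k (TmJ t A) \<longleftrightarrow> raw_tm \<Sigma> \<theta> \<gamma> k t \<and> raw_ty \<Sigma> \<theta> \<gamma> k A"
| "raw_jthesis \<Sigma> \<theta> \<gamma> k (EqTyJ A B) \<longleftrightarrow> raw_ty \<Sigma> \<theta> \<gamma> k A \<and> raw_ty \<Sigma> \<theta> \<gamma> k B"
| "raw_jthesis \<Sigma> \<theta> \<gamma> k (EqTmJ s t A) \<longleftrightarrow>
    raw_tm \<Sigma> \<theta> \<gamma> k s \<and> raw_tm \<Sigma> \<theta> \<gamma> k t \<and> raw_ty \<Sigma> \<theta> \<gamma> k A"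

primrec raw_bthesis ::
  "'s signature \<Rightarrow> (mvar \<Rightarrow> arity option) \<Rightarrow> var set \<Rightarrow> nat \<Rightarrow> 's expr bthesis \<Rightarrow> bool" where
  "raw_bthesis \<Sigma> \<theta> \<gamma> k TyB \<longleftrightarrow> True"
| "raw_bthesis \<Sigma> \<theta> \<gamma> k (TmB A) \<longleftrightarrow> raw_ty \<Sigma> \<theta> \<gamma> k A"
| "raw_bthesis \<Sigma> \<theta> \<gamma> k (EqTyB A B) \<longleftrightarrow> raw_ty \<Sigma> \<theta> \<gamma> k A \<and> raw_ty \<Sigma> \<theta> \<gamma> k B"
| "raw_bthesis \<Sigma> \<theta> \<gamma> k (EqTmB s t A) \<longleftrightarrow>
    raw_tm \<Sigma> \<theta> \<gamma> k s \<and> raw_tm \<Sigma> \<theta> \<gamma> k t \<and> raw_ty \<Sigma> \<theta> \<gamma> k A"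

primrec raw_bdry ::
  "'s signature \<Rightarrow> (mvar \<Rightarrow> arity option) \<Rightarrow> var set \<Rightarrow> nat \<Rightarrow> 's expr bdry \<Rightarrow> bool" where
  "raw_bdry \<Sigma> \<theta> \<gamma> k (BTh b) \<longleftrightarrow> raw_bthesis \<Sigma> \<theta> \<gamma> k b"
| "raw_bdry \<Sigma> \<theta> \<gamma> k (BAbs A B) \<longleftrightarrow> raw_ty \<Sigma> \<theta> \<gamma> k A \<and> raw_bdry \<Sigma> \<theta> \<gamma> (Suc k) B"

inductive raw_mctx :: "'s signature \<Rightarrow> 's mctx \<Rightarrow> bool" for \<Sigma> where
  "raw_mctx \<Sigma> []"
| "raw_mctx \<Sigma> \<Theta> \<Longrightarrow> M \<notin> fst ` set \<Theta> \<Longrightarrow> raw_bdry \<Sigma> (mctx_arities \<Theta>) {} 0 B \<Longrightarrow>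
    raw_mctx \<Sigma> (\<Theta> @ [(M, B)])"

definition raw_rule :: "'s signature \<Rightarrow> 's rule \<Rightarrow> bool" where
  "raw_rule \<Sigma> R \<longleftrightarrow>
    raw_mctx \<Sigma> (fst R) \<and> raw_jthesis \<Sigma> (mctx_arities (fst R)) {} 0 (snd R)"

definition raw_type_theory :: "'s signature \<Rightarrow> 's rule set \<Rightarrow> bool" where
  "raw_type_theory \<Sigma> T \<longleftrightarrow>
    (\<forall>S c \<alpha>. \<Sigma> S = Some (c, \<alpha>) \<longrightarrow> c \<in> {Ty, Tm}) \<and> (\<forall>R\<in>T. raw_rule \<Sigma> R)"


subsection \<open>Filling boundaries\<close>

text \<open>Filling is partial: the head must have as many abstractions as the boundary.\<close>

primrec fill_thesis :: "'s expr bthesis \<Rightarrow> 's expr \<Rightarrow> 's expr jthesis option" where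
  "fill_thesis TyB e = Some (TyJ e)"
| "fill_thesis (TmB A) e = Some (TmJ e A)"
| "fill_thesis (EqTyB A B) e = (if e = StarTy then Some (EqTyJ A B) else None)"
| "fill_thesis (EqTmB s t A) e = (if e = StarTm then Some (EqTmJ s t A) else None)"

fun fill :: "'s expr bdry \<Rightarrow> 's expr \<Rightarrow> 's expr jdg option" where
  "fill (BTh b) e = map_option JTh (fill_thesis b e)"
| "fill (BAbs A B) (Abs e) = map_option (JAbs A) (fill B e)"
| "fill (BAbs A B) _ = None"

fun fill_eq :: "'s expr bdry \<Rightarrow> 's expr \<Rightarrow> 's expr \<Rightarrow> 's expr jdg option" where
  "fill_eq (BTh TyB) e1 e2 = Some (JTh (EqTyJ e1 e2))"
| "fill_eq (BTh (TmB A)) e1 e2 = Some (JTh (EqTmJ e1 e2 A))"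
| "fill_eq (BAbs A B) (Abs e1) (Abs e2) = map_option (JAbs A) (fill_eq B e1 e2)"
| "fill_eq _ _ _ = None"


subsection \<open>Instantiations\<close>

fun inst_expr :: "'s inst \<Rightarrow> 's expr \<Rightarrow> 's expr" where
  "inst_expr I (FV a) = FV a"
| "inst_expr I (BV i) = BV i"
| "inst_expr I (Sym S es) = Sym S (map (inst_expr I) es)"
| "inst_expr I (MApp M ts) =
    (case map_of I M of
       None \<Rightarrow> MApp M (map (inst_expr I) ts)
     | Some e \<Rightarrow> arg_app e (map (inst_expr I) ts))"
| "inst_expr I StarTy = StarTy"
| "inst_expr I StarTm = StarTm"
| "inst_expr I (Abs e) = Abs (inst_expr I e)"

abbreviation inst_jthesis :: "'s inst \<Rightarrow> 's expr jthesis \<Rightarrow> 's expr jthesis" where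
  "inst_jthesis I \<equiv> map_jthesis (inst_expr I)"

abbreviation inst_bdry :: "'s inst \<Rightarrow> 's expr bdry \<Rightarrow> 's expr bdry" where
  "inst_bdry I \<equiv> map_bdry (inst_expr I)"

text \<open>
  \<open>(I \<equiv> J)\<^sub>*\<close>, specified on object judgements only.  The outermost binders of a judgement need no
  care, as the arguments of an instantiation have no dangling bound variables.
\<close>

fun inst_eq :: "'s inst \<Rightarrow> 's inst \<Rightarrow> 's expr jdg \<Rightarrow> 's expr jdg" where
  "inst_eq I J (JTh (TyJ A)) = JTh (EqTyJ (inst_expr I A) (inst_expr J A))"
| "inst_eq I J (JTh (TmJ t A)) = JTh (EqTmJ (inst_expr I t) (inst_expr J t) (inst_expr I A))"
| "inst_eq I J (JAbs A \<J>) = JAbs (inst_expr I A) (inst_eq I J \<J>)"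

text \<open>
  The judgements \<open>(I\<^sub>(\<^sub>k\<^sub>)\<^sub>* B\<^sub>k)[e\<^sub>k]\<close>, respectively \<open>(I\<^sub>(\<^sub>k\<^sub>)\<^sub>* B\<^sub>k)[e\<^sub>k \<equiv> f\<^sub>k]\<close> for object
  boundaries \<open>B\<^sub>k\<close>, all satisfy \<open>D\<close>.  Positions are counted from \<open>0\<close>, so that
  \<open>take k I\<close> is the restriction of \<open>I\<close> to the metavariables preceding position \<open>k\<close>.
\<close>

definition inst_holds :: "('s expr jdg \<Rightarrow> bool) \<Rightarrow> 's mctx \<Rightarrow> 's inst \<Rightarrow> bool" where
  "inst_holds D \<Xi> I \<longleftrightarrow>
    map fst I = map fst \<Xi> \<and>
    (\<forall>k < length \<Xi>. \<exists>\<J>. fill (inst_bdry (take k I) (snd (\<Xi> ! k))) (snd (I ! k)) = Some \<J> \<and> D \<J>)"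

definition inst_eq_holds ::
  "('s expr jdg \<Rightarrow> bool) \<Rightarrow> 's mctx \<Rightarrow> 's inst \<Rightarrow> 's inst \<Rightarrow> bool" where
  "inst_eq_holds D \<Xi> I J \<longleftrightarrow>
    (\<forall>k < length \<Xi>. obj_bdry (snd (\<Xi> ! k)) \<longrightarrow>
      (\<exists>\<J>. fill_eq (inst_bdry (take k I) (snd (\<Xi> ! k))) (snd (I ! k)) (snd (J ! k)) = Some \<J> \<and> D \<J>))"

lemma inst_holds_mono [mono]:
  "(\<And>\<J>. D \<J> \<longrightarrow> D' \<J>) \<Longrightarrow> inst_holds D \<Xi> I \<longrightarrow> inst_holds D' \<Xi> I"
  unfolding inst_holds_def by blast

lemma inst_eq_holds_mono [mono]:
  "(\<And>\<J>. D \<J> \<longrightarrow> D' \<J>) \<Longrightarrow> inst_eq_holds D \<Xi> I J \<longrightarrow> inst_eq_holds D' \<Xi> I J"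
  unfolding inst_eq_holds_def by blast


subsection \<open>The deductive system of a raw type theory\<close>

definition fv_jdg :: "'s expr jdg \<Rightarrow> var set" where
  "fv_jdg \<J> = (\<Union>e\<in>set_jdg \<J>. fv e)"

definition fv_bdry :: "'s expr bdry \<Rightarrow> var set" where
  "fv_bdry B = (\<Union>e\<in>set_bdry B. fv e)"

text \<open>
  \<open>derivable T \<Theta> \<Gamma> \<J>\<close> is \<open>\<Theta>; \<Gamma> \<turnstile> \<J>\<close> and \<open>derivable_bdry T \<Theta> \<Gamma> B\<close> is \<open>\<Theta>; \<Gamma> \<turnstile> B\<close>.

  There are no well-scopedness side conditions.  If \<open>T\<close> consists of raw rules, \<open>\<Theta>\<close> is a raw
  metavariable context and the types in \<open>\<Gamma>\<close> are well-scoped over \<open>\<Theta>\<close>, then every derivable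
  judgement is well-scoped over \<open>\<Theta>; \<Gamma>\<close>, because the rules build judgements only from expressions
  that occur in their premises or in the contexts.  Not tying the types of \<open>\<Gamma>\<close> to \<open>\<Theta>\<close> gives a
  meaning to \<open>\<Xi>; \<Gamma> \<turnstile> \<J>\<close> when \<open>\<Gamma>\<close> is a context over some other \<open>\<Theta>\<close>.  In the abstraction rules the
  condition \<open>a \<notin> fv_jdg \<J>\<close> expresses that \<open>{x:A} \<J>\<close> is a judgement over \<open>\<Gamma>\<close>.
\<close>

inductive derivable :: "'s rule set \<Rightarrow> 's mctx \<Rightarrow> 's vctx \<Rightarrow> 's expr jdg \<Rightarrow> bool"
  and derivable_bdry :: "'s rule set \<Rightarrow> 's mctx \<Rightarrow> 's vctx \<Rightarrow> 's expr bdry \<Rightarrow> bool"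
  for T where
  \<comment> \<open>variables, metavariables, abstraction\<close>
  var: "(a, A) \<in> set \<Gamma> \<Longrightarrow> derivable T \<Theta> \<Gamma> (JTh (TmJ (FV a) A))"
| meta_obj:
    "(M, B) \<in> set \<Theta> \<Longrightarrow> length ts = snd (bdry_arity B) \<Longrightarrow>
     \<forall>j < length ts. derivable T \<Theta> \<Gamma> (JTh (TmJ (ts ! j) (bdry_doms B ts ! j))) \<Longrightarrow>
     bdry_app B ts = BTh b \<Longrightarrow> obj_bthesis b \<Longrightarrow>
     derivable_bdry T \<Theta> \<Gamma> (BTh b) \<Longrightarrow>
     fill_thesis b (MApp M ts) = Some j \<Longrightarrow>
     derivable T \<Theta> \<Gamma> (JTh j)"
| meta_eq:
    "(M, B) \<in> set \<Theta> \<Longrightarrow> length ts = snd (bdry_arity B) \<Longrightarrow>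
     \<forall>j < length ts. derivable T \<Theta> \<Gamma> (JTh (TmJ (ts ! j) (bdry_doms B ts ! j))) \<Longrightarrow>
     bdry_app B ts = BTh b \<Longrightarrow> \<not> obj_bthesis b \<Longrightarrow>
     derivable_bdry T \<Theta> \<Gamma> (BTh b) \<Longrightarrow>
     bthesis_of j = b \<Longrightarrow>
     derivable T \<Theta> \<Gamma> (JTh j)"
| meta_cong_ty:
    "(M, B) \<in> set \<Theta> \<Longrightarrow>
     length ss = snd (bdry_arity B) \<Longrightarrow> length ts = snd (bdry_arity B) \<Longrightarrow>
     \<forall>j < length ss. derivable T \<Theta> \<Gamma> (JTh (TmJ (ss ! j) (bdry_doms B ss ! j))) \<Longrightarrow>
     \<forall>j < length ts. derivable T \<Theta> \<Gamma> (JTh (TmJ (ts ! j) (bdry_doms B ts ! j))) \<Longrightarrow>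
     \<forall>j < length ss. derivable T \<Theta> \<Gamma> (JTh (EqTmJ (ss ! j) (ts ! j) (bdry_doms B ss ! j))) \<Longrightarrow>
     bdry_app B ss = BTh TyB \<Longrightarrow>
     derivable T \<Theta> \<Gamma> (JTh (EqTyJ (MApp M ss) (MApp M ts)))"
| meta_cong_tm:
    "(M, B) \<in> set \<Theta> \<Longrightarrow>
     length ss = snd (bdry_arity B) \<Longrightarrow> length ts = snd (bdry_arity B) \<Longrightarrow>
     \<forall>j < length ss. derivable T \<Theta> \<Gamma> (JTh (TmJ (ss ! j) (bdry_doms B ss ! j))) \<Longrightarrow>
     \<forall>j < length ts. derivable T \<Theta> \<Gamma> (JTh (TmJ (ts ! j) (bdry_doms B ts ! j))) \<Longrightarrow>
     \<forall>j < length ss. derivable T \<Theta> \<Gamma> (JTh (EqTmJ (ss ! j) (ts ! j) (bdry_doms B ss ! j))) \<Longrightarrow>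
     bdry_app B ss = BTh (TmB C) \<Longrightarrow> bdry_app B ts = BTh (TmB C') \<Longrightarrow>
     derivable T \<Theta> \<Gamma> (JTh (EqTyJ C C')) \<Longrightarrow>
     derivable T \<Theta> \<Gamma> (JTh (EqTmJ (MApp M ss) (MApp M ts) C))"
| abstr:
    "derivable T \<Theta> \<Gamma> (JTh (TyJ A)) \<Longrightarrow> a \<notin> fst ` set \<Gamma> \<Longrightarrow> a \<notin> fv_jdg \<J> \<Longrightarrow>
     derivable T \<Theta> (\<Gamma> @ [(a, A)]) (jdg_bsubst 0 (FV a) \<J>) \<Longrightarrow>
     derivable T \<Theta> \<Gamma> (JAbs A \<J>)"
  \<comment> \<open>equality and conversion\<close>
| eqty_refl: "derivable T \<Theta> \<Gamma> (JTh (TyJ A)) \<Longrightarrow> derivable T \<Theta> \<Gamma> (JTh (EqTyJ A A))"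
| eqty_sym: "derivable T \<Theta> \<Gamma> (JTh (EqTyJ A B)) \<Longrightarrow> derivable T \<Theta> \<Gamma> (JTh (EqTyJ B A))"
| eqty_trans:
    "derivable T \<Theta> \<Gamma> (JTh (EqTyJ A B)) \<Longrightarrow> derivable T \<Theta> \<Gamma> (JTh (EqTyJ B C)) \<Longrightarrow>
     derivable T \<Theta> \<Gamma> (JTh (EqTyJ A C))"
| eqtm_refl: "derivable T \<Theta> \<Gamma> (JTh (TmJ t A)) \<Longrightarrow> derivable T \<Theta> \<Gamma> (JTh (EqTmJ t t A))"
| eqtm_sym: "derivable T \<Theta> \<Gamma> (JTh (EqTmJ s t A)) \<Longrightarrow> derivable T \<Theta> \<Gamma> (JTh (EqTmJ t s A))"
| eqtm_trans:
    "derivable T \<Theta> \<Gamma> (JTh (EqTmJ s t A)) \<Longrightarrow> derivable T \<Theta> \<Gamma> (JTh (EqTmJ t u A)) \<Longrightarrow>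
     derivable T \<Theta> \<Gamma> (JTh (EqTmJ s u A))"
| conv_tm:
    "derivable T \<Theta> \<Gamma> (JTh (TmJ t A)) \<Longrightarrow> derivable T \<Theta> \<Gamma> (JTh (EqTyJ A B)) \<Longrightarrow>
     derivable T \<Theta> \<Gamma> (JTh (TmJ t B))"
| conv_eqtm:
    "derivable T \<Theta> \<Gamma> (JTh (EqTmJ s t A)) \<Longrightarrow> derivable T \<Theta> \<Gamma> (JTh (EqTyJ A B)) \<Longrightarrow>
     derivable T \<Theta> \<Gamma> (JTh (EqTmJ s t B))"
  \<comment> \<open>boundaries\<close>
| bdry_ty: "derivable_bdry T \<Theta> \<Gamma> (BTh TyB)"
| bdry_tm: "derivable T \<Theta> \<Gamma> (JTh (TyJ A)) \<Longrightarrow> derivable_bdry T \<Theta> \<Gamma> (BTh (TmB A))"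
| bdry_eqty:
    "derivable T \<Theta> \<Gamma> (JTh (TyJ A)) \<Longrightarrow> derivable T \<Theta> \<Gamma> (JTh (TyJ B)) \<Longrightarrow>
     derivable_bdry T \<Theta> \<Gamma> (BTh (EqTyB A B))"
| bdry_eqtm:
    "derivable T \<Theta> \<Gamma> (JTh (TyJ A)) \<Longrightarrow>
     derivable T \<Theta> \<Gamma> (JTh (TmJ s A)) \<Longrightarrow> derivable T \<Theta> \<Gamma> (JTh (TmJ t A)) \<Longrightarrow>
     derivable_bdry T \<Theta> \<Gamma> (BTh (EqTmB s t A))"
| bdry_abstr:
    "derivable T \<Theta> \<Gamma> (JTh (TyJ A)) \<Longrightarrow> a \<notin> fst ` set \<Gamma> \<Longrightarrow> a \<notin> fv_bdry B \<Longrightarrow>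
     derivable_bdry T \<Theta> (\<Gamma> @ [(a, A)]) (bdry_bsubst 0 (FV a) B) \<Longrightarrow>
     derivable_bdry T \<Theta> \<Gamma> (BAbs A B)"
  \<comment> \<open>instantiations of specific rules; congruence rules of specific object rules\<close>
| specific:
    "(\<Xi>, j) \<in> T \<Longrightarrow> inst_holds (derivable T \<Theta> \<Gamma>) \<Xi> I \<Longrightarrow>
     derivable_bdry T \<Theta> \<Gamma> (BTh (bthesis_of (inst_jthesis I j))) \<Longrightarrow>
     derivable T \<Theta> \<Gamma> (JTh (inst_jthesis I j))"
| specific_cong_ty:
    "(\<Xi>, TyJ A) \<in> T \<Longrightarrow>
     inst_holds (derivable T \<Theta> \<Gamma>) \<Xi> I \<Longrightarrow> inst_holds (derivable T \<Theta> \<Gamma>) \<Xi> J \<Longrightarrow>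
     inst_eq_holds (derivable T \<Theta> \<Gamma>) \<Xi> I J \<Longrightarrow>
     derivable T \<Theta> \<Gamma> (JTh (EqTyJ (inst_expr I A) (inst_expr J A)))"
| specific_cong_tm:
    "(\<Xi>, TmJ t A) \<in> T \<Longrightarrow>
     inst_holds (derivable T \<Theta> \<Gamma>) \<Xi> I \<Longrightarrow> inst_holds (derivable T \<Theta> \<Gamma>) \<Xi> J \<Longrightarrow>
     inst_eq_holds (derivable T \<Theta> \<Gamma>) \<Xi> I J \<Longrightarrow>
     derivable T \<Theta> \<Gamma> (JTh (EqTyJ (inst_expr I A) (inst_expr J A))) \<Longrightarrow>
     derivable T \<Theta> \<Gamma> (JTh (EqTmJ (inst_expr I t) (inst_expr J t) (inst_expr I A)))"

definition derivable_inst ::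
  "'s rule set \<Rightarrow> 's mctx \<Rightarrow> 's vctx \<Rightarrow> 's mctx \<Rightarrow> 's inst \<Rightarrow> bool" where
  "derivable_inst T \<Theta> \<Gamma> \<Xi> I \<longleftrightarrow> inst_holds (derivable T \<Theta> \<Gamma>) \<Xi> I"

definition equal_inst ::
  "'s rule set \<Rightarrow> 's mctx \<Rightarrow> 's vctx \<Rightarrow> 's mctx \<Rightarrow> 's inst \<Rightarrow> 's inst \<Rightarrow> bool" where
  "equal_inst T \<Theta> \<Gamma> \<Xi> I J \<longleftrightarrow> inst_eq_holds (derivable T \<Theta> \<Gamma>) \<Xi> I J"

inductive wf_mctx :: "'s rule set \<Rightarrow> 's mctx \<Rightarrow> bool" for T where
  "wf_mctx T []"
| "wf_mctx T \<Theta> \<Longrightarrow> derivable_bdry T \<Theta> [] B \<Longrightarrow> M \<notin> fst ` set \<Theta> \<Longrightarrow> wf_mctx T (\<Theta> @ [(M, B)])"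

inductive wf_vctx :: "'s rule set \<Rightarrow> 's mctx \<Rightarrow> 's vctx \<Rightarrow> bool" for T \<Theta> where
  "wf_vctx T \<Theta> []"
| "wf_vctx T \<Theta> \<Gamma> \<Longrightarrow> derivable T \<Theta> \<Gamma> (JTh (TyJ A)) \<Longrightarrow> a \<notin> fst ` set \<Gamma> \<Longrightarrow>
    wf_vctx T \<Theta> (\<Gamma> @ [(a, A)])"

text \<open>
  Distinct metavariable contexts are conventionally given distinct names.  When \<open>\<Gamma>\<close> is a context over
  \<open>\<Theta>\<close> and \<open>I\<close> instantiates \<open>\<Xi>\<close> over \<open>\<Theta>; \<Gamma>\<close>, what is needed of this convention is that \<open>\<Gamma>\<close> does not
  mention metavariables of \<open>\<Xi>\<close>.  For \<open>\<Xi> = [M : \<box> type]\<close>, \<open>\<Theta> = [M : \<box> type, N : \<box> type]\<close>, \<open>\<Gamma> = [a : M]\<close>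
  and \<open>I = \<langle>M \<mapsto> N\<rangle>\<close> one has \<open>\<Xi>; \<Gamma> \<turnstile> a : M\<close>, whereas \<open>\<Theta>; \<Gamma> \<turnstile> a : N\<close> need not hold.
\<close>

definition mvars_vctx :: "'s vctx \<Rightarrow> mvar set" where
  "mvars_vctx \<Gamma> = (\<Union>(a, A)\<in>set \<Gamma>. mvars A)"

end

theory Submission
  imports Defs
begin

text \<open>
  Substitutions for free variables and instantiations of metavariables are treated together, as the
  action \<open>act I \<sigma>\<close> of a pair on expressions.  An induction on derivations, parametrised by
  how the rules for metavariables are translated, shows successively that judgements are stable under
  renaming, substitution and instantiation; a second such induction compares the actions of two
  equal morphisms, first for substitutions and then for instantiations.

  The only hard case is a metavariable \<open>M : B\<close> instantiated by \<open>e\<close> and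
  \<open>f\<close> and applied to arguments \<open>ts\<close>, where one wants
  \<open>e(I\<^sub>*ts) \<equiv> e(J\<^sub>*ts) \<equiv> f(J\<^sub>*ts)\<close>.  Both steps need
  \<open>J\<^sub>*ts\<close> to be typed by \<open>I\<^sub>*B\<close>, whereas it is given as typed by
  \<open>J\<^sub>*B\<close>.  As \<open>B\<close> is derivable over the metavariables preceding
  \<open>M\<close>, induction on the length of \<open>\<Xi>\<close> makes the domains of
  \<open>I\<^sub>*B\<close> and \<open>J\<^sub>*B\<close> judgementally equal, and the arguments can be converted.
\<close>

text \<open>Stability under one morphism has to precede the comparison of two. The comparison
  concerns object judgements only, so when a derivation uses an equation, as in a conversion, that
  equation is translated along the left side alone; the arguments of a metavariable have to be
  translated along each side separately. The kinds of morphisms are forced into an order. Entering a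
  binder enlarges the target context, so substitutions and instantiations presuppose weakening;
  renamings are the morphisms that can be extended by a fresh variable without it. Instantiations
  presuppose even the equality of substitutions: once \<open>M\<close> is replaced by an argument
  \<open>e\<close>, the congruence rule for \<open>M\<close> becomes the statement that the body of
  \<open>e\<close> respects equal substitutions. The type equations demanded by congruence rules for
  terms come from the boundary premises of the rules for metavariables and of specific rules.
  Scoping is measured by a depth map \<open>\<theta>\<close> that may exceed the context of the
  derivation, because a derivation over \<open>\<Xi>\<close> may use a \<open>\<Gamma>\<close> whose
  types mention metavariables of \<open>\<Theta>\<close>.\<close>

subsection \<open>Scoping and depth\<close>

text \<open>
  \<open>wsc \<theta> \<gamma> k n e\<close> forgets the syntactic classes in \<open>raw_arg\<close> and the arities of symbols, but
  keeps the depths of arguments: this suffices for \<open>arg_app\<close> to consume exactly the binders of an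
  argument, on which its commutation with substitution depends.
\<close>

fun wsc :: "(mvar \<Rightarrow> nat option) \<Rightarrow> var set \<Rightarrow> nat \<Rightarrow> nat \<Rightarrow> 's expr \<Rightarrow> bool" where
  "wsc \<theta> \<gamma> k n (FV a) \<longleftrightarrow> n = 0 \<and> a \<in> \<gamma>"
| "wsc \<theta> \<gamma> k n (BV i) \<longleftrightarrow> n = 0 \<and> i < k"
| "wsc \<theta> \<gamma> k n (Sym S es) \<longleftrightarrow> n = 0 \<and> (\<forall>e\<in>set es. \<exists>m. wsc \<theta> \<gamma> k m e)"
| "wsc \<theta> \<gamma> k n (MApp M ts) \<longleftrightarrow> n = 0 \<and> \<theta> M = Some (length ts) \<and> (\<forall>t\<in>set ts. wsc \<theta> \<gamma> k 0 t)"
| "wsc \<theta> \<gamma> k n StarTy \<longleftrightarrow> n = 0"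
| "wsc \<theta> \<gamma> k n StarTm \<longleftrightarrow> n = 0"
| "wsc \<theta> \<gamma> k n (Abs e) \<longleftrightarrow> n \<noteq> 0 \<and> wsc \<theta> \<gamma> (Suc k) (n - 1) e"

fun wsc_jdg :: "(mvar \<Rightarrow> nat option) \<Rightarrow> var set \<Rightarrow> nat \<Rightarrow> 's expr jdg \<Rightarrow> bool" where
  "wsc_jdg \<theta> \<gamma> k (JTh j) \<longleftrightarrow> (\<forall>e\<in>set_jthesis j. wsc \<theta> \<gamma> k 0 e)"
| "wsc_jdg \<theta> \<gamma> k (JAbs A J) \<longleftrightarrow> wsc \<theta> \<gamma> k 0 A \<and> wsc_jdg \<theta> \<gamma> (Suc k) J"

fun wsc_bdry :: "(mvar \<Rightarrow> nat option) \<Rightarrow> var set \<Rightarrow> nat \<Rightarrow> 's expr bdry \<Rightarrow> bool" where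
  "wsc_bdry \<theta> \<gamma> k (BTh b) \<longleftrightarrow> (\<forall>e\<in>set_bthesis b. wsc \<theta> \<gamma> k 0 e)"
| "wsc_bdry \<theta> \<gamma> k (BAbs A B) \<longleftrightarrow> wsc \<theta> \<gamma> k 0 A \<and> wsc_bdry \<theta> \<gamma> (Suc k) B"

definition wsc_vctx :: "(mvar \<Rightarrow> nat option) \<Rightarrow> 's vctx \<Rightarrow> bool" where
  "wsc_vctx \<theta> \<Gamma> \<longleftrightarrow> (\<forall>(a, A)\<in>set \<Gamma>. wsc \<theta> (fst ` set \<Gamma>) 0 0 A)"

abbreviation bdry_depth :: "'e bdry \<Rightarrow> nat" where
  "bdry_depth B \<equiv> snd (bdry_arity B)"

definition depths :: "'s mctx \<Rightarrow> mvar \<Rightarrow> nat option" where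
  "depths \<Theta> = map_of (map (\<lambda>(M, B). (M, bdry_depth B)) \<Theta>)"

definition wsc_mctx :: "'s mctx \<Rightarrow> bool" where
  "wsc_mctx \<Theta> \<longleftrightarrow> distinct (map fst \<Theta>) \<and>
    (\<forall>k < length \<Theta>. wsc_bdry (depths (take k \<Theta>)) {} 0 (snd (\<Theta> ! k)))"

text \<open>Values of \<open>\<sigma>\<close> and \<open>I\<close> are inserted under binders
  without lifting, since \<open>act_ok\<close> will demand that they have no dangling bound
  variables. The empty \<open>I\<close> gives pure substitution, and \<open>FV\<close> in place of
  \<open>\<sigma>\<close> gives pure instantiation.\<close>

fun act :: "'s inst \<Rightarrow> (var \<Rightarrow> 's expr) \<Rightarrow> 's expr \<Rightarrow> 's expr" where
  "act I \<sigma> (FV a) = \<sigma> a"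
| "act I \<sigma> (BV i) = BV i"
| "act I \<sigma> (Sym S es) = Sym S (map (act I \<sigma>) es)"
| "act I \<sigma> (MApp M ts) =
    (case map_of I M of
       None \<Rightarrow> MApp M (map (act I \<sigma>) ts)
     | Some e \<Rightarrow> arg_app e (map (act I \<sigma>) ts))"
| "act I \<sigma> StarTy = StarTy"
| "act I \<sigma> StarTm = StarTm"
| "act I \<sigma> (Abs e) = Abs (act I \<sigma> e)"

lemma inst_expr_eq_act: "inst_expr I = act I FV"
proof
  show "inst_expr I e = act I FV e" for e
    by (induction e) (auto cong: map_cong split: option.split)
qed

subsection \<open>De Bruijn calculus\<close>

lemma lift_lift: "i \<le> k \<Longrightarrow> lift i (lift k e) = lift (Suc k) (lift i e)"
  by (induction e arbitrary: i k) auto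

lemma bsubst_lift [simp]: "bsubst k t (lift k e) = e"
  by (induction e arbitrary: k t) (auto intro: map_idI)

lemma lift_bsubst_ge:
  "k \<le> j \<Longrightarrow> lift j (bsubst k t e) = bsubst k (lift j t) (lift (Suc j) e)"
  by (induction e arbitrary: j k t) (auto simp: lift_lift)

lemma lift_bsubst_le:
  "j \<le> k \<Longrightarrow> lift j (bsubst k t e) = bsubst (Suc k) (lift j t) (lift j e)"
  by (induction e arbitrary: j k t) (auto simp: lift_lift)

text \<open>The substitution lemma \<open>e[t/x][u/y] = e[u/y][t[u/y]/x]\<close>. While the binder
  of \<open>x\<close> is still present, \<open>y\<close> has the index \<open>Suc j\<close> and
  \<open>u\<close> must be lifted past \<open>x\<close>.\<close>

lemma bsubst_bsubst:
  "k \<le> j \<Longrightarrow> bsubst j u (bsubst k t e) = bsubst k (bsubst j u t) (bsubst (Suc j) (lift k u) e)"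
  by (induction e arbitrary: j k t u) (auto simp: lift_lift lift_bsubst_le)

lemma arg_app_Nil [simp]: "arg_app e [] = e"
  by (cases e) auto

lemma bdry_app_Nil [simp]: "bdry_app B [] = B"
  by (cases B) auto

lemma bdry_doms_Nil [simp]: "bdry_doms B [] = []"
  by (cases B) auto

lemma wsc_mono:
  assumes "wsc \<theta> \<gamma> k n e" "k \<le> k'" "\<gamma> \<subseteq> \<gamma>'" "\<theta> \<subseteq>\<^sub>m \<theta>'"
  shows "wsc \<theta>' \<gamma>' k' n e"
  using assms
proof (induction e arbitrary: k k' n)
  case (Sym S es)
  then show ?case by simp meson
next
  case (MApp M ts)
  then show ?case by (auto simp: map_le_def dom_def)
qed auto

lemma wsc_lift: "wsc \<theta> \<gamma> k n e \<Longrightarrow> wsc \<theta> \<gamma> (Suc k) n (lift j e)"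
proof (induction e arbitrary: k n j)
  case (Sym S es)
  then show ?case by simp meson
qed auto

lemma wsc_bsubst:
  "wsc \<theta> \<gamma> (Suc k) n e \<Longrightarrow> wsc \<theta> \<gamma> k 0 t \<Longrightarrow> j \<le> k \<Longrightarrow> wsc \<theta> \<gamma> k n (bsubst j t e)"
proof (induction e arbitrary: k n j t)
  case (Sym S es)
  then show ?case by simp meson
qed (auto simp: wsc_lift)

lemma lift_closed: "wsc \<theta> \<gamma> k n e \<Longrightarrow> k \<le> j \<Longrightarrow> lift j e = e"
proof (induction e arbitrary: k n j)
  case (Sym S es)
  then show ?case by simp (metis map_idI)
next
  case (MApp M es)
  then show ?case by simp (metis map_idI)
qed auto

lemma bsubst_closed: "wsc \<theta> \<gamma> k n e \<Longrightarrow> k \<le> j \<Longrightarrow> bsubst j t e = e"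
proof (induction e arbitrary: k n j t)
  case (Sym S es)
  then show ?case by simp (metis map_idI)
next
  case (MApp M es)
  then show ?case by simp (metis map_idI)
qed auto

text \<open>Freshness of \<open>a\<close> means that every occurrence of \<open>a\<close> in the
  opened expression stems from the bound variable, so closing it again trades the name for one more
  dangling index.\<close>

lemma wsc_unbsubst:
  "wsc \<theta> (insert a \<gamma>) k n (bsubst j (FV a) e) \<Longrightarrow> j \<le> k \<Longrightarrow> a \<notin> fv e \<Longrightarrow> wsc \<theta> \<gamma> (Suc k) n e"
proof (induction e arbitrary: k n j)
  case (Sym S es)
  then show ?case by simp meson
next
  case (BV i)
  then show ?case by (auto split: if_splits)
qed auto

lemma wsc_fv: "wsc \<theta> \<gamma> k n e \<Longrightarrow> fv e \<subseteq> \<gamma>"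
proof (induction e arbitrary: k n)
  case (Sym S es)
  then show ?case by simp blast
next
  case (MApp M es)
  then show ?case by simp blast
qed auto

lemma wsc_arg_app:
  "wsc \<theta> \<gamma> k n e \<Longrightarrow> length ts = n \<Longrightarrow> \<forall>t\<in>set ts. wsc \<theta> \<gamma> k 0 t \<Longrightarrow> wsc \<theta> \<gamma> k 0 (arg_app e ts)"
proof (induction ts arbitrary: n e)
  case (Cons t ts)
  then obtain e' where e: "e = Abs e'" by (cases e) auto
  then have "wsc \<theta> \<gamma> k (n - 1) (bsubst 0 t e')" using Cons.prems by (simp add: wsc_bsubst)
  then show ?case using Cons e by auto
qed auto

lemma lift_arg_app:
  "wsc \<theta> \<gamma> k n e \<Longrightarrow> length ts = n \<Longrightarrow> \<forall>t\<in>set ts. wsc \<theta> \<gamma> k 0 t \<Longrightarrow>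
    lift j (arg_app e ts) = arg_app (lift j e) (map (lift j) ts)"
proof (induction ts arbitrary: n e)
  case (Cons t ts)
  then obtain e' where e: "e = Abs e'" by (cases e) auto
  then have "wsc \<theta> \<gamma> k (n - 1) (bsubst 0 t e')" using Cons.prems by (simp add: wsc_bsubst)
  then show ?case using Cons e by (auto simp: lift_bsubst_ge)
qed auto

text \<open>The depth \<open>n\<close> provides an \<open>Abs\<close> for every remaining argument.
  Without it \<open>arg_app\<close> could stop at a bound variable, while substituting first might
  put an \<open>Abs\<close> there that goes on consuming arguments.\<close>

lemma bsubst_arg_app:
  "wsc \<theta> \<gamma> k n e \<Longrightarrow> length ts = n \<Longrightarrow> \<forall>t\<in>set ts. wsc \<theta> \<gamma> k 0 t \<Longrightarrow>
    bsubst j u (arg_app e ts) = arg_app (bsubst j u e) (map (bsubst j u) ts)"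
proof (induction ts arbitrary: n e)
  case (Cons t ts)
  then obtain e' where e: "e = Abs e'" by (cases e) auto
  then have "wsc \<theta> \<gamma> k (n - 1) (bsubst 0 t e')" using Cons.prems by (simp add: wsc_bsubst)
  then show ?case using Cons e by (auto simp: bsubst_bsubst)
qed auto

subsection \<open>Simultaneous instantiation and substitution\<close>

text \<open>The scoping part of a morphism. Values have no dangling indices, hence the
  \<open>0\<close>; a metavariable that \<open>I\<close> does not replace must be known to the
  target with the same depth.\<close>

definition act_ok ::
  "(mvar \<Rightarrow> nat option) \<Rightarrow> var set \<Rightarrow> (mvar \<Rightarrow> nat option) \<Rightarrow> var set \<Rightarrow> 's inst \<Rightarrow> (var \<Rightarrow> 's expr) \<Rightarrow> bool"
where
  "act_ok \<theta> \<gamma> \<theta>' \<gamma>' I \<sigma> \<longleftrightarrow>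
    (\<forall>a\<in>\<gamma>. wsc \<theta>' \<gamma>' 0 0 (\<sigma> a)) \<and>
    (\<forall>M n. \<theta> M = Some n \<longrightarrow>
      (case map_of I M of None \<Rightarrow> \<theta>' M = Some n | Some e \<Rightarrow> wsc \<theta>' \<gamma>' 0 n e))"

lemma act_ok_var: "act_ok \<theta> \<gamma> \<theta>' \<gamma>' I \<sigma> \<Longrightarrow> a \<in> \<gamma> \<Longrightarrow> wsc \<theta>' \<gamma>' k 0 (\<sigma> a)"
  unfolding act_ok_def by (meson wsc_mono le0 order_refl map_le_refl)

lemma act_ok_None: "act_ok \<theta> \<gamma> \<theta>' \<gamma>' I \<sigma> \<Longrightarrow> \<theta> M = Some n \<Longrightarrow> map_of I M = None \<Longrightarrow> \<theta>' M = Some n"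
  unfolding act_ok_def by fastforce

lemma act_ok_Some:
  "act_ok \<theta> \<gamma> \<theta>' \<gamma>' I \<sigma> \<Longrightarrow> \<theta> M = Some n \<Longrightarrow> map_of I M = Some e \<Longrightarrow> wsc \<theta>' \<gamma>' k n e"
  unfolding act_ok_def by (metis (no_types, lifting) wsc_mono le0 order_refl map_le_refl option.simps(5))

lemma wsc_act:
  "act_ok \<theta> \<gamma> \<theta>' \<gamma>' I \<sigma> \<Longrightarrow> wsc \<theta> \<gamma> k n e \<Longrightarrow> wsc \<theta>' \<gamma>' k n (act I \<sigma> e)"
proof (induction e arbitrary: k n)
  case (Sym S es)
  then show ?case by simp meson
next
  case (MApp M ts)
  have ts: "wsc \<theta>' \<gamma>' k 0 (act I \<sigma> t)" if "t \<in> set ts" for t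
    using MApp that by simp
  show ?case
  proof (cases "map_of I M")
    case None
    then show ?thesis using MApp.prems ts by (simp add: act_ok_None)
  next
    case (Some e)
    then have "wsc \<theta>' \<gamma>' k (length ts) e" using MApp.prems act_ok_Some by fastforce
    then have "wsc \<theta>' \<gamma>' k 0 (arg_app e (map (act I \<sigma>) ts))"
      using ts by (intro wsc_arg_app) auto
    then show ?thesis using Some MApp.prems by simp
  qed
qed (auto simp: act_ok_var)

text \<open>At an instantiated metavariable, lifting passes through \<open>arg_app\<close> by depth,
  and the inserted argument is closed and therefore fixed. The same two facts drive
  \<open>act_bsubst\<close>, which needs this lemma when it goes under \<open>Abs\<close>.\<close>

lemma act_lift:
  "act_ok \<theta> \<gamma> \<theta>' \<gamma>' I \<sigma> \<Longrightarrow> wsc \<theta> \<gamma> k n e \<Longrightarrow> act I \<sigma> (lift j e) = lift j (act I \<sigma> e)"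
proof (induction e arbitrary: k n j)
  case (FV a)
  then show ?case using lift_closed[OF act_ok_var[OF FV(1), of a 0], of j] by simp
next
  case (Sym S es)
  then show ?case by simp meson
next
  case (MApp M ts)
  have ih: "map (\<lambda>x. act I \<sigma> (lift j x)) ts = map (\<lambda>x. lift j (act I \<sigma> x)) ts"
    using MApp by simp blast
  show ?case
  proof (cases "map_of I M")
    case None
    then show ?thesis using ih by (simp add: o_def)
  next
    case (Some e)
    have w: "wsc \<theta>' \<gamma>' 0 (length ts) e"
      using MApp.prems Some by (auto intro: act_ok_Some)
    then have "wsc \<theta>' \<gamma>' k (length ts) e"
      by (rule wsc_mono) auto
    then have "lift j (arg_app e (map (act I \<sigma>) ts)) = arg_app (lift j e) (map (lift j) (map (act I \<sigma>) ts))"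
      using MApp.prems by (intro lift_arg_app[of \<theta>' \<gamma>' k "length ts"]) (auto intro: wsc_act)
    then show ?thesis using ih Some lift_closed[OF w, of j] by (simp add: o_def del: map_eq_conv)
  qed
qed auto

lemma act_bsubst:
  "act_ok \<theta> \<gamma> \<theta>' \<gamma>' I \<sigma> \<Longrightarrow> wsc \<theta> \<gamma> (Suc k) n e \<Longrightarrow> wsc \<theta> \<gamma> k 0 t \<Longrightarrow>
    act I \<sigma> (bsubst j t e) = bsubst j (act I \<sigma> t) (act I \<sigma> e)"
proof (induction e arbitrary: k n j t)
  case (FV a)
  then show ?case using bsubst_closed[OF act_ok_var[OF FV(1), of a 0], of j] by simp
next
  case (Sym S es)
  then show ?case by simp meson
next
  case (MApp M ts)
  have ih: "map (\<lambda>x. act I \<sigma> (bsubst j t x)) ts = map (\<lambda>x. bsubst j (act I \<sigma> t) (act I \<sigma> x)) ts"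
    using MApp by simp blast
  show ?case
  proof (cases "map_of I M")
    case None
    then show ?thesis using ih by (simp add: o_def)
  next
    case (Some e)
    have w: "wsc \<theta>' \<gamma>' 0 (length ts) e"
      using MApp.prems Some by (auto intro: act_ok_Some)
    then have "wsc \<theta>' \<gamma>' (Suc k) (length ts) e"
      by (rule wsc_mono) auto
    then have "bsubst j (act I \<sigma> t) (arg_app e (map (act I \<sigma>) ts)) =
        arg_app (bsubst j (act I \<sigma> t) e) (map (bsubst j (act I \<sigma> t)) (map (act I \<sigma>) ts))"
      using MApp.prems by (intro bsubst_arg_app[of \<theta>' \<gamma>' "Suc k" "length ts"]) (auto intro: wsc_act)
    then show ?thesis using ih Some bsubst_closed[OF w, of j] by (simp add: o_def del: map_eq_conv)
  qed
next
  case (Abs e)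
  then show ?case by (auto simp: wsc_lift act_lift)
qed auto

lemma act_arg_app:
  "act_ok \<theta> \<gamma> \<theta>' \<gamma>' I \<sigma> \<Longrightarrow> wsc \<theta> \<gamma> k n e \<Longrightarrow> length ts = n \<Longrightarrow> \<forall>t\<in>set ts. wsc \<theta> \<gamma> k 0 t \<Longrightarrow>
    act I \<sigma> (arg_app e ts) = arg_app (act I \<sigma> e) (map (act I \<sigma>) ts)"
proof (induction ts arbitrary: n e)
  case (Cons t ts)
  then obtain e' where e: "e = Abs e'" by (cases e) auto
  then have "act I \<sigma> (bsubst 0 t e') = bsubst 0 (act I \<sigma> t) (act I \<sigma> e')"
    using Cons.prems by (intro act_bsubst[of \<theta> \<gamma> \<theta>' \<gamma>' I \<sigma> k "n - 1"]) auto
  moreover have "wsc \<theta> \<gamma> k (n - 1) (bsubst 0 t e')" using Cons.prems e by (simp add: wsc_bsubst)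
  ultimately show ?case using Cons e by auto
qed auto

text \<open>\<open>K\<close> and \<open>\<rho>\<close> are any pair that behaves as the composite on
  the metavariables and variables in scope. Leaving the composite open spares a choice of its values
  elsewhere.\<close>

lemma act_act:
  assumes I: "act_ok \<theta> \<gamma> \<theta>' \<gamma>' I \<sigma>" and J: "act_ok \<theta>' \<gamma>' \<theta>'' \<gamma>'' J \<tau>"
    and \<rho>: "\<And>a. a \<in> \<gamma> \<Longrightarrow> \<rho> a = act J \<tau> (\<sigma> a)"
    and K: "\<And>M n. \<theta> M = Some n \<Longrightarrow>
      map_of K M = (case map_of I M of None \<Rightarrow> map_of J M | Some e \<Rightarrow> Some (act J \<tau> e))"
  shows "wsc \<theta> \<gamma> k n e \<Longrightarrow> act J \<tau> (act I \<sigma> e) = act K \<rho> e"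
proof (induction e arbitrary: k n)
  case (FV a)
  then show ?case using \<rho> by simp
next
  case (Sym S es)
  then show ?case by simp meson
next
  case (MApp M ts)
  then have ih: "map (act J \<tau>) (map (act I \<sigma>) ts) = map (act K \<rho>) ts"
    by simp blast
  from MApp.prems have M: "\<theta> M = Some (length ts)" by simp
  show ?case
  proof (cases "map_of I M")
    case None
    then show ?thesis using K[OF M] by (simp only: act.simps option.case ih)
  next
    case (Some e)
    have w: "wsc \<theta>' \<gamma>' k (length ts) e"
      using I M Some by (auto intro: act_ok_Some)
    have "act J \<tau> (arg_app e (map (act I \<sigma>) ts)) = arg_app (act J \<tau> e) (map (act J \<tau>) (map (act I \<sigma>) ts))"
      using MApp.prems by (intro act_arg_app[OF J w]) (auto intro: wsc_act[OF I])
    then show ?thesis using ih K[OF M] Some by (simp del: map_eq_conv map_map)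
  qed
qed auto

lemma act_cong:
  assumes "\<And>a. a \<in> \<gamma> \<Longrightarrow> \<sigma> a = \<tau> a" "\<And>M n. \<theta> M = Some n \<Longrightarrow> map_of I M = map_of J M"
  shows "wsc \<theta> \<gamma> k n e \<Longrightarrow> act I \<sigma> e = act J \<tau> e"
proof (induction e arbitrary: k n)
  case (Sym S es)
  then show ?case by simp meson
next
  case (MApp M ts)
  then have "map (act I \<sigma>) ts = map (act J \<tau>) ts" by simp blast
  then show ?case using MApp.prems assms(2)[of M] by (auto simp del: map_eq_conv split: option.split)
qed (auto simp: assms(1))

lemma act_ident:
  assumes "\<And>a. a \<in> \<gamma> \<Longrightarrow> \<sigma> a = FV a" "\<And>M n. \<theta> M = Some n \<Longrightarrow> map_of I M = None"
  shows "wsc \<theta> \<gamma> k n e \<Longrightarrow> act I \<sigma> e = e"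
proof (induction e arbitrary: k n)
  case (Sym S es)
  then show ?case by simp (meson map_idI)
next
  case (MApp M ts)
  then have "map (act I \<sigma>) ts = ts" by simp (meson map_idI)
  with MApp.prems assms(2) show ?case by auto
qed (auto simp: assms)

subsection \<open>Judgements and boundaries\<close>

text \<open>\<open>inst_eq\<close> with arbitrary maps in place of two instantiations, so that it
  also serves two substitutions. Types are taken from the left map throughout.\<close>

fun jdg_eq :: "('e \<Rightarrow> 'e) \<Rightarrow> ('e \<Rightarrow> 'e) \<Rightarrow> 'e jdg \<Rightarrow> 'e jdg" where
  "jdg_eq f g (JTh (TyJ A)) = JTh (EqTyJ (f A) (g A))"
| "jdg_eq f g (JTh (TmJ t A)) = JTh (EqTmJ (f t) (g t) (f A))"
| "jdg_eq f g (JAbs A \<J>) = JAbs (f A) (jdg_eq f g \<J>)"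

lemma inst_eq_eq_jdg_eq: "obj_jdg \<J> \<Longrightarrow> inst_eq I J \<J> = jdg_eq (act I FV) (act J FV) \<J>"
proof (induction \<J>)
  case (JTh j)
  then show ?case by (cases j) (auto simp: inst_expr_eq_act)
qed (auto simp: inst_expr_eq_act)

lemma wsc_jdg_mono:
  "wsc_jdg \<theta> \<gamma> k \<J> \<Longrightarrow> k \<le> k' \<Longrightarrow> \<gamma> \<subseteq> \<gamma>' \<Longrightarrow> \<theta> \<subseteq>\<^sub>m \<theta>' \<Longrightarrow> wsc_jdg \<theta>' \<gamma>' k' \<J>"
  by (induction \<J> arbitrary: k k') (auto intro: wsc_mono)

lemma wsc_bdry_mono:
  "wsc_bdry \<theta> \<gamma> k B \<Longrightarrow> k \<le> k' \<Longrightarrow> \<gamma> \<subseteq> \<gamma>' \<Longrightarrow> \<theta> \<subseteq>\<^sub>m \<theta>' \<Longrightarrow> wsc_bdry \<theta>' \<gamma>' k' B"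
  by (induction B arbitrary: k k') (auto intro: wsc_mono)

lemma wsc_bdry_bsubst:
  "wsc_bdry \<theta> \<gamma> (Suc k) B \<Longrightarrow> wsc \<theta> \<gamma> k 0 t \<Longrightarrow> j \<le> k \<Longrightarrow> wsc_bdry \<theta> \<gamma> k (bdry_bsubst j t B)"
  by (induction B arbitrary: k j t) (auto simp: bthesis.set_map wsc_bsubst wsc_lift)

lemma wsc_jdg_unbsubst:
  "wsc_jdg \<theta> (insert a \<gamma>) k (jdg_bsubst j (FV a) \<J>) \<Longrightarrow> j \<le> k \<Longrightarrow> a \<notin> fv_jdg \<J> \<Longrightarrow>
    wsc_jdg \<theta> \<gamma> (Suc k) \<J>"
  by (induction \<J> arbitrary: k j) (auto simp: fv_jdg_def jthesis.set_map wsc_unbsubst)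

lemma wsc_bdry_unbsubst:
  "wsc_bdry \<theta> (insert a \<gamma>) k (bdry_bsubst j (FV a) B) \<Longrightarrow> j \<le> k \<Longrightarrow> a \<notin> fv_bdry B \<Longrightarrow>
    wsc_bdry \<theta> \<gamma> (Suc k) B"
  by (induction B arbitrary: k j) (auto simp: fv_bdry_def bthesis.set_map wsc_unbsubst)

lemma wsc_jdg_fv: "wsc_jdg \<theta> \<gamma> k \<J> \<Longrightarrow> fv_jdg \<J> \<subseteq> \<gamma>"
  by (induction \<J> arbitrary: k) (auto simp: fv_jdg_def dest: wsc_fv)

lemma wsc_bdry_fv: "wsc_bdry \<theta> \<gamma> k B \<Longrightarrow> fv_bdry B \<subseteq> \<gamma>"
  by (induction B arbitrary: k) (auto simp: fv_bdry_def dest: wsc_fv)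

lemma wsc_jdg_act:
  "act_ok \<theta> \<gamma> \<theta>' \<gamma>' I \<sigma> \<Longrightarrow> wsc_jdg \<theta> \<gamma> k \<J> \<Longrightarrow> wsc_jdg \<theta>' \<gamma>' k (map_jdg (act I \<sigma>) \<J>)"
  by (induction \<J> arbitrary: k) (auto simp: jthesis.set_map wsc_act)

lemma wsc_bdry_act:
  "act_ok \<theta> \<gamma> \<theta>' \<gamma>' I \<sigma> \<Longrightarrow> wsc_bdry \<theta> \<gamma> k B \<Longrightarrow> wsc_bdry \<theta>' \<gamma>' k (map_bdry (act I \<sigma>) B)"
  by (induction B arbitrary: k) (auto simp: bthesis.set_map wsc_act)

lemma map_jdg_bsubst:
  "act_ok \<theta> \<gamma> \<theta>' \<gamma>' I \<sigma> \<Longrightarrow> wsc_jdg \<theta> \<gamma> (Suc k) \<J> \<Longrightarrow> wsc \<theta> \<gamma> k 0 t \<Longrightarrow>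
    map_jdg (act I \<sigma>) (jdg_bsubst j t \<J>) = jdg_bsubst j (act I \<sigma> t) (map_jdg (act I \<sigma>) \<J>)"
  by (induction \<J> arbitrary: k j t)
    (auto simp: jthesis.map_comp act_bsubst wsc_lift act_lift intro!: jthesis.map_cong)

lemma map_bdry_bsubst:
  "act_ok \<theta> \<gamma> \<theta>' \<gamma>' I \<sigma> \<Longrightarrow> wsc_bdry \<theta> \<gamma> (Suc k) B \<Longrightarrow> wsc \<theta> \<gamma> k 0 t \<Longrightarrow>
    map_bdry (act I \<sigma>) (bdry_bsubst j t B) = bdry_bsubst j (act I \<sigma> t) (map_bdry (act I \<sigma>) B)"
  by (induction B arbitrary: k j t)
    (auto simp: bthesis.map_comp act_bsubst wsc_lift act_lift intro!: bthesis.map_cong)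

lemma obj_jdg_bsubst [simp]: "obj_jdg (jdg_bsubst k t \<J>) = obj_jdg \<J>"
proof (induction \<J> arbitrary: k t)
  case (JTh j)
  then show ?case by (cases j) auto
qed auto

lemma bdry_arity_map [simp]: "bdry_arity (map_bdry f B) = bdry_arity B"
proof (induction B)
  case (BTh b)
  then show ?case by (cases b) auto
qed auto

lemma bdry_arity_bsubst [simp]: "bdry_arity (bdry_bsubst k t B) = bdry_arity B"
proof (induction B arbitrary: k t)
  case (BTh b)
  then show ?case by (cases b) auto
qed auto

lemma obj_bthesis_map [simp]: "obj_bthesis (map_bthesis f b) = obj_bthesis b"
  by (cases b) auto

lemma obj_bdry_map [simp]: "obj_bdry (map_bdry f B) = obj_bdry B"
  by (induction B) auto

lemma obj_bdry_bsubst [simp]: "obj_bdry (bdry_bsubst k t B) = obj_bdry B"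
  by (induction B arbitrary: k t) auto

lemma bthesis_of_map [simp]: "bthesis_of (map_jthesis f j) = map_bthesis f (bthesis_of j)"
  by (cases j) auto

text \<open>The two sides of the resulting equation receive one and the same term, hence the
  requirement that both morphisms agree on \<open>t\<close>. It is met under a binder, where both
  are extended by the same fresh variable.\<close>

lemma jdg_eq_bsubst:
  "act_ok \<theta> \<gamma> \<theta>' \<gamma>' I \<sigma> \<Longrightarrow> act_ok \<theta> \<gamma> \<theta>' \<gamma>' J \<tau> \<Longrightarrow> wsc_jdg \<theta> \<gamma> (Suc k) \<J> \<Longrightarrow> wsc \<theta> \<gamma> k 0 t \<Longrightarrow>
    obj_jdg \<J> \<Longrightarrow> act I \<sigma> t = act J \<tau> t \<Longrightarrow>
    jdg_eq (act I \<sigma>) (act J \<tau>) (jdg_bsubst j t \<J>) =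
    jdg_bsubst j (act I \<sigma> t) (jdg_eq (act I \<sigma>) (act J \<tau>) \<J>)"
proof (induction \<J> arbitrary: k j t)
  case (JTh th)
  then show ?case
    by (cases th) (auto simp: act_bsubst[of \<theta> \<gamma> _ _ I] act_bsubst[of \<theta> \<gamma> _ _ J])
next
  case (JAbs A \<J>)
  have l: "act I \<sigma> (lift 0 t) = lift 0 (act I \<sigma> t)" "act J \<tau> (lift 0 t) = lift 0 (act J \<tau> t)"
    using JAbs.prems act_lift by blast+
  have "act I \<sigma> (bsubst j t A) = bsubst j (act I \<sigma> t) (act I \<sigma> A)"
    using JAbs.prems by (intro act_bsubst) auto
  moreover have "jdg_eq (act I \<sigma>) (act J \<tau>) (jdg_bsubst (Suc j) (lift 0 t) \<J>) =
      jdg_bsubst (Suc j) (act I \<sigma> (lift 0 t)) (jdg_eq (act I \<sigma>) (act J \<tau>) \<J>)"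
    using JAbs.prems l by (intro JAbs.IH[of "Suc k"]) (auto simp: wsc_lift)
  ultimately show ?case using l by simp
qed

lemma map_jdg_act_cong:
  assumes "\<And>a. a \<in> \<gamma> \<Longrightarrow> \<sigma> a = \<tau> a" "\<And>M n. \<theta> M = Some n \<Longrightarrow> map_of I M = map_of J M"
  shows "wsc_jdg \<theta> \<gamma> k \<J> \<Longrightarrow> map_jdg (act I \<sigma>) \<J> = map_jdg (act J \<tau>) \<J>"
proof (induction \<J> arbitrary: k)
  case (JTh j)
  then show ?case using act_cong[OF assms] by (auto intro!: jthesis.map_cong)
next
  case (JAbs A \<J>)
  then show ?case using act_cong[OF assms] by auto
qed

lemma map_bdry_act_cong:
  assumes "\<And>a. a \<in> \<gamma> \<Longrightarrow> \<sigma> a = \<tau> a" "\<And>M n. \<theta> M = Some n \<Longrightarrow> map_of I M = map_of J M"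
  shows "wsc_bdry \<theta> \<gamma> k B \<Longrightarrow> map_bdry (act I \<sigma>) B = map_bdry (act J \<tau>) B"
proof (induction B arbitrary: k)
  case (BTh j)
  then show ?case using act_cong[OF assms] by (auto intro!: bthesis.map_cong)
next
  case (BAbs A B)
  then show ?case using act_cong[OF assms] by auto
qed

lemma map_bdry_act_ident:
  assumes "\<And>a. a \<in> \<gamma> \<Longrightarrow> \<sigma> a = FV a" "\<And>M n. \<theta> M = Some n \<Longrightarrow> map_of I M = None"
  shows "wsc_bdry \<theta> \<gamma> k B \<Longrightarrow> map_bdry (act I \<sigma>) B = B"
proof (induction B arbitrary: k)
  case (BTh b)
  then show ?case using act_ident[OF assms] by (cases b) auto
next
  case (BAbs A B)
  then show ?case using act_ident[OF assms] by auto
qed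

lemma map_jdg_act_ident:
  assumes "\<And>a. a \<in> \<gamma> \<Longrightarrow> \<sigma> a = FV a" "\<And>M n. \<theta> M = Some n \<Longrightarrow> map_of I M = None"
  shows "wsc_jdg \<theta> \<gamma> k \<J> \<Longrightarrow> map_jdg (act I \<sigma>) \<J> = \<J>"
proof (induction \<J> arbitrary: k)
  case (JTh j)
  then show ?case using act_ident[OF assms] by (cases j) auto
next
  case (JAbs A B)
  then show ?case using act_ident[OF assms] by auto
qed

lemma jdg_eq_act_cong:
  assumes "\<And>a. a \<in> \<gamma> \<Longrightarrow> \<sigma> a = \<sigma>' a" "\<And>a. a \<in> \<gamma> \<Longrightarrow> \<tau> a = \<tau>' a"
  shows "wsc_jdg \<theta> \<gamma> k \<J> \<Longrightarrow> obj_jdg \<J> \<Longrightarrow>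
    jdg_eq (act I \<sigma>) (act J \<tau>) \<J> = jdg_eq (act I \<sigma>') (act J \<tau>') \<J>"
proof (induction \<J> arbitrary: k)
  case (JTh j)
  then show ?case
    using act_cong[of \<gamma> \<sigma> \<sigma>' \<theta> I I, OF assms(1)] act_cong[of \<gamma> \<tau> \<tau>' \<theta> J J, OF assms(2)]
    by (cases j) auto
next
  case (JAbs A \<J>)
  then show ?case using act_cong[of \<gamma> \<sigma> \<sigma>' \<theta> I I, OF assms(1)] by auto
qed

subsection \<open>Filling\<close>

text \<open>An instantiation is known only through its filled judgements; reading the equivalence
  from left to right recovers the depth of its entries from their derivability.\<close>

lemma fill_wsc:
  "fill B e = Some \<J> \<Longrightarrow> wsc_jdg \<theta> \<gamma> k \<J> \<longleftrightarrow> wsc_bdry \<theta> \<gamma> k B \<and> wsc \<theta> \<gamma> k (bdry_depth B) e"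
proof (induction B e arbitrary: \<J> k rule: fill.induct)
  case (1 b e)
  then show ?case by (cases b) (auto split: if_splits)
qed auto

lemma fill_obj: "fill B e = Some \<J> \<Longrightarrow> obj_jdg \<J> = obj_bdry B"
proof (induction B e arbitrary: \<J> rule: fill.induct)
  case (1 b e)
  then show ?case by (cases b) (auto split: if_splits)
qed auto

lemma fill_act:
  "fill B e = Some \<J> \<Longrightarrow> fill (map_bdry (act I \<sigma>) B) (act I \<sigma> e) = Some (map_jdg (act I \<sigma>) \<J>)"
proof (induction B e arbitrary: \<J> rule: fill.induct)
  case (1 b e)
  then show ?case by (cases b) (auto split: if_splits)
qed auto

lemma fill_bsubst:
  "fill B e = Some \<J> \<Longrightarrow> fill (bdry_bsubst k t B) (bsubst k t e) = Some (jdg_bsubst k t \<J>)"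
proof (induction B e arbitrary: \<J> k t rule: fill.induct)
  case (1 b e)
  then show ?case by (cases b) (auto split: if_splits)
qed auto

lemma fill_eq_act:
  "fill_eq B e f = Some \<J> \<Longrightarrow>
    fill_eq (map_bdry (act I \<sigma>) B) (act I \<sigma> e) (act I \<sigma> f) = Some (map_jdg (act I \<sigma>) \<J>)"
  by (induction B e f arbitrary: \<J> rule: fill_eq.induct) auto

lemma fill_eq_bsubst:
  "fill_eq B e f = Some \<J> \<Longrightarrow>
    fill_eq (bdry_bsubst k t B) (bsubst k t e) (bsubst k t f) = Some (jdg_bsubst k t \<J>)"
  by (induction B e f arbitrary: \<J> k t rule: fill_eq.induct) auto

text \<open>Both \<open>fill_eq\<close> over the left boundary and \<open>jdg_eq\<close> take their
  types from the left, so comparing two morphisms on a filled boundary produces exactly the equation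
  of its two translated heads.\<close>

lemma fill_eq_of_fill:
  "fill B e = Some \<J> \<Longrightarrow> obj_bdry B \<Longrightarrow>
    fill_eq (map_bdry (act I \<sigma>) B) (act I \<sigma> e) (act J \<tau> e) =
    Some (jdg_eq (act I \<sigma>) (act J \<tau>) \<J>)"
proof (induction B e arbitrary: \<J> rule: fill.induct)
  case (1 b e)
  then show ?case by (cases b) auto
qed auto

lemma map_bdry_app:
  "act_ok \<theta> \<gamma> \<theta>' \<gamma>' I \<sigma> \<Longrightarrow> wsc_bdry \<theta> \<gamma> k B \<Longrightarrow> \<forall>t\<in>set ts. wsc \<theta> \<gamma> k 0 t \<Longrightarrow>
    map_bdry (act I \<sigma>) (bdry_app B ts) = bdry_app (map_bdry (act I \<sigma>) B) (map (act I \<sigma>) ts)"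
proof (induction ts arbitrary: B)
  case (Cons t ts)
  then show ?case by (cases B) (auto simp: wsc_bdry_bsubst map_bdry_bsubst)
qed auto

lemma map_bdry_doms:
  "act_ok \<theta> \<gamma> \<theta>' \<gamma>' I \<sigma> \<Longrightarrow> wsc_bdry \<theta> \<gamma> k B \<Longrightarrow> \<forall>t\<in>set ts. wsc \<theta> \<gamma> k 0 t \<Longrightarrow>
    map (act I \<sigma>) (bdry_doms B ts) = bdry_doms (map_bdry (act I \<sigma>) B) (map (act I \<sigma>) ts)"
proof (induction ts arbitrary: B)
  case (Cons t ts)
  then show ?case by (cases B) (auto simp: wsc_bdry_bsubst map_bdry_bsubst)
qed auto

lemma length_bdry_doms: "length ts = bdry_depth B \<Longrightarrow> length (bdry_doms B ts) = length ts"
proof (induction ts arbitrary: B)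
  case (Cons t ts)
  then show ?case by (cases B) auto
qed auto

subsection \<open>Metavariable contexts and instantiations\<close>

lemma depths_mem: "distinct (map fst \<Theta>) \<Longrightarrow> (M, B) \<in> set \<Theta> \<Longrightarrow> depths \<Theta> M = Some (bdry_depth B)"
  unfolding depths_def by (induction \<Theta>) force+

lemma depths_SomeD: "depths \<Theta> M = Some n \<Longrightarrow> \<exists>k < length \<Theta>. fst (\<Theta> ! k) = M \<and> bdry_depth (snd (\<Theta> ! k)) = n"
  unfolding depths_def by (drule map_of_SomeD) (clarsimp simp: in_set_conv_nth, metis fst_conv snd_conv)

lemma depths_None: "depths \<Theta> M = None \<longleftrightarrow> M \<notin> fst ` set \<Theta>"
  unfolding depths_def by (force simp: map_of_eq_None_iff)

lemma depths_append: "depths (\<Theta> @ \<Theta>') = depths \<Theta>' ++ depths \<Theta>"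
  unfolding depths_def by simp

text \<open>\<open>map_of\<close> prefers earlier entries, so a prefix agrees with the whole list
  wherever the prefix is defined.\<close>

lemma depths_take: "depths (take k \<Theta>) \<subseteq>\<^sub>m depths \<Theta>"
proof -
  have "depths \<Theta> = depths (drop k \<Theta>) ++ depths (take k \<Theta>)"
    by (metis depths_append append_take_drop_id)
  then show ?thesis by (metis map_le_map_add)
qed

lemma map_of_take:
  assumes "M \<in> fst ` set (take k K)"
  shows "map_of (take k K) M = map_of K M"
proof -
  have "map_of K = map_of (drop k K) ++ map_of (take k K)"
    by (metis map_of_append append_take_drop_id)
  moreover have "map_of (take k K) M \<noteq> None"
    using assms by (metis map_of_eq_None_iff)
  ultimately show ?thesis by (auto simp: map_add_def split: option.splits)
qed

lemma wsc_mctx_mem: "wsc_mctx \<Theta> \<Longrightarrow> (M, B) \<in> set \<Theta> \<Longrightarrow> wsc_bdry (depths \<Theta>) {} 0 B"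
  unfolding wsc_mctx_def in_set_conv_nth
  by (metis wsc_bdry_mono depths_take le_refl order_refl snd_conv)

lemma wsc_mctx_take: "wsc_mctx \<Theta> \<Longrightarrow> wsc_mctx (take k \<Theta>)"
  unfolding wsc_mctx_def by (auto simp: take_map[symmetric] min_def)

lemma inst_holds_take: "inst_holds D \<Xi> K \<Longrightarrow> inst_holds D (take m \<Xi>) (take m K)"
  unfolding inst_holds_def by (auto simp: take_map[symmetric] min_def)

lemma inst_eq_holds_take: "inst_eq_holds D \<Xi> K L \<Longrightarrow> inst_eq_holds D (take m \<Xi>) (take m K) (take m L)"
  unfolding inst_eq_holds_def by (auto simp: min_def)

text \<open>An instantiation of \<open>\<Xi>\<close> has an entry for each of its metavariables, so
  the \<open>Some\<close> case of \<open>act_ok\<close> is the relevant one. The predicate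
  \<open>D\<close> is kept abstract because inside an induction on derivations it is derivability
  together with the induction hypothesis.\<close>

lemma inst_holds_act_ok:
  assumes K: "inst_holds D \<Xi> K" and D: "\<And>\<J>. D \<J> \<Longrightarrow> wsc_jdg \<theta> \<gamma> 0 \<J>" and d: "distinct (map fst \<Xi>)"
  shows "act_ok (depths \<Xi>) {} \<theta> \<gamma> K \<sigma>"
  unfolding act_ok_def
proof (intro conjI allI impI ballI)
  fix M n assume "depths \<Xi> M = Some n"
  then obtain k where k: "k < length \<Xi>" "fst (\<Xi> ! k) = M" "bdry_depth (snd (\<Xi> ! k)) = n"
    using depths_SomeD by metis
  have f: "map fst K = map fst \<Xi>" using K by (simp add: inst_holds_def)
  then have k': "k < length K" "fst (K ! k) = M"
    using k by (metis length_map, metis length_map nth_map)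
  then have "(M, snd (K ! k)) \<in> set K" by (metis nth_mem prod.collapse)
  then have m: "map_of K M = Some (snd (K ! k))" using d f by (metis map_of_is_SomeI)
  obtain \<J> where "fill (inst_bdry (take k K) (snd (\<Xi> ! k))) (snd (K ! k)) = Some \<J>" "D \<J>"
    using K k unfolding inst_holds_def by blast
  then have "wsc \<theta> \<gamma> 0 n (snd (K ! k))" using D fill_wsc k by fastforce
  then show "case map_of K M of None \<Rightarrow> \<theta> M = Some n | Some e \<Rightarrow> wsc \<theta> \<gamma> 0 n e"
    using m by simp
qed auto

section \<open>Composing an instantiation with a morphism\<close>

definition act_inst :: "'s inst \<Rightarrow> (var \<Rightarrow> 's expr) \<Rightarrow> 's inst \<Rightarrow> 's inst" where
  "act_inst I \<sigma> K = map (\<lambda>(M, e). (M, act I \<sigma> e)) K"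

lemma map_of_act_inst: "map_of (act_inst I \<sigma> K) M = map_option (act I \<sigma>) (map_of K M)"
  unfolding act_inst_def by (induction K) auto

lemma take_act_inst: "take k (act_inst I \<sigma> K) = act_inst I \<sigma> (take k K)"
  by (simp add: act_inst_def take_map)

text \<open>\<open>K\<close> already replaces every metavariable of \<open>\<Xi>\<close>, so
  afterwards \<open>I\<close> and \<open>\<sigma>\<close> can act only inside the entries of
  \<open>K\<close>: the composite is again an instantiation of \<open>\<Xi>\<close>.\<close>

lemma act_inst_expr:
  assumes K: "act_ok (depths \<Xi>) {} \<theta> \<gamma> K FV" and f: "map fst K = map fst \<Xi>"
    and I: "act_ok \<theta> \<gamma> \<theta>' \<gamma>' I \<sigma>" and e: "wsc (depths \<Xi>) {} k n e"
  shows "act I \<sigma> (inst_expr K e) = inst_expr (act_inst I \<sigma> K) e"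
  unfolding inst_expr_eq_act
proof (rule act_act[OF K I _ _ e])
  fix M n assume "depths \<Xi> M = Some n"
  then have "M \<in> fst ` set K"
    using f by (metis depths_None option.distinct(1) list.set_map)
  then obtain e where "map_of K M = Some e"
    by (metis map_of_eq_None_iff not_None_eq)
  then show "map_of (act_inst I \<sigma> K) M =
      (case map_of K M of None \<Rightarrow> map_of I M | Some e \<Rightarrow> Some (act I \<sigma> e))"
    by (simp add: map_of_act_inst)
qed auto

lemma act_inst_jthesis:
  assumes "act_ok (depths \<Xi>) {} \<theta> \<gamma> K FV" "map fst K = map fst \<Xi>"
    "act_ok \<theta> \<gamma> \<theta>' \<gamma>' I \<sigma>" "wsc_jdg (depths \<Xi>) {} k (JTh j)"
  shows "map_jthesis (act I \<sigma>) (inst_jthesis K j) = inst_jthesis (act_inst I \<sigma> K) j"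
  using assms by (auto simp: jthesis.map_comp intro!: jthesis.map_cong act_inst_expr)

lemma act_inst_bdry:
  assumes "act_ok (depths \<Xi>) {} \<theta> \<gamma> K FV" "map fst K = map fst \<Xi>" "act_ok \<theta> \<gamma> \<theta>' \<gamma>' I \<sigma>"
  shows "wsc_bdry (depths \<Xi>) {} k B \<Longrightarrow>
    map_bdry (act I \<sigma>) (inst_bdry K B) = inst_bdry (act_inst I \<sigma> K) B"
proof (induction B arbitrary: k)
  case (BTh b)
  then show ?case using assms
    by (auto simp: bthesis.map_comp intro!: bthesis.map_cong act_inst_expr)
next
  case (BAbs A B)
  then show ?case using assms by (auto intro: act_inst_expr)
qed

text \<open>\<open>inst_holds\<close> speaks of restricted instantiations, and the boundary at
  position \<open>k\<close> is scoped over the first \<open>k\<close> metavariables; on it the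
  restriction of \<open>K\<close> is total, so the composition law applies.\<close>

lemma act_inst_prefix:
  assumes K: "inst_holds D \<Xi> K" and \<Xi>: "wsc_mctx \<Xi>" and D: "\<And>\<J>. D \<J> \<Longrightarrow> wsc_jdg \<theta> \<gamma> 0 \<J>"
    and I: "act_ok \<theta> \<gamma> \<theta>' \<gamma>' I \<sigma>" and k: "k < length \<Xi>"
  shows "inst_bdry (take k (act_inst I \<sigma> K)) (snd (\<Xi> ! k)) =
    map_bdry (act I \<sigma>) (inst_bdry (take k K) (snd (\<Xi> ! k)))"
proof -
  have t: "inst_holds D (take k \<Xi>) (take k K)" using K by (rule inst_holds_take)
  have "act_ok (depths (take k \<Xi>)) {} \<theta> \<gamma> (take k K) FV"
    using \<Xi> wsc_mctx_take wsc_mctx_def by (intro inst_holds_act_ok[OF t D]) blast+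
  moreover have "map fst (take k K) = map fst (take k \<Xi>)"
    using t by (simp add: inst_holds_def)
  moreover have "wsc_bdry (depths (take k \<Xi>)) {} 0 (snd (\<Xi> ! k))"
    using \<Xi> k by (simp add: wsc_mctx_def)
  ultimately show ?thesis using act_inst_bdry I take_act_inst by metis
qed

lemma inst_holds_act:
  assumes K: "inst_holds D \<Xi> K" and \<Xi>: "wsc_mctx \<Xi>" and D: "\<And>\<J>. D \<J> \<Longrightarrow> wsc_jdg \<theta> \<gamma> 0 \<J>"
    and I: "act_ok \<theta> \<gamma> \<theta>' \<gamma>' I \<sigma>" and D': "\<And>\<J>. D \<J> \<Longrightarrow> D' (map_jdg (act I \<sigma>) \<J>)"
  shows "inst_holds D' \<Xi> (act_inst I \<sigma> K)"
  unfolding inst_holds_def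
proof (intro conjI allI impI)
  show f: "map fst (act_inst I \<sigma> K) = map fst \<Xi>"
    using K by (auto simp: act_inst_def inst_holds_def o_def case_prod_beta)
  fix k assume k: "k < length \<Xi>"
  then have "k < length K" using K by (metis inst_holds_def length_map)
  then have e: "snd (act_inst I \<sigma> K ! k) = act I \<sigma> (snd (K ! k))"
    by (simp add: act_inst_def case_prod_beta)
  obtain \<J> where "fill (inst_bdry (take k K) (snd (\<Xi> ! k))) (snd (K ! k)) = Some \<J>" "D \<J>"
    using K k unfolding inst_holds_def by blast
  then show "\<exists>\<J>. fill (inst_bdry (take k (act_inst I \<sigma> K)) (snd (\<Xi> ! k)))
      (snd (act_inst I \<sigma> K ! k)) = Some \<J> \<and> D' \<J>"
    using act_inst_prefix[OF K \<Xi> D I k] e D' fill_act by fastforce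
qed

lemma inst_eq_holds_act:
  assumes K: "inst_holds D \<Xi> K" and L: "map fst L = map fst \<Xi>" and e: "inst_eq_holds E \<Xi> K L"
    and \<Xi>: "wsc_mctx \<Xi>" and D: "\<And>\<J>. D \<J> \<Longrightarrow> wsc_jdg \<theta> \<gamma> 0 \<J>"
    and I: "act_ok \<theta> \<gamma> \<theta>' \<gamma>' I \<sigma>" and D': "\<And>\<J>. E \<J> \<Longrightarrow> D' (map_jdg (act I \<sigma>) \<J>)"
  shows "inst_eq_holds D' \<Xi> (act_inst I \<sigma> K) (act_inst I \<sigma> L)"
  unfolding inst_eq_holds_def
proof (intro conjI allI impI)
  fix k assume k: "k < length \<Xi>" and o: "obj_bdry (snd (\<Xi> ! k))"
  then have "k < length K" "k < length L" using K L by (metis inst_holds_def length_map, metis length_map)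
  then have s: "snd (act_inst I \<sigma> K ! k) = act I \<sigma> (snd (K ! k))"
    "snd (act_inst I \<sigma> L ! k) = act I \<sigma> (snd (L ! k))"
    by (simp_all add: act_inst_def case_prod_beta)
  obtain \<J> where "fill_eq (inst_bdry (take k K) (snd (\<Xi> ! k))) (snd (K ! k)) (snd (L ! k)) = Some \<J>" "E \<J>"
    using e k o unfolding inst_eq_holds_def by blast
  then show "\<exists>\<J>. fill_eq (inst_bdry (take k (act_inst I \<sigma> K)) (snd (\<Xi> ! k)))
      (snd (act_inst I \<sigma> K ! k)) (snd (act_inst I \<sigma> L ! k)) = Some \<J> \<and> D' \<J>"
    using act_inst_prefix[OF K \<Xi> D I k] s D' fill_eq_act by fastforce
qed

text \<open>One instantiation followed by two morphisms: each object entry of \<open>K\<close>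
  yields an equation. This is the equality premise of the congruence rule attached to a specific
  object rule.\<close>

lemma inst_eq_holds_of_inst_holds:
  assumes K: "inst_holds D \<Xi> K" and \<Xi>: "wsc_mctx \<Xi>" and D: "\<And>\<J>. D \<J> \<Longrightarrow> wsc_jdg \<theta> \<gamma> 0 \<J>"
    and I: "act_ok \<theta> \<gamma> \<theta>' \<gamma>' I \<sigma>"
    and D': "\<And>\<J>. D \<J> \<Longrightarrow> obj_jdg \<J> \<Longrightarrow> D' (jdg_eq (act I \<sigma>) (act J \<tau>) \<J>)"
  shows "inst_eq_holds D' \<Xi> (act_inst I \<sigma> K) (act_inst J \<tau> K)"
  unfolding inst_eq_holds_def
proof (intro conjI allI impI)
  fix k assume k: "k < length \<Xi>" and o: "obj_bdry (snd (\<Xi> ! k))"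
  then have "k < length K" using K by (metis inst_holds_def length_map)
  then have s: "snd (act_inst I \<sigma> K ! k) = act I \<sigma> (snd (K ! k))"
    "snd (act_inst J \<tau> K ! k) = act J \<tau> (snd (K ! k))"
    by (simp_all add: act_inst_def case_prod_beta)
  obtain \<J> where \<J>: "fill (inst_bdry (take k K) (snd (\<Xi> ! k))) (snd (K ! k)) = Some \<J>" "D \<J>"
    using K k unfolding inst_holds_def by blast
  have o': "obj_bdry (inst_bdry (take k K) (snd (\<Xi> ! k)))" using o by simp
  have "obj_jdg \<J>" using fill_obj[OF \<J>(1)] o by simp
  then show "\<exists>\<J>. fill_eq (inst_bdry (take k (act_inst I \<sigma> K)) (snd (\<Xi> ! k)))
      (snd (act_inst I \<sigma> K ! k)) (snd (act_inst J \<tau> K ! k)) = Some \<J> \<and> D' \<J>"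
    using act_inst_prefix[OF K \<Xi> D I k] fill_eq_of_fill[OF \<J>(1) o'] s D' \<J>(2) by auto
qed

subsection \<open>Raw syntax is scoped\<close>

lemma raw_arg_wsc: "raw_arg \<Sigma> \<theta> \<gamma> k \<alpha> e \<Longrightarrow> wsc (\<lambda>M. map_option snd (\<theta> M)) \<gamma> k (snd \<alpha>) e"
proof (induction rule: raw_arg.induct)
  case (3 S c \<alpha> k es)
  then show ?case by (simp add: list_all2_conv_all_nth) (metis in_set_conv_nth)
qed auto

lemma mctx_arities_depths: "(\<lambda>M. map_option snd (mctx_arities \<Theta> M)) = depths \<Theta>"
proof
  show "map_option snd (mctx_arities \<Theta> M) = depths \<Theta> M" for M
    unfolding mctx_arities_def depths_def by (induction \<Theta>) (auto, metis prod.collapse)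
qed

lemma raw_jthesis_wsc: "raw_jthesis \<Sigma> \<theta> \<gamma> k j \<Longrightarrow> wsc_jdg (\<lambda>M. map_option snd (\<theta> M)) \<gamma> k (JTh j)"
  by (cases j) (auto dest: raw_arg_wsc)

lemma raw_bdry_wsc: "raw_bdry \<Sigma> \<theta> \<gamma> k B \<Longrightarrow> wsc_bdry (\<lambda>M. map_option snd (\<theta> M)) \<gamma> k B"
proof (induction B arbitrary: k)
  case (BTh b)
  then show ?case by (cases b) (auto dest: raw_arg_wsc)
qed (auto dest: raw_arg_wsc)

lemma wsc_mctx_Nil: "wsc_mctx []"
  by (simp add: wsc_mctx_def)

lemma wsc_mctx_snoc:
  "wsc_mctx \<Theta> \<Longrightarrow> M \<notin> fst ` set \<Theta> \<Longrightarrow> wsc_bdry (depths \<Theta>) {} 0 B \<Longrightarrow> wsc_mctx (\<Theta> @ [(M, B)])"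
  unfolding wsc_mctx_def by (auto simp: nth_append less_Suc_eq)

lemma raw_mctx_wsc: "raw_mctx \<Sigma> \<Theta> \<Longrightarrow> wsc_mctx \<Theta>"
proof (induction rule: raw_mctx.induct)
  case (2 \<Theta> M B)
  then show ?case using wsc_mctx_snoc raw_bdry_wsc mctx_arities_depths by metis
qed (rule wsc_mctx_Nil)

definition wsc_theory :: "'s rule set \<Rightarrow> bool" where
  "wsc_theory T \<longleftrightarrow> (\<forall>(\<Xi>, j)\<in>T. wsc_mctx \<Xi> \<and> wsc_jdg (depths \<Xi>) {} 0 (JTh j))"

lemma raw_type_theory_wsc: "raw_type_theory \<Sigma> T \<Longrightarrow> wsc_theory T"
  unfolding raw_type_theory_def wsc_theory_def raw_rule_def
  by (fastforce dest: raw_jthesis_wsc raw_mctx_wsc simp: mctx_arities_depths simp del: wsc_jdg.simps)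

subsection \<open>Derivable judgements are scoped\<close>

lemma wsc_vctx_Nil [simp]: "wsc_vctx \<theta> []"
  by (simp add: wsc_vctx_def)

lemma wsc_vctx_snoc: "wsc_vctx \<theta> \<Gamma> \<Longrightarrow> wsc \<theta> (fst ` set \<Gamma>) 0 0 A \<Longrightarrow> wsc_vctx \<theta> (\<Gamma> @ [(a, A)])"
  unfolding wsc_vctx_def by (fastforce intro: wsc_mono)

lemma wsc_vctx_mem: "wsc_vctx \<theta> \<Gamma> \<Longrightarrow> (a, A) \<in> set \<Gamma> \<Longrightarrow> wsc \<theta> (fst ` set \<Gamma>) 0 0 A"
  unfolding wsc_vctx_def by auto

lemma wsc_inst_jthesis:
  "act_ok (depths \<Xi>) {} \<theta> \<gamma> K FV \<Longrightarrow> wsc_jdg (depths \<Xi>) {} 0 (JTh j) \<Longrightarrow>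
    wsc_jdg \<theta> \<gamma> 0 (JTh (inst_jthesis K j))"
  unfolding inst_expr_eq_act by (auto simp: jthesis.set_map wsc_act)

lemma wsc_theory_rule:
  "wsc_theory T \<Longrightarrow> (\<Xi>, j) \<in> T \<Longrightarrow> wsc_mctx \<Xi> \<and> distinct (map fst \<Xi>) \<and> wsc_jdg (depths \<Xi>) {} 0 (JTh j)"
  unfolding wsc_theory_def wsc_mctx_def by auto

lemma wsc_MApp:
  "wsc_mctx \<Theta> \<Longrightarrow> depths \<Theta> \<subseteq>\<^sub>m \<theta> \<Longrightarrow> (M, B) \<in> set \<Theta> \<Longrightarrow> length ts = bdry_depth B \<Longrightarrow>
    \<forall>i < length ts. wsc \<theta> \<gamma> 0 0 (ts ! i) \<Longrightarrow> wsc \<theta> \<gamma> 0 0 (MApp M ts)"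
  using depths_mem[of \<Theta> M B] by (auto simp: wsc_mctx_def map_le_def dom_def in_set_conv_nth)

text \<open>Each rule builds its conclusion from scoped parts, and at a binder the freshness
  condition discards the opened variable again. \<open>\<theta>\<close> may exceed
  \<open>depths \<Theta>\<close> because the types in \<open>\<Gamma>\<close> are not tied to
  \<open>\<Theta>\<close>.\<close>

lemma derivable_wsc:
  assumes T: "wsc_theory T"
  shows "derivable T \<Theta> \<Gamma> \<J> \<Longrightarrow> wsc_mctx \<Theta> \<Longrightarrow> depths \<Theta> \<subseteq>\<^sub>m \<theta> \<Longrightarrow> wsc_vctx \<theta> \<Gamma> \<Longrightarrow>
      wsc_jdg \<theta> (fst ` set \<Gamma>) 0 \<J>"
    and "derivable_bdry T \<Theta> \<Gamma> B \<Longrightarrow> wsc_mctx \<Theta> \<Longrightarrow> depths \<Theta> \<subseteq>\<^sub>m \<theta> \<Longrightarrow> wsc_vctx \<theta> \<Gamma> \<Longrightarrow>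
      wsc_bdry \<theta> (fst ` set \<Gamma>) 0 B"
proof (induction rule: derivable_derivable_bdry.inducts)
  case (var a A \<Gamma> \<Theta>)
  then show ?case by (force dest: wsc_vctx_mem)
next
  case (meta_obj M B \<Theta> ts \<Gamma> b j)
  then have "wsc \<theta> (fst ` set \<Gamma>) 0 0 (MApp M ts)" by (intro wsc_MApp) auto
  then show ?case using meta_obj by (cases b) auto
next
  case (meta_eq M B \<Theta> ts \<Gamma> b j)
  then show ?case by (cases j) auto
next
  case (meta_cong_ty M B \<Theta> ss ts \<Gamma>)
  then have "wsc \<theta> (fst ` set \<Gamma>) 0 0 (MApp M ss)" "wsc \<theta> (fst ` set \<Gamma>) 0 0 (MApp M ts)"
    by (auto intro!: wsc_MApp simp del: wsc.simps)
  then show ?case by simp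
next
  case (meta_cong_tm M B \<Theta> ss ts \<Gamma> C C')
  then have "wsc \<theta> (fst ` set \<Gamma>) 0 0 (MApp M ss)" "wsc \<theta> (fst ` set \<Gamma>) 0 0 (MApp M ts)"
    by (auto intro!: wsc_MApp simp del: wsc.simps)
  then show ?case using meta_cong_tm by simp
next
  case (abstr \<Theta> \<Gamma> A a \<J>)
  then have "wsc_vctx \<theta> (\<Gamma> @ [(a, A)])" by (auto intro: wsc_vctx_snoc)
  with abstr show ?case by (auto intro: wsc_jdg_unbsubst)
next
  case (bdry_abstr \<Theta> \<Gamma> A a B)
  then have "wsc_vctx \<theta> (\<Gamma> @ [(a, A)])" by (auto intro: wsc_vctx_snoc)
  with bdry_abstr show ?case by (auto intro: wsc_bdry_unbsubst)
next
  case (specific \<Xi> j \<Theta> \<Gamma> I)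
  note r = wsc_theory_rule[OF T specific(1)]
  have "act_ok (depths \<Xi>) {} \<theta> (fst ` set \<Gamma>) I FV"
    using specific r by (intro inst_holds_act_ok[OF specific(2)]) auto
  then show ?case using r wsc_inst_jthesis by blast
next
  case (specific_cong_ty \<Xi> A \<Theta> \<Gamma> I J)
  note r = wsc_theory_rule[OF T specific_cong_ty(1)]
  have "act_ok (depths \<Xi>) {} \<theta> (fst ` set \<Gamma>) I FV"
    using specific_cong_ty r by (intro inst_holds_act_ok[OF specific_cong_ty(2)]) auto
  moreover have "act_ok (depths \<Xi>) {} \<theta> (fst ` set \<Gamma>) J FV"
    using specific_cong_ty r by (intro inst_holds_act_ok[OF specific_cong_ty(3)]) auto
  ultimately show ?case
    using r unfolding inst_expr_eq_act by (auto intro: wsc_act)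
next
  case (specific_cong_tm \<Xi> t A \<Theta> \<Gamma> I J)
  note r = wsc_theory_rule[OF T specific_cong_tm(1)]
  have "act_ok (depths \<Xi>) {} \<theta> (fst ` set \<Gamma>) I FV"
    using specific_cong_tm r by (intro inst_holds_act_ok[OF specific_cong_tm(2)]) auto
  moreover have "act_ok (depths \<Xi>) {} \<theta> (fst ` set \<Gamma>) J FV"
    using specific_cong_tm r by (intro inst_holds_act_ok[OF specific_cong_tm(3)]) auto
  ultimately show ?case
    using r unfolding inst_expr_eq_act by (auto intro: wsc_act)
qed auto

text \<open>The premises of the abstraction rule speak of the opened body; commuting a morphism with
  the opening needs the scoping of the closed body, which is recovered here.\<close>

lemma abstr_wsc:
  assumes "wsc_theory T" "wsc_mctx \<Theta>" "depths \<Theta> \<subseteq>\<^sub>m \<theta>" "wsc_vctx \<theta> \<Gamma>"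
    and "derivable T \<Theta> \<Gamma> (JTh (TyJ A))" "a \<notin> fv_jdg \<J>"
    and "derivable T \<Theta> (\<Gamma> @ [(a, A)]) (jdg_bsubst 0 (FV a) \<J>)"
  shows "wsc \<theta> (fst ` set \<Gamma>) 0 0 A" "wsc_jdg \<theta> (fst ` set \<Gamma>) (Suc 0) \<J>"
proof -
  show A: "wsc \<theta> (fst ` set \<Gamma>) 0 0 A"
    using derivable_wsc(1)[OF assms(1,5,2,3,4)] by simp
  show "wsc_jdg \<theta> (fst ` set \<Gamma>) (Suc 0) \<J>"
    using derivable_wsc(1)[OF assms(1,7,2,3) wsc_vctx_snoc[OF assms(4) A]] assms(6)
    by (auto intro: wsc_jdg_unbsubst)
qed

lemma bdry_abstr_wsc:
  assumes "wsc_theory T" "wsc_mctx \<Theta>" "depths \<Theta> \<subseteq>\<^sub>m \<theta>" "wsc_vctx \<theta> \<Gamma>"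
    and "derivable T \<Theta> \<Gamma> (JTh (TyJ A))" "a \<notin> fv_bdry B"
    and "derivable_bdry T \<Theta> (\<Gamma> @ [(a, A)]) (bdry_bsubst 0 (FV a) B)"
  shows "wsc \<theta> (fst ` set \<Gamma>) 0 0 A" "wsc_bdry \<theta> (fst ` set \<Gamma>) (Suc 0) B"
proof -
  show A: "wsc \<theta> (fst ` set \<Gamma>) 0 0 A"
    using derivable_wsc(1)[OF assms(1,5,2,3,4)] by simp
  show "wsc_bdry \<theta> (fst ` set \<Gamma>) (Suc 0) B"
    using derivable_wsc(2)[OF assms(1,7,2,3) wsc_vctx_snoc[OF assms(4) A]] assms(6)
    by (auto intro: wsc_bdry_unbsubst)
qed

subsection \<open>Spines\<close>

definition typed :: "'s rule set \<Rightarrow> 's mctx \<Rightarrow> 's vctx \<Rightarrow> 's expr bdry \<Rightarrow> 's expr list \<Rightarrow> bool" where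
  "typed T \<Theta> \<Gamma> B ts \<longleftrightarrow> length ts = bdry_depth B \<and>
    (\<forall>j < length ts. derivable T \<Theta> \<Gamma> (JTh (TmJ (ts ! j) (bdry_doms B ts ! j))))"

definition typed_eq ::
  "'s rule set \<Rightarrow> 's mctx \<Rightarrow> 's vctx \<Rightarrow> 's expr bdry \<Rightarrow> 's expr list \<Rightarrow> 's expr list \<Rightarrow> bool" where
  "typed_eq T \<Theta> \<Gamma> B ss ts \<longleftrightarrow>
    (\<forall>j < length ss. derivable T \<Theta> \<Gamma> (JTh (EqTmJ (ss ! j) (ts ! j) (bdry_doms B ss ! j))))"

text \<open>The four rules for metavariables, with an arbitrary head in place of a metavariable.\<close>

definition head_ok ::
  "'s rule set \<Rightarrow> 's mctx \<Rightarrow> 's vctx \<Rightarrow> 's expr bdry \<Rightarrow> ('s expr list \<Rightarrow> 's expr) \<Rightarrow> bool" where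
  "head_ok T \<Theta> \<Gamma> B h \<longleftrightarrow>
    (\<forall>ts b j. typed T \<Theta> \<Gamma> B ts \<longrightarrow> bdry_app B ts = BTh b \<longrightarrow> derivable_bdry T \<Theta> \<Gamma> (BTh b) \<longrightarrow>
      (if obj_bthesis b then fill_thesis b (h ts) = Some j else bthesis_of j = b) \<longrightarrow>
      derivable T \<Theta> \<Gamma> (JTh j)) \<and>
    (\<forall>ss ts. typed T \<Theta> \<Gamma> B ss \<longrightarrow> typed T \<Theta> \<Gamma> B ts \<longrightarrow> typed_eq T \<Theta> \<Gamma> B ss ts \<longrightarrow>
      bdry_app B ss = BTh TyB \<longrightarrow> derivable T \<Theta> \<Gamma> (JTh (EqTyJ (h ss) (h ts)))) \<and>
    (\<forall>ss ts C C'. typed T \<Theta> \<Gamma> B ss \<longrightarrow> typed T \<Theta> \<Gamma> B ts \<longrightarrow> typed_eq T \<Theta> \<Gamma> B ss ts \<longrightarrow>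
      bdry_app B ss = BTh (TmB C) \<longrightarrow> bdry_app B ts = BTh (TmB C') \<longrightarrow>
      derivable T \<Theta> \<Gamma> (JTh (EqTyJ C C')) \<longrightarrow> derivable T \<Theta> \<Gamma> (JTh (EqTmJ (h ss) (h ts) C)))"

lemma head_ok_MApp:
  assumes M: "(M, B) \<in> set \<Theta>"
  shows "head_ok T \<Theta> \<Gamma> B (MApp M)"
  unfolding head_ok_def
proof (intro conjI allI impI)
  fix ts b j
  assume "typed T \<Theta> \<Gamma> B ts" "bdry_app B ts = BTh b" "derivable_bdry T \<Theta> \<Gamma> (BTh b)"
    "if obj_bthesis b then fill_thesis b (MApp M ts) = Some j else bthesis_of j = b"
  then show "derivable T \<Theta> \<Gamma> (JTh j)"
    using meta_obj[OF M, of ts T \<Gamma> b j] meta_eq[OF M, of ts T \<Gamma> b j]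
    by (auto simp: typed_def split: if_splits)
next
  fix ss ts
  assume "typed T \<Theta> \<Gamma> B ss" "typed T \<Theta> \<Gamma> B ts" "typed_eq T \<Theta> \<Gamma> B ss ts" "bdry_app B ss = BTh TyB"
  then show "derivable T \<Theta> \<Gamma> (JTh (EqTyJ (MApp M ss) (MApp M ts)))"
    using M by (intro meta_cong_ty) (auto simp: typed_def typed_eq_def)
next
  fix ss ts C C'
  assume "typed T \<Theta> \<Gamma> B ss" "typed T \<Theta> \<Gamma> B ts" "typed_eq T \<Theta> \<Gamma> B ss ts"
    "bdry_app B ss = BTh (TmB C)" "bdry_app B ts = BTh (TmB C')" "derivable T \<Theta> \<Gamma> (JTh (EqTyJ C C'))"
  then show "derivable T \<Theta> \<Gamma> (JTh (EqTmJ (MApp M ss) (MApp M ts) C))"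
    using M by (intro meta_cong_tm[of M B]) (auto simp: typed_def typed_eq_def)
qed

definition mapp :: "'s inst \<Rightarrow> mvar \<Rightarrow> 's expr list \<Rightarrow> 's expr" where
  "mapp I M ts = (case map_of I M of None \<Rightarrow> MApp M ts | Some e \<Rightarrow> arg_app e ts)"

lemma act_MApp: "act I \<sigma> (MApp M ts) = mapp I M (map (act I \<sigma>) ts)"
  by (simp add: mapp_def)

text \<open>The part of a morphism of contexts that concerns scoping only. How variables are typed
  in the target differs between renamings and substitutions and is added later.\<close>

definition sub_ok ::
  "(mvar \<Rightarrow> nat option) \<Rightarrow> (mvar \<Rightarrow> nat option) \<Rightarrow> 's inst \<Rightarrow> 's vctx \<Rightarrow> (var \<Rightarrow> 's expr) \<Rightarrow> 's vctx \<Rightarrow> bool" where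
  "sub_ok \<theta> \<theta>' I \<Gamma> \<sigma> \<Gamma>' \<longleftrightarrow> wsc_vctx \<theta> \<Gamma> \<and> wsc_vctx \<theta>' \<Gamma>' \<and>
    act_ok \<theta> (fst ` set \<Gamma>) \<theta>' (fst ` set \<Gamma>') I \<sigma>"

lemma act_fun_upd: "a \<notin> \<gamma> \<Longrightarrow> wsc \<theta> \<gamma> k n e \<Longrightarrow> act I (\<sigma>(a := t)) e = act I \<sigma> e"
  by (rule act_cong) auto

lemma act_ok_mono: "act_ok \<theta> \<gamma> \<theta>' \<gamma>' I \<sigma> \<Longrightarrow> \<gamma>' \<subseteq> \<gamma>'' \<Longrightarrow> act_ok \<theta> \<gamma> \<theta>' \<gamma>'' I \<sigma>"
  unfolding act_ok_def
  using wsc_mono[of \<theta>' \<gamma>' 0 _ _ 0 \<gamma>'' \<theta>'] by (auto split: option.splits) force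

lemma act_ok_insert:
  "act_ok \<theta> \<gamma> \<theta>' \<gamma>' I \<sigma> \<Longrightarrow> wsc \<theta>' \<gamma>' 0 0 t \<Longrightarrow> act_ok \<theta> (insert a \<gamma>) \<theta>' \<gamma>' I (\<sigma>(a := t))"
  unfolding act_ok_def by auto

lemma sub_ok_snoc:
  assumes "sub_ok \<theta> \<theta>' I \<Gamma> \<sigma> \<Gamma>'" "wsc \<theta> (fst ` set \<Gamma>) 0 0 A" "wsc \<theta>' (fst ` set \<Gamma>') 0 0 A'"
  shows "sub_ok \<theta> \<theta>' I (\<Gamma> @ [(a, A)]) (\<sigma>(a := FV b)) (\<Gamma>' @ [(b, A')])"
proof -
  have "act_ok \<theta> (fst ` set \<Gamma>) \<theta>' (insert b (fst ` set \<Gamma>')) I \<sigma>"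
    using assms(1) by (auto simp: sub_ok_def intro: act_ok_mono)
  then have "act_ok \<theta> (insert a (fst ` set \<Gamma>)) \<theta>' (insert b (fst ` set \<Gamma>')) I (\<sigma>(a := FV b))"
    by (rule act_ok_insert) simp
  then show ?thesis using assms by (auto simp: sub_ok_def intro: wsc_vctx_snoc)
qed

lemma sub_ok_insert:
  assumes "sub_ok \<theta> \<theta>' I \<Gamma> \<sigma> \<Gamma>'" "wsc \<theta> (fst ` set \<Gamma>) 0 0 A" "wsc \<theta>' (fst ` set \<Gamma>') 0 0 t"
  shows "sub_ok \<theta> \<theta>' I (\<Gamma> @ [(a, A)]) (\<sigma>(a := t)) \<Gamma>'"
  using assms by (auto simp: sub_ok_def intro: wsc_vctx_snoc act_ok_insert)

text \<open>Since \<open>a\<close> does not occur in the closed body, sending \<open>a\<close> to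
  \<open>t\<close> after opening is the same as translating the closed body and filling its binder
  with \<open>t\<close>. A fresh variable for \<open>t\<close> serves for re-abstraction, an
  arbitrary term for substitution.\<close>

lemma map_jdg_abstr:
  assumes ok: "act_ok \<theta> (insert a \<gamma>) \<theta>' \<gamma>' I (\<sigma>(a := t))"
    and J: "wsc_jdg \<theta> \<gamma> (Suc 0) \<J>" and a: "a \<notin> \<gamma>"
  shows "map_jdg (act I (\<sigma>(a := t))) (jdg_bsubst 0 (FV a) \<J>) = jdg_bsubst 0 t (map_jdg (act I \<sigma>) \<J>)"
proof -
  have "map_jdg (act I (\<sigma>(a := t))) (jdg_bsubst 0 (FV a) \<J>) =
      jdg_bsubst 0 (act I (\<sigma>(a := t)) (FV a)) (map_jdg (act I (\<sigma>(a := t))) \<J>)"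
    by (intro map_jdg_bsubst[where k = 0, OF ok] wsc_jdg_mono[OF J]) auto
  moreover have "map_jdg (act I (\<sigma>(a := t))) \<J> = map_jdg (act I \<sigma>) \<J>"
    using a by (intro map_jdg_act_cong[OF _ _ J]) auto
  ultimately show ?thesis by simp
qed

lemma map_bdry_abstr:
  assumes ok: "act_ok \<theta> (insert a \<gamma>) \<theta>' \<gamma>' I (\<sigma>(a := t))"
    and J: "wsc_bdry \<theta> \<gamma> (Suc 0) B" and a: "a \<notin> \<gamma>"
  shows "map_bdry (act I (\<sigma>(a := t))) (bdry_bsubst 0 (FV a) B) = bdry_bsubst 0 t (map_bdry (act I \<sigma>) B)"
proof -
  have "map_bdry (act I (\<sigma>(a := t))) (bdry_bsubst 0 (FV a) B) =
      bdry_bsubst 0 (act I (\<sigma>(a := t)) (FV a)) (map_bdry (act I (\<sigma>(a := t))) B)"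
    by (intro map_bdry_bsubst[where k = 0, OF ok] wsc_bdry_mono[OF J]) auto
  moreover have "map_bdry (act I (\<sigma>(a := t))) B = map_bdry (act I \<sigma>) B"
    using a by (intro map_bdry_act_cong[OF _ _ J]) auto
  ultimately show ?thesis by simp
qed

lemma ex_fresh_var: "\<exists>b. b \<notin> fst ` set (\<Gamma> :: 's vctx)"
  by (meson ex_new_if_finite finite_imageI List.finite_set infinite_UNIV_nat)

subsection \<open>Renaming, substitution and instantiation\<close>

text \<open>The boundary of a metavariable has no free variables, so \<open>\<sigma>\<close> acts on
  it like \<open>FV\<close>. Writing \<open>act I FV\<close> makes the translated boundary
  independent of the morphism, as \<open>head_ok\<close> requires.\<close>

lemma typed_act:
  assumes "act_ok \<theta> \<gamma> \<theta>' \<gamma>' I \<sigma>" "wsc_bdry \<theta> {} 0 B" "length ts = bdry_depth B"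
    and "\<forall>j < length ts. wsc \<theta> \<gamma> 0 0 (ts ! j) \<and>
      derivable T \<Theta> \<Gamma> (JTh (TmJ (act I \<sigma> (ts ! j)) (act I \<sigma> (bdry_doms B ts ! j))))"
  shows "typed T \<Theta> \<Gamma> (map_bdry (act I FV) B) (map (act I \<sigma>) ts)"
proof -
  have B: "map_bdry (act I FV) B = map_bdry (act I \<sigma>) B"
    using assms(2) by (intro map_bdry_act_cong[where \<gamma> = "{}"]) auto
  have "map (act I \<sigma>) (bdry_doms B ts) = bdry_doms (map_bdry (act I \<sigma>) B) (map (act I \<sigma>) ts)"
    using assms wsc_bdry_mono[OF assms(2)]
    by (intro map_bdry_doms[of \<theta> \<gamma> \<theta>' \<gamma>' I \<sigma> 0]) (auto simp: in_set_conv_nth)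
  then have "bdry_doms (map_bdry (act I \<sigma>) B) (map (act I \<sigma>) ts) ! j = act I \<sigma> (bdry_doms B ts ! j)"
    if "j < length ts" for j
    using that assms(3) length_bdry_doms by (metis nth_map)
  then show ?thesis using assms by (simp add: typed_def B)
qed

lemma typed_eq_act:
  assumes "act_ok \<theta> \<gamma> \<theta>' \<gamma>' I \<sigma>" "wsc_bdry \<theta> {} 0 B" "length ss = bdry_depth B"
    and "\<forall>j < length ss. wsc \<theta> \<gamma> 0 0 (ss ! j) \<and>
      derivable T \<Theta> \<Gamma> (JTh (EqTmJ (act I \<sigma> (ss ! j)) (ts' ! j) (act I \<sigma> (bdry_doms B ss ! j))))"
  shows "typed_eq T \<Theta> \<Gamma> (map_bdry (act I FV) B) (map (act I \<sigma>) ss) ts'"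
proof -
  have B: "map_bdry (act I FV) B = map_bdry (act I \<sigma>) B"
    using assms(2) by (intro map_bdry_act_cong[where \<gamma> = "{}"]) auto
  have "map (act I \<sigma>) (bdry_doms B ss) = bdry_doms (map_bdry (act I \<sigma>) B) (map (act I \<sigma>) ss)"
    using assms wsc_bdry_mono[OF assms(2)]
    by (intro map_bdry_doms[of \<theta> \<gamma> \<theta>' \<gamma>' I \<sigma> 0]) (auto simp: in_set_conv_nth)
  then have "bdry_doms (map_bdry (act I \<sigma>) B) (map (act I \<sigma>) ss) ! j = act I \<sigma> (bdry_doms B ss ! j)"
    if "j < length ss" for j
    using that assms(3) length_bdry_doms by (metis nth_map)
  then show ?thesis using assms by (simp add: typed_eq_def B)
qed

lemma bdry_app_act:
  assumes "act_ok \<theta> \<gamma> \<theta>' \<gamma>' I \<sigma>" "wsc_bdry \<theta> {} 0 B" "\<forall>t\<in>set ts. wsc \<theta> \<gamma> 0 0 t"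
  shows "bdry_app (map_bdry (act I FV) B) (map (act I \<sigma>) ts) = map_bdry (act I \<sigma>) (bdry_app B ts)"
proof -
  have B: "map_bdry (act I FV) B = map_bdry (act I \<sigma>) B"
    using assms(2) by (intro map_bdry_act_cong[where \<gamma> = "{}"]) auto
  show ?thesis unfolding B
    using assms wsc_bdry_mono[OF assms(2)]
    by (intro map_bdry_app[symmetric, of \<theta> \<gamma> \<theta>' \<gamma>' I \<sigma> 0]) auto
qed

lemma wsc_typed_args:
  assumes "wsc_theory T" "wsc_mctx \<Xi>" "depths \<Xi> \<subseteq>\<^sub>m \<theta>" "wsc_vctx \<theta> \<Gamma>"
    and "\<forall>j < length ts. derivable T \<Xi> \<Gamma> (JTh (TmJ (ts ! j) (As ! j)))"
  shows "\<forall>j < length ts. wsc \<theta> (fst ` set \<Gamma>) 0 0 (ts ! j)"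
  using derivable_wsc(1)[OF assms(1) _ assms(2-4)] assms(5) by fastforce

text \<open>What an induction on derivations over \<open>\<Xi>\<close> asks of a class
  \<open>mor\<close> of morphisms. \<open>I\<close> is fixed whereas \<open>\<sigma>\<close> and the
  contexts vary, because passing a binder changes variables but not metavariables. The four rules
  for metavariables are confined to \<open>mor_head\<close>.\<close>

locale translation =
  fixes T :: "'s rule set" and \<Xi> \<Theta> :: "'s mctx" and I :: "'s inst"
    and \<theta> \<theta>' :: "mvar \<Rightarrow> nat option" and mor :: "'s vctx \<Rightarrow> (var \<Rightarrow> 's expr) \<Rightarrow> 's vctx \<Rightarrow> bool"
  assumes T: "wsc_theory T" and \<Xi>: "wsc_mctx \<Xi>" and \<theta>: "depths \<Xi> \<subseteq>\<^sub>m \<theta>"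
    and mor_ok: "mor \<Gamma> \<sigma> \<Gamma>' \<Longrightarrow> sub_ok \<theta> \<theta>' I \<Gamma> \<sigma> \<Gamma>'"
    and mor_var: "mor \<Gamma> \<sigma> \<Gamma>' \<Longrightarrow> (a, A) \<in> set \<Gamma> \<Longrightarrow> derivable T \<Theta> \<Gamma>' (JTh (TmJ (\<sigma> a) (act I \<sigma> A)))"
    and mor_snoc: "mor \<Gamma> \<sigma> \<Gamma>' \<Longrightarrow> a \<notin> fst ` set \<Gamma> \<Longrightarrow> b \<notin> fst ` set \<Gamma>' \<Longrightarrow> wsc \<theta> (fst ` set \<Gamma>) 0 0 A \<Longrightarrow>
      mor (\<Gamma> @ [(a, A)]) (\<sigma>(a := FV b)) (\<Gamma>' @ [(b, act I \<sigma> A)])"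
    and mor_head: "mor \<Gamma> \<sigma> \<Gamma>' \<Longrightarrow> (M, B) \<in> set \<Xi> \<Longrightarrow>
      head_ok T \<Theta> \<Gamma>' (map_bdry (act I FV) B) (mapp I M)"
begin

lemma mor_act_ok: "mor \<Gamma> \<sigma> \<Gamma>' \<Longrightarrow> act_ok \<theta> (fst ` set \<Gamma>) \<theta>' (fst ` set \<Gamma>') I \<sigma>"
  and mor_wsc: "mor \<Gamma> \<sigma> \<Gamma>' \<Longrightarrow> wsc_vctx \<theta> \<Gamma>"
  using mor_ok unfolding sub_ok_def by auto

lemma \<Xi>_bdry: "(M, B) \<in> set \<Xi> \<Longrightarrow> wsc_bdry \<theta> {} 0 B"
  using wsc_bdry_mono[OF wsc_mctx_mem[OF \<Xi>]] \<theta> by auto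

text \<open>The hypothesis \<open>ts\<close> has the shape in which rule induction delivers a
  premise together with its induction hypothesis, so that it applies directly in the cases for
  metavariables.\<close>

lemma spine:
  assumes m: "mor \<Gamma> \<sigma> \<Gamma>'" and M: "(M, B) \<in> set \<Xi>" and l: "length ts = bdry_depth B"
    and ts: "\<forall>j < length ts. derivable T \<Xi> \<Gamma> (JTh (TmJ (ts ! j) (bdry_doms B ts ! j))) \<and>
      (\<forall>\<sigma> \<Gamma>'. mor \<Gamma> \<sigma> \<Gamma>' \<longrightarrow>
        derivable T \<Theta> \<Gamma>' (map_jdg (act I \<sigma>) (JTh (TmJ (ts ! j) (bdry_doms B ts ! j)))))"
  shows "typed T \<Theta> \<Gamma>' (map_bdry (act I FV) B) (map (act I \<sigma>) ts)"
    and "bdry_app (map_bdry (act I FV) B) (map (act I \<sigma>) ts) = map_bdry (act I \<sigma>) (bdry_app B ts)"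
proof -
  have w: "\<forall>j < length ts. wsc \<theta> (fst ` set \<Gamma>) 0 0 (ts ! j)"
    using ts by (intro wsc_typed_args[OF T \<Xi> \<theta> mor_wsc[OF m]]) auto
  show "typed T \<Theta> \<Gamma>' (map_bdry (act I FV) B) (map (act I \<sigma>) ts)"
    using ts m w l by (intro typed_act[OF mor_act_ok[OF m] \<Xi>_bdry[OF M]]) auto
  show "bdry_app (map_bdry (act I FV) B) (map (act I \<sigma>) ts) = map_bdry (act I \<sigma>) (bdry_app B ts)"
    using w by (intro bdry_app_act[OF mor_act_ok[OF m] \<Xi>_bdry[OF M]]) (auto simp: in_set_conv_nth)
qed

lemma spine_eq:
  assumes m: "mor \<Gamma> \<sigma> \<Gamma>'" and M: "(M, B) \<in> set \<Xi>" and l: "length ss = bdry_depth B" "length ts = bdry_depth B"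
    and ss: "\<forall>j < length ss. derivable T \<Xi> \<Gamma> (JTh (TmJ (ss ! j) (bdry_doms B ss ! j))) \<and> P j"
    and eq: "\<forall>j < length ss. derivable T \<Xi> \<Gamma> (JTh (EqTmJ (ss ! j) (ts ! j) (bdry_doms B ss ! j))) \<and>
      (\<forall>\<sigma> \<Gamma>'. mor \<Gamma> \<sigma> \<Gamma>' \<longrightarrow>
        derivable T \<Theta> \<Gamma>' (map_jdg (act I \<sigma>) (JTh (EqTmJ (ss ! j) (ts ! j) (bdry_doms B ss ! j)))))"
  shows "typed_eq T \<Theta> \<Gamma>' (map_bdry (act I FV) B) (map (act I \<sigma>) ss) (map (act I \<sigma>) ts)"
proof -
  have w: "\<forall>j < length ss. wsc \<theta> (fst ` set \<Gamma>) 0 0 (ss ! j)"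
    using ss by (intro wsc_typed_args[OF T \<Xi> \<theta> mor_wsc[OF m]]) auto
  show ?thesis
    using eq m w l by (intro typed_eq_act[OF mor_act_ok[OF m] \<Xi>_bdry[OF M]]) auto
qed

text \<open>Metavariable rules go to \<open>head_ok\<close>; specific rules and their congruences
  are reapplied with the composite instantiation. \<open>\<sigma>\<close> and
  \<open>\<Gamma>'\<close> are quantified inside because a binder changes both.\<close>

lemma derivable_act_aux:
  "derivable T X \<Gamma> \<J> \<Longrightarrow> X = \<Xi> \<longrightarrow>
    (\<forall>\<sigma> \<Gamma>'. mor \<Gamma> \<sigma> \<Gamma>' \<longrightarrow> derivable T \<Theta> \<Gamma>' (map_jdg (act I \<sigma>) \<J>))"
  "derivable_bdry T X \<Gamma> B \<Longrightarrow> X = \<Xi> \<longrightarrow>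
    (\<forall>\<sigma> \<Gamma>'. mor \<Gamma> \<sigma> \<Gamma>' \<longrightarrow> derivable_bdry T \<Theta> \<Gamma>' (map_bdry (act I \<sigma>) B))"
proof (induct rule: derivable_derivable_bdry.inducts)
  case (var a A \<Gamma> X)
  then show ?case by (auto intro: mor_var)
next
  case (meta_obj M B X ts \<Gamma> b j)
  show ?case
  proof (intro allI impI)
    fix \<sigma> \<Gamma>' assume X: "X = \<Xi>" and m: "mor \<Gamma> \<sigma> \<Gamma>'"
    have sp: "typed T \<Theta> \<Gamma>' (map_bdry (act I FV) B) (map (act I \<sigma>) ts)"
      "bdry_app (map_bdry (act I FV) B) (map (act I \<sigma>) ts) = map_bdry (act I \<sigma>) (bdry_app B ts)"
      using meta_obj(1-3) X by (intro spine[OF m]; auto)+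
    have "derivable_bdry T \<Theta> \<Gamma>' (BTh (map_bthesis (act I \<sigma>) b))"
      using meta_obj m X by auto
    moreover have "fill_thesis (map_bthesis (act I \<sigma>) b) (mapp I M (map (act I \<sigma>) ts)) =
        Some (map_jthesis (act I \<sigma>) j)"
      using meta_obj(5,8) unfolding act_MApp[symmetric] by (cases b) auto
    ultimately show "derivable T \<Theta> \<Gamma>' (map_jdg (act I \<sigma>) (JTh j))"
      using mor_head[OF m, of M B] sp meta_obj(1,4,5) X unfolding head_ok_def by auto
  qed
next
  case (meta_eq M B X ts \<Gamma> b j)
  show ?case
  proof (intro allI impI)
    fix \<sigma> \<Gamma>' assume X: "X = \<Xi>" and m: "mor \<Gamma> \<sigma> \<Gamma>'"
    have sp: "typed T \<Theta> \<Gamma>' (map_bdry (act I FV) B) (map (act I \<sigma>) ts)"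
      "bdry_app (map_bdry (act I FV) B) (map (act I \<sigma>) ts) = map_bdry (act I \<sigma>) (bdry_app B ts)"
      using meta_eq(1-3) X by (intro spine[OF m]; auto)+
    have "derivable_bdry T \<Theta> \<Gamma>' (BTh (map_bthesis (act I \<sigma>) b))"
      using meta_eq m X by auto
    then show "derivable T \<Theta> \<Gamma>' (map_jdg (act I \<sigma>) (JTh j))"
      using mor_head[OF m, of M B] sp meta_eq(1,4,5,8) X unfolding head_ok_def by auto
  qed
next
  case (meta_cong_ty M B X ss ts \<Gamma>)
  show ?case
  proof (intro allI impI)
    fix \<sigma> \<Gamma>' assume X: "X = \<Xi>" and m: "mor \<Gamma> \<sigma> \<Gamma>'"
    have "typed T \<Theta> \<Gamma>' (map_bdry (act I FV) B) (map (act I \<sigma>) ss)"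
      "bdry_app (map_bdry (act I FV) B) (map (act I \<sigma>) ss) = map_bdry (act I \<sigma>) (bdry_app B ss)"
      using meta_cong_ty(1-5) X by (intro spine[OF m]; auto)+
    moreover have "typed T \<Theta> \<Gamma>' (map_bdry (act I FV) B) (map (act I \<sigma>) ts)"
      using meta_cong_ty(1-5) X by (intro spine[OF m]; auto)+
    moreover have "typed_eq T \<Theta> \<Gamma>' (map_bdry (act I FV) B) (map (act I \<sigma>) ss) (map (act I \<sigma>) ts)"
      using meta_cong_ty(1-6) X by (intro spine_eq[OF m]) auto
    ultimately show "derivable T \<Theta> \<Gamma>' (map_jdg (act I \<sigma>) (JTh (EqTyJ (MApp M ss) (MApp M ts))))"
      using mor_head[OF m, of M B] meta_cong_ty(1,7) X unfolding head_ok_def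
      by (auto simp: act_MApp simp del: act.simps)
  qed
next
  case (meta_cong_tm M B X ss ts \<Gamma> C C')
  show ?case
  proof (intro allI impI)
    fix \<sigma> \<Gamma>' assume X: "X = \<Xi>" and m: "mor \<Gamma> \<sigma> \<Gamma>'"
    have "typed T \<Theta> \<Gamma>' (map_bdry (act I FV) B) (map (act I \<sigma>) ss)"
      "bdry_app (map_bdry (act I FV) B) (map (act I \<sigma>) ss) = map_bdry (act I \<sigma>) (bdry_app B ss)"
      using meta_cong_tm(1-5) X by (intro spine[OF m]; auto)+
    moreover have "typed T \<Theta> \<Gamma>' (map_bdry (act I FV) B) (map (act I \<sigma>) ts)"
      "bdry_app (map_bdry (act I FV) B) (map (act I \<sigma>) ts) = map_bdry (act I \<sigma>) (bdry_app B ts)"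
      using meta_cong_tm(1-5) X by (intro spine[OF m]; auto)+
    moreover have "typed_eq T \<Theta> \<Gamma>' (map_bdry (act I FV) B) (map (act I \<sigma>) ss) (map (act I \<sigma>) ts)"
      using meta_cong_tm(1-6) X by (intro spine_eq[OF m]) auto
    moreover have "derivable T \<Theta> \<Gamma>' (JTh (EqTyJ (act I \<sigma> C) (act I \<sigma> C')))"
      using meta_cong_tm m X by auto
    ultimately show "derivable T \<Theta> \<Gamma>' (map_jdg (act I \<sigma>) (JTh (EqTmJ (MApp M ss) (MApp M ts) C)))"
      using mor_head[OF m, of M B] meta_cong_tm(1,7,8) X unfolding head_ok_def
      by (auto simp: act_MApp simp del: act.simps)
  qed
next
  case (abstr X \<Gamma> A a \<J>)
  show ?case
  proof (intro allI impI)
    fix \<sigma> \<Gamma>' assume X: "X = \<Xi>" and m: "mor \<Gamma> \<sigma> \<Gamma>'"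
    note w = abstr_wsc[OF T \<Xi> \<theta> mor_wsc[OF m] abstr(1)[unfolded X] abstr(4,5)[unfolded X]]
    \<comment> \<open>The name \<open>a\<close> is fresh for \<open>\<Gamma>\<close> but may be
      declared in \<open>\<Gamma>'\<close>, so the translated binder is opened with another name and
      \<open>\<sigma>\<close> sends \<open>a\<close> to it.\<close>
    obtain b where b: "b \<notin> fst ` set \<Gamma>'" using ex_fresh_var by blast
    have m': "mor (\<Gamma> @ [(a, A)]) (\<sigma>(a := FV b)) (\<Gamma>' @ [(b, act I \<sigma> A)])"
      using m abstr(3) b w by (intro mor_snoc)
    have "map_jdg (act I (\<sigma>(a := FV b))) (jdg_bsubst 0 (FV a) \<J>) = jdg_bsubst 0 (FV b) (map_jdg (act I \<sigma>) \<J>)"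
      using mor_act_ok[OF m'] w abstr(3) by (intro map_jdg_abstr) auto
    then have "derivable T \<Theta> (\<Gamma>' @ [(b, act I \<sigma> A)]) (jdg_bsubst 0 (FV b) (map_jdg (act I \<sigma>) \<J>))"
      using abstr(6) m' X by metis
    moreover have "b \<notin> fv_jdg (map_jdg (act I \<sigma>) \<J>)"
      using wsc_jdg_fv[OF wsc_jdg_act[OF mor_act_ok[OF m] w(2)]] b by blast
    ultimately show "derivable T \<Theta> \<Gamma>' (map_jdg (act I \<sigma>) (JAbs A \<J>))"
      using abstr m X b by (auto intro: derivable_derivable_bdry.abstr)
  qed
next
  case (bdry_abstr X \<Gamma> A a B)
  show ?case
  proof (intro allI impI)
    fix \<sigma> \<Gamma>' assume X: "X = \<Xi>" and m: "mor \<Gamma> \<sigma> \<Gamma>'"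
    note w = bdry_abstr_wsc[OF T \<Xi> \<theta> mor_wsc[OF m] bdry_abstr(1)[unfolded X] bdry_abstr(4,5)[unfolded X]]
    obtain b where b: "b \<notin> fst ` set \<Gamma>'" using ex_fresh_var by blast
    have m': "mor (\<Gamma> @ [(a, A)]) (\<sigma>(a := FV b)) (\<Gamma>' @ [(b, act I \<sigma> A)])"
      using m bdry_abstr(3) b w by (intro mor_snoc)
    have "map_bdry (act I (\<sigma>(a := FV b))) (bdry_bsubst 0 (FV a) B) = bdry_bsubst 0 (FV b) (map_bdry (act I \<sigma>) B)"
      using mor_act_ok[OF m'] w bdry_abstr(3) by (intro map_bdry_abstr) auto
    then have "derivable_bdry T \<Theta> (\<Gamma>' @ [(b, act I \<sigma> A)]) (bdry_bsubst 0 (FV b) (map_bdry (act I \<sigma>) B))"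
      using bdry_abstr(6) m' X by metis
    moreover have "b \<notin> fv_bdry (map_bdry (act I \<sigma>) B)"
      using wsc_bdry_fv[OF wsc_bdry_act[OF mor_act_ok[OF m] w(2)]] b by blast
    ultimately show "derivable_bdry T \<Theta> \<Gamma>' (map_bdry (act I \<sigma>) (BAbs A B))"
      using bdry_abstr m X b by (auto intro: derivable_derivable_bdry.bdry_abstr)
  qed
next
  case (specific \<Phi> j X \<Gamma> K)
  show ?case
  proof (intro allI impI)
    fix \<sigma> \<Gamma>' assume X: "X = \<Xi>" and m: "mor \<Gamma> \<sigma> \<Gamma>'"
    note r = wsc_theory_rule[OF T specific(1)] and ok = mor_act_ok[OF m]
    note D = derivable_wsc(1)[OF T _ \<Xi> \<theta> mor_wsc[OF m]]
    have K: "act_ok (depths \<Phi>) {} \<theta> (fst ` set \<Gamma>) K FV"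
      using r D X by (intro inst_holds_act_ok[OF specific(2)]) auto
    have f: "map fst K = map fst \<Phi>" using specific(2) by (simp add: inst_holds_def)
    have e: "map_jthesis (act I \<sigma>) (inst_jthesis K j) = inst_jthesis (act_inst I \<sigma> K) j"
      using r by (intro act_inst_jthesis[OF K f ok]) auto
    have "inst_holds (derivable T \<Theta> \<Gamma>') \<Phi> (act_inst I \<sigma> K)"
      using r X m by (intro inst_holds_act[OF specific(2) _ _ ok]) (auto intro: D)
    moreover have "derivable_bdry T \<Theta> \<Gamma>' (BTh (bthesis_of (inst_jthesis (act_inst I \<sigma> K) j)))"
      using specific(4) m X e by (metis bthesis_of_map bdry.map(1))
    ultimately have "derivable T \<Theta> \<Gamma>' (JTh (inst_jthesis (act_inst I \<sigma> K) j))"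
      by (rule derivable_derivable_bdry.specific[OF specific(1)])
    then show "derivable T \<Theta> \<Gamma>' (map_jdg (act I \<sigma>) (JTh (inst_jthesis K j)))"
      using e by simp
  qed
next
  case (specific_cong_ty \<Phi> A X \<Gamma> K L)
  show ?case
  proof (intro allI impI)
    fix \<sigma> \<Gamma>' assume X: "X = \<Xi>" and m: "mor \<Gamma> \<sigma> \<Gamma>'"
    note r = wsc_theory_rule[OF T specific_cong_ty(1)] and ok = mor_act_ok[OF m]
    note D = derivable_wsc(1)[OF T _ \<Xi> \<theta> mor_wsc[OF m]]
    have K: "act_ok (depths \<Phi>) {} \<theta> (fst ` set \<Gamma>) K FV"
      using r D X by (intro inst_holds_act_ok[OF specific_cong_ty(2)]) auto
    have L: "act_ok (depths \<Phi>) {} \<theta> (fst ` set \<Gamma>) L FV"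
      using r D X by (intro inst_holds_act_ok[OF specific_cong_ty(3)]) auto
    have f: "map fst K = map fst \<Phi>" "map fst L = map fst \<Phi>"
      using specific_cong_ty(2,3) by (simp_all add: inst_holds_def)
    have e: "act I \<sigma> (inst_expr K A) = inst_expr (act_inst I \<sigma> K) A"
      "act I \<sigma> (inst_expr L A) = inst_expr (act_inst I \<sigma> L) A"
      using r by (auto intro: act_inst_expr[OF K f(1) ok] act_inst_expr[OF L f(2) ok])
    have "inst_holds (derivable T \<Theta> \<Gamma>') \<Phi> (act_inst I \<sigma> K)"
      using r X m by (intro inst_holds_act[OF specific_cong_ty(2) _ _ ok]) (auto intro: D)
    moreover have "inst_holds (derivable T \<Theta> \<Gamma>') \<Phi> (act_inst I \<sigma> L)"
      using r X m by (intro inst_holds_act[OF specific_cong_ty(3) _ _ ok]) (auto intro: D)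
    moreover have "inst_eq_holds (derivable T \<Theta> \<Gamma>') \<Phi> (act_inst I \<sigma> K) (act_inst I \<sigma> L)"
      using r X m by (intro inst_eq_holds_act[OF specific_cong_ty(2) f(2) specific_cong_ty(4) _ _ ok]) (auto intro: D)
    ultimately have "derivable T \<Theta> \<Gamma>' (JTh (EqTyJ (inst_expr (act_inst I \<sigma> K) A) (inst_expr (act_inst I \<sigma> L) A)))"
      by (rule derivable_derivable_bdry.specific_cong_ty[OF specific_cong_ty(1)])
    then show "derivable T \<Theta> \<Gamma>' (map_jdg (act I \<sigma>) (JTh (EqTyJ (inst_expr K A) (inst_expr L A))))"
      using e by simp
  qed
next
  case (specific_cong_tm \<Phi> t A X \<Gamma> K L)
  show ?case
  proof (intro allI impI)
    fix \<sigma> \<Gamma>' assume X: "X = \<Xi>" and m: "mor \<Gamma> \<sigma> \<Gamma>'"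
    note r = wsc_theory_rule[OF T specific_cong_tm(1)] and ok = mor_act_ok[OF m]
    note D = derivable_wsc(1)[OF T _ \<Xi> \<theta> mor_wsc[OF m]]
    have K: "act_ok (depths \<Phi>) {} \<theta> (fst ` set \<Gamma>) K FV"
      using r D X by (intro inst_holds_act_ok[OF specific_cong_tm(2)]) auto
    have L: "act_ok (depths \<Phi>) {} \<theta> (fst ` set \<Gamma>) L FV"
      using r D X by (intro inst_holds_act_ok[OF specific_cong_tm(3)]) auto
    have f: "map fst K = map fst \<Phi>" "map fst L = map fst \<Phi>"
      using specific_cong_tm(2,3) by (simp_all add: inst_holds_def)
    have e: "act I \<sigma> (inst_expr K e) = inst_expr (act_inst I \<sigma> K) e"
      "act I \<sigma> (inst_expr L e) = inst_expr (act_inst I \<sigma> L) e" if "e \<in> {t, A}" for e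
      using r that by (auto intro: act_inst_expr[OF K f(1) ok] act_inst_expr[OF L f(2) ok])
    have "inst_holds (derivable T \<Theta> \<Gamma>') \<Phi> (act_inst I \<sigma> K)"
      using r X m by (intro inst_holds_act[OF specific_cong_tm(2) _ _ ok]) (auto intro: D)
    moreover have "inst_holds (derivable T \<Theta> \<Gamma>') \<Phi> (act_inst I \<sigma> L)"
      using r X m by (intro inst_holds_act[OF specific_cong_tm(3) _ _ ok]) (auto intro: D)
    moreover have "inst_eq_holds (derivable T \<Theta> \<Gamma>') \<Phi> (act_inst I \<sigma> K) (act_inst I \<sigma> L)"
      using r X m by (intro inst_eq_holds_act[OF specific_cong_tm(2) f(2) specific_cong_tm(4) _ _ ok]) (auto intro: D)
    moreover have "derivable T \<Theta> \<Gamma>' (JTh (EqTyJ (inst_expr (act_inst I \<sigma> K) A) (inst_expr (act_inst I \<sigma> L) A)))"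
      using specific_cong_tm(6) X m by (auto simp: e[of A, symmetric])
    ultimately have "derivable T \<Theta> \<Gamma>' (JTh (EqTmJ (inst_expr (act_inst I \<sigma> K) t)
        (inst_expr (act_inst I \<sigma> L) t) (inst_expr (act_inst I \<sigma> K) A)))"
      by (rule derivable_derivable_bdry.specific_cong_tm[OF specific_cong_tm(1)])
    then show "derivable T \<Theta> \<Gamma>' (map_jdg (act I \<sigma>)
        (JTh (EqTmJ (inst_expr K t) (inst_expr L t) (inst_expr K A))))"
      using e by simp
  qed
next
  case (eqty_trans X \<Gamma> A B C)
  then show ?case by simp (meson derivable_derivable_bdry.eqty_trans)
next
  case (eqtm_trans X \<Gamma> s t A u)
  then show ?case by simp (meson derivable_derivable_bdry.eqtm_trans)
next
  case (conv_tm X \<Gamma> t A B)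
  then show ?case by simp (meson derivable_derivable_bdry.conv_tm)
next
  case (conv_eqtm X \<Gamma> s t A B)
  then show ?case by simp (meson derivable_derivable_bdry.conv_eqtm)
qed (auto intro: eqty_refl eqty_sym eqtm_refl eqtm_sym bdry_ty bdry_tm bdry_eqty bdry_eqtm)

lemma derivable_act:
  "derivable T \<Xi> \<Gamma> \<J> \<Longrightarrow> mor \<Gamma> \<sigma> \<Gamma>' \<Longrightarrow> derivable T \<Theta> \<Gamma>' (map_jdg (act I \<sigma>) \<J>)"
  using derivable_act_aux(1) by blast

end

lemma mapp_Nil [simp]: "mapp [] M = MApp M"
  by (simp add: mapp_def fun_eq_iff)

lemma wsc_mctx_bdry_ident:
  "wsc_mctx \<Theta> \<Longrightarrow> (M, B) \<in> set \<Theta> \<Longrightarrow> map_bdry (act [] FV) B = B"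
  by (rule map_bdry_act_ident[OF _ _ wsc_mctx_mem]) auto

section \<open>Renamings and weakening\<close>

definition ren_mor :: "'s mctx \<Rightarrow> 's vctx \<Rightarrow> (var \<Rightarrow> 's expr) \<Rightarrow> 's vctx \<Rightarrow> bool" where
  "ren_mor \<Theta> \<Gamma> \<sigma> \<Gamma>' \<longleftrightarrow> sub_ok (depths \<Theta>) (depths \<Theta>) [] \<Gamma> \<sigma> \<Gamma>' \<and>
    (\<forall>(a, A)\<in>set \<Gamma>. \<exists>b. \<sigma> a = FV b \<and> (b, act [] \<sigma> A) \<in> set \<Gamma>')"

lemma translation_ren:
  assumes "wsc_theory T" "wsc_mctx \<Theta>"
  shows "translation T \<Theta> \<Theta> [] (depths \<Theta>) (depths \<Theta>) (ren_mor \<Theta>)"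
proof (unfold_locales, goal_cases)
  case (5 \<Gamma> \<sigma> \<Gamma>' a A)
  then show ?case by (fastforce simp: ren_mor_def intro: derivable_derivable_bdry.var)
next
  case (6 \<Gamma> \<sigma> \<Gamma>' a b A)
  then have ok: "sub_ok (depths \<Theta>) (depths \<Theta>) [] \<Gamma> \<sigma> \<Gamma>'" by (simp add: ren_mor_def)
  then have "sub_ok (depths \<Theta>) (depths \<Theta>) [] (\<Gamma> @ [(a, A)]) (\<sigma>(a := FV b)) (\<Gamma>' @ [(b, act [] \<sigma> A)])"
    using 6 wsc_act by (intro sub_ok_snoc) (auto simp: sub_ok_def)
  moreover have "\<exists>b'. (\<sigma>(a := FV b)) c = FV b' \<and> (b', act [] (\<sigma>(a := FV b)) C) \<in> set (\<Gamma>' @ [(b, act [] \<sigma> A)])"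
    if "(c, C) \<in> set (\<Gamma> @ [(a, A)])" for c C
  proof (cases "c = a")
    case True
    then have "C = A" using that 6 by force
    then show ?thesis using 6 True by (simp add: act_fun_upd)
  next
    case False
    then have "(c, C) \<in> set \<Gamma>" using that by auto
    then have "act [] (\<sigma>(a := FV b)) C = act [] \<sigma> C"
      using 6 ok by (intro act_fun_upd[where \<gamma> = "fst ` set \<Gamma>"]) (auto simp: sub_ok_def intro: wsc_vctx_mem)
    then show ?thesis using False 6(1) \<open>(c, C) \<in> set \<Gamma>\<close> by (fastforce simp: ren_mor_def)
  qed
  ultimately show ?case by (fastforce simp: ren_mor_def)
next
  case (7 \<Gamma> \<sigma> \<Gamma>' M B)
  then show ?case using assms by (simp add: wsc_mctx_bdry_ident head_ok_MApp)
qed (use assms in \<open>auto simp: ren_mor_def\<close>)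

lemma act_ok_FV: "\<gamma> \<subseteq> \<gamma>' \<Longrightarrow> act_ok \<theta> \<gamma> \<theta> \<gamma>' [] FV"
  by (auto simp: act_ok_def)

text \<open>The identity is a renaming from \<open>\<Gamma>\<close> to \<open>\<Gamma>'\<close>. A
  direct induction on inclusions would stall at abstraction, where the chosen variable may already
  be declared in \<open>\<Gamma>'\<close>; renamings can change it.\<close>

lemma weakening:
  assumes "wsc_theory T" "wsc_mctx \<Theta>" "wsc_vctx (depths \<Theta>) \<Gamma>" "wsc_vctx (depths \<Theta>) \<Gamma>'"
    and "set \<Gamma> \<subseteq> set \<Gamma>'" "derivable T \<Theta> \<Gamma> \<J>"
  shows "derivable T \<Theta> \<Gamma>' \<J>"
proof -
  have "act [] FV A = A" if "(a, A) \<in> set \<Gamma>" for a A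
    using wsc_vctx_mem[OF assms(3) that] by (intro act_ident) auto
  then have "ren_mor \<Theta> \<Gamma> FV \<Gamma>'"
    using assms by (auto simp: ren_mor_def sub_ok_def intro!: act_ok_FV)
  then have "derivable T \<Theta> \<Gamma>' (map_jdg (act [] FV) \<J>)"
    using translation.derivable_act[OF translation_ren] assms by blast
  moreover have "map_jdg (act [] FV) \<J> = \<J>"
    by (rule map_jdg_act_ident[OF _ _ derivable_wsc(1)[OF assms(1,6,2) _ assms(3)]]) auto
  ultimately show ?thesis by simp
qed

section \<open>Typed morphisms and substitution\<close>

text \<open>\<open>\<Delta>\<close> is the context over which the entries of \<open>I\<close> are
  derivable. The target must keep containing it while binders enlarge the target, so that these
  entries remain available by weakening.\<close>

definition inst_mor ::
  "'s rule set \<Rightarrow> 's mctx \<Rightarrow> 's vctx \<Rightarrow> (mvar \<Rightarrow> nat option) \<Rightarrow> 's inst \<Rightarrow>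
    's vctx \<Rightarrow> (var \<Rightarrow> 's expr) \<Rightarrow> 's vctx \<Rightarrow> bool" where
  "inst_mor T \<Theta> \<Delta> \<theta> I \<Gamma> \<sigma> \<Gamma>' \<longleftrightarrow> sub_ok \<theta> (depths \<Theta>) I \<Gamma> \<sigma> \<Gamma>' \<and> set \<Delta> \<subseteq> set \<Gamma>' \<and>
    (\<forall>(a, A)\<in>set \<Gamma>. derivable T \<Theta> \<Gamma>' (JTh (TmJ (\<sigma> a) (act I \<sigma> A))))"

lemma inst_mor_act_ok: "inst_mor T \<Theta> \<Delta> \<theta> I \<Gamma> \<sigma> \<Gamma>' \<Longrightarrow> act_ok \<theta> (fst ` set \<Gamma>) (depths \<Theta>) (fst ` set \<Gamma>') I \<sigma>"
  and inst_mor_dom: "inst_mor T \<Theta> \<Delta> \<theta> I \<Gamma> \<sigma> \<Gamma>' \<Longrightarrow> wsc_vctx \<theta> \<Gamma>"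
  and inst_mor_cod: "inst_mor T \<Theta> \<Delta> \<theta> I \<Gamma> \<sigma> \<Gamma>' \<Longrightarrow> wsc_vctx (depths \<Theta>) \<Gamma>'"
  and inst_mor_base: "inst_mor T \<Theta> \<Delta> \<theta> I \<Gamma> \<sigma> \<Gamma>' \<Longrightarrow> set \<Delta> \<subseteq> set \<Gamma>'"
  unfolding inst_mor_def sub_ok_def by auto

lemma inst_mor_weaken:
  assumes "wsc_theory T" "wsc_mctx \<Theta>" "inst_mor T \<Theta> \<Delta> \<theta> I \<Gamma> \<sigma> \<Gamma>'"
    and "set \<Gamma>' \<subseteq> set \<Gamma>''" "wsc_vctx (depths \<Theta>) \<Gamma>''"
  shows "inst_mor T \<Theta> \<Delta> \<theta> I \<Gamma> \<sigma> \<Gamma>''"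
  using assms act_ok_mono[of \<theta> _ _ _ I \<sigma> "fst ` set \<Gamma>''"]
    weakening[OF assms(1,2) inst_mor_cod[OF assms(3)] assms(5,4)]
  unfolding inst_mor_def sub_ok_def by (blast intro: image_mono)

lemma inst_mor_insert:
  assumes T: "wsc_theory T" "wsc_mctx \<Theta>" and m: "inst_mor T \<Theta> \<Delta> \<theta> I \<Gamma> \<sigma> \<Gamma>'"
    and A: "wsc \<theta> (fst ` set \<Gamma>) 0 0 A" and a: "a \<notin> fst ` set \<Gamma>"
    and t: "derivable T \<Theta> \<Gamma>' (JTh (TmJ t (act I \<sigma> A)))"
  shows "inst_mor T \<Theta> \<Delta> \<theta> I (\<Gamma> @ [(a, A)]) (\<sigma>(a := t)) \<Gamma>'"
proof -
  have "wsc (depths \<Theta>) (fst ` set \<Gamma>') 0 0 t"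
    using derivable_wsc(1)[OF T(1) t T(2) _ inst_mor_cod[OF m]] by auto
  then have "sub_ok \<theta> (depths \<Theta>) I (\<Gamma> @ [(a, A)]) (\<sigma>(a := t)) \<Gamma>'"
    using m A by (intro sub_ok_insert) (auto simp: inst_mor_def)
  moreover have "derivable T \<Theta> \<Gamma>' (JTh (TmJ ((\<sigma>(a := t)) c) (act I (\<sigma>(a := t)) C)))"
    if "(c, C) \<in> set (\<Gamma> @ [(a, A)])" for c C
  proof (cases "c = a")
    case True
    then have "C = A" using that a by force
    then show ?thesis using A True a t by (simp add: act_fun_upd)
  next
    case False
    then have "(c, C) \<in> set \<Gamma>" using that by auto
    moreover from this have "act I (\<sigma>(a := t)) C = act I \<sigma> C"
      using inst_mor_dom[OF m] a by (intro act_fun_upd[where \<gamma> = "fst ` set \<Gamma>"]) (auto intro: wsc_vctx_mem)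
    ultimately show ?thesis using False m by (auto simp: inst_mor_def)
  qed
  ultimately show ?thesis using m unfolding inst_mor_def by blast
qed

lemma inst_mor_snoc:
  assumes T: "wsc_theory T" "wsc_mctx \<Theta>" and m: "inst_mor T \<Theta> \<Delta> \<theta> I \<Gamma> \<sigma> \<Gamma>'"
    and A: "wsc \<theta> (fst ` set \<Gamma>) 0 0 A" and a: "a \<notin> fst ` set \<Gamma>"
  shows "inst_mor T \<Theta> \<Delta> \<theta> I (\<Gamma> @ [(a, A)]) (\<sigma>(a := FV b)) (\<Gamma>' @ [(b, act I \<sigma> A)])"
proof -
  have "wsc_vctx (depths \<Theta>) (\<Gamma>' @ [(b, act I \<sigma> A)])"
    using inst_mor_cod[OF m] wsc_act[OF inst_mor_act_ok[OF m] A] by (rule wsc_vctx_snoc)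
  then have "inst_mor T \<Theta> \<Delta> \<theta> I \<Gamma> \<sigma> (\<Gamma>' @ [(b, act I \<sigma> A)])"
    by (intro inst_mor_weaken[OF T m]) auto
  then show ?thesis
    by (rule inst_mor_insert[OF T _ A a]) (simp add: derivable_derivable_bdry.var)
qed

text \<open>Variables and binders are treated alike for substitutions and instantiations; what
  distinguishes the two is the translation of heads, which is left as a hypothesis.\<close>

lemma translation_inst_mor:
  assumes "wsc_theory T" "wsc_mctx \<Xi>" "depths \<Xi> \<subseteq>\<^sub>m \<theta>" "wsc_mctx \<Theta>"
    and "\<And>\<Gamma>' M B. set \<Delta> \<subseteq> set \<Gamma>' \<Longrightarrow> wsc_vctx (depths \<Theta>) \<Gamma>' \<Longrightarrow> (M, B) \<in> set \<Xi> \<Longrightarrow>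
      head_ok T \<Theta> \<Gamma>' (map_bdry (act I FV) B) (mapp I M)"
  shows "translation T \<Xi> \<Theta> I \<theta> (depths \<Theta>) (inst_mor T \<Theta> \<Delta> \<theta> I)"
proof (unfold_locales, goal_cases)
  case (6 \<Gamma> \<sigma> \<Gamma>' a b A)
  then show ?case using inst_mor_snoc assms by blast
next
  case (7 \<Gamma> \<sigma> \<Gamma>' M B)
  then show ?case using assms(5) inst_mor_base inst_mor_cod by blast
qed (use assms in \<open>auto simp: inst_mor_def\<close>)

abbreviation "sub_mor T \<Theta> \<equiv> inst_mor T \<Theta> [] (depths \<Theta>) []"

lemma translation_sub:
  assumes "wsc_theory T" "wsc_mctx \<Theta>"
  shows "translation T \<Theta> \<Theta> [] (depths \<Theta>) (depths \<Theta>) (sub_mor T \<Theta>)"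
  using assms by (intro translation_inst_mor) (auto simp: wsc_mctx_bdry_ident head_ok_MApp)

lemmas substitution = translation.derivable_act[OF translation_sub]

lemma vctx_act_ident:
  "wsc_vctx \<theta> \<Gamma> \<Longrightarrow> (a, A) \<in> set \<Gamma> \<Longrightarrow> act [] FV A = A"
  by (rule act_ident[OF _ _ wsc_vctx_mem]) auto

lemma sub_mor_id: "wsc_vctx (depths \<Theta>) \<Gamma> \<Longrightarrow> sub_mor T \<Theta> \<Gamma> FV \<Gamma>"
  unfolding inst_mor_def sub_ok_def
  by (auto simp: vctx_act_ident act_ok_FV intro: derivable_derivable_bdry.var)

section \<open>Applying abstracted judgements to spines\<close>

text \<open>Only the abstraction rule concludes an abstracted judgement. Inverting it gives the body
  opened at some \<open>a\<close>, and the substitution that is the identity except for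
  \<open>a := t\<close> does the rest.\<close>

lemma derivable_JAbs_bsubst:
  assumes T: "wsc_theory T" "wsc_mctx \<Theta>" and \<Gamma>: "wsc_vctx (depths \<Theta>) \<Gamma>"
    and J: "derivable T \<Theta> \<Gamma> (JAbs A \<J>)" and t: "derivable T \<Theta> \<Gamma> (JTh (TmJ t A))"
  shows "derivable T \<Theta> \<Gamma> (jdg_bsubst 0 t \<J>)"
  using J
proof cases
  case (abstr a)
  note w = abstr_wsc[OF T map_le_refl \<Gamma> abstr(1,3,4)]
  have m: "sub_mor T \<Theta> (\<Gamma> @ [(a, A)]) (FV(a := t)) \<Gamma>"
    using t w(1) by (intro inst_mor_insert[OF T sub_mor_id[OF \<Gamma>] w(1) abstr(2)]) (subst act_ident, auto)
  have "map_jdg (act [] (FV(a := t))) (jdg_bsubst 0 (FV a) \<J>) = jdg_bsubst 0 t (map_jdg (act [] FV) \<J>)"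
    using inst_mor_act_ok[OF m] by (intro map_jdg_abstr[OF _ w(2) abstr(2)]) simp
  moreover have "map_jdg (act [] FV) \<J> = \<J>"
    by (rule map_jdg_act_ident[OF _ _ w(2)]) auto
  ultimately show ?thesis using substitution[OF T abstr(4) m] by simp
qed

lemma typed_Cons:
  "typed T \<Theta> \<Gamma> (BAbs A B) (t # ts) \<longleftrightarrow>
    derivable T \<Theta> \<Gamma> (JTh (TmJ t A)) \<and> typed T \<Theta> \<Gamma> (bdry_bsubst 0 t B) ts"
  unfolding typed_def by (auto simp: nth_Cons split: nat.split)

lemma typed_eq_Cons:
  "typed_eq T \<Theta> \<Gamma> (BAbs A B) (s # ss) (t # ts) \<longleftrightarrow>
    derivable T \<Theta> \<Gamma> (JTh (EqTmJ s t A)) \<and> typed_eq T \<Theta> \<Gamma> (bdry_bsubst 0 s B) ss ts"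
  unfolding typed_eq_def by (auto simp: nth_Cons split: nat.split)

lemma typed_Cons_cases:
  assumes "typed T \<Theta> \<Gamma> B (t # ts)"
  obtains A B' where "B = BAbs A B'"
  using assms unfolding typed_def by (cases B) auto

lemma typed_Nil: "typed T \<Theta> \<Gamma> B [] \<longleftrightarrow> bdry_depth B = 0"
  by (auto simp: typed_def)

lemma derivable_fill_spine:
  assumes T: "wsc_theory T" "wsc_mctx \<Theta>" and \<Gamma>: "wsc_vctx (depths \<Theta>) \<Gamma>"
  shows "derivable T \<Theta> \<Gamma> \<J> \<Longrightarrow> fill B e = Some \<J> \<Longrightarrow> typed T \<Theta> \<Gamma> B ts \<Longrightarrow> bdry_app B ts = BTh b \<Longrightarrow>
    \<exists>j. fill_thesis b (arg_app e ts) = Some j \<and> derivable T \<Theta> \<Gamma> (JTh j)"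
proof (induction ts arbitrary: B e \<J>)
  case Nil
  then show ?case by auto
next
  case (Cons t ts)
  obtain A B' where B: "B = BAbs A B'" using Cons.prems(3) by (rule typed_Cons_cases)
  with Cons.prems obtain e' \<J>' where e: "e = Abs e'" "\<J> = JAbs A \<J>'" "fill B' e' = Some \<J>'"
    by (cases e) auto
  have "derivable T \<Theta> \<Gamma> (jdg_bsubst 0 t \<J>')"
    using Cons.prems B e by (intro derivable_JAbs_bsubst[OF T \<Gamma>]) (auto simp: typed_Cons)
  then show ?case
    using Cons.IH[OF _ fill_bsubst[OF e(3)]] Cons.prems B e by (auto simp: typed_Cons)
qed

text \<open>Each argument strips one binder from the abstracted equation. Applied to the equality of
  two instantiations, this compares two heads on the same arguments.\<close>

lemma derivable_fill_eq_spine: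
  assumes T: "wsc_theory T" "wsc_mctx \<Theta>" and \<Gamma>: "wsc_vctx (depths \<Theta>) \<Gamma>"
  shows "derivable T \<Theta> \<Gamma> \<J> \<Longrightarrow> fill_eq B e f = Some \<J> \<Longrightarrow> typed T \<Theta> \<Gamma> B ts \<Longrightarrow> bdry_app B ts = BTh b \<Longrightarrow>
    \<exists>\<J>'. fill_eq (BTh b) (arg_app e ts) (arg_app f ts) = Some \<J>' \<and> derivable T \<Theta> \<Gamma> \<J>'"
proof (induction ts arbitrary: B e f \<J>)
  case Nil
  then show ?case by auto
next
  case (Cons t ts)
  obtain A B' where B: "B = BAbs A B'" using Cons.prems(3) by (rule typed_Cons_cases)
  with Cons.prems obtain e' f' \<J>' where e: "e = Abs e'" "f = Abs f'" "\<J> = JAbs A \<J>'" "fill_eq B' e' f' = Some \<J>'"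
    by (cases e; cases f) auto
  have "derivable T \<Theta> \<Gamma> (jdg_bsubst 0 t \<J>')"
    using Cons.prems B e by (intro derivable_JAbs_bsubst[OF T \<Gamma>]) (auto simp: typed_Cons)
  then show ?case
    using Cons.IH[OF _ fill_eq_bsubst[OF e(4)]] Cons.prems B e by (auto simp: typed_Cons)
qed

subsection \<open>Equality of morphisms\<close>

text \<open>Each side types a variable at its own translated type, while the equation is stated at
  the left one; passing between the two types is always by an explicit conversion.\<close>

definition eq_mor ::
  "'s rule set \<Rightarrow> 's mctx \<Rightarrow> 's vctx \<Rightarrow> (mvar \<Rightarrow> nat option) \<Rightarrow> 's inst \<Rightarrow> 's inst \<Rightarrow>
    's vctx \<Rightarrow> (var \<Rightarrow> 's expr) \<Rightarrow> (var \<Rightarrow> 's expr) \<Rightarrow> 's vctx \<Rightarrow> bool" where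
  "eq_mor T \<Theta> \<Delta> \<theta> I J \<Gamma> \<sigma> \<tau> \<Gamma>' \<longleftrightarrow>
    inst_mor T \<Theta> \<Delta> \<theta> I \<Gamma> \<sigma> \<Gamma>' \<and> inst_mor T \<Theta> \<Delta> \<theta> J \<Gamma> \<tau> \<Gamma>' \<and>
    (\<forall>(a, A)\<in>set \<Gamma>. derivable T \<Theta> \<Gamma>' (JTh (EqTmJ (\<sigma> a) (\<tau> a) (act I \<sigma> A))))"

lemma eq_mor_weaken:
  assumes "wsc_theory T" "wsc_mctx \<Theta>" "eq_mor T \<Theta> \<Delta> \<theta> I J \<Gamma> \<sigma> \<tau> \<Gamma>'"
    and "set \<Gamma>' \<subseteq> set \<Gamma>''" "wsc_vctx (depths \<Theta>) \<Gamma>''"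
  shows "eq_mor T \<Theta> \<Delta> \<theta> I J \<Gamma> \<sigma> \<tau> \<Gamma>''"
  using assms inst_mor_weaken[OF assms(1,2) _ assms(4,5)] inst_mor_cod
    weakening[OF assms(1,2) _ assms(5,4)]
  unfolding eq_mor_def by blast

lemma eq_mor_insert:
  assumes T: "wsc_theory T" "wsc_mctx \<Theta>" and m: "eq_mor T \<Theta> \<Delta> \<theta> I J \<Gamma> \<sigma> \<tau> \<Gamma>'"
    and A: "wsc \<theta> (fst ` set \<Gamma>) 0 0 A" and a: "a \<notin> fst ` set \<Gamma>"
    and s: "derivable T \<Theta> \<Gamma>' (JTh (TmJ s (act I \<sigma> A)))"
    and t: "derivable T \<Theta> \<Gamma>' (JTh (TmJ t (act J \<tau> A)))"
    and e: "derivable T \<Theta> \<Gamma>' (JTh (EqTmJ s t (act I \<sigma> A)))"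
  shows "eq_mor T \<Theta> \<Delta> \<theta> I J (\<Gamma> @ [(a, A)]) (\<sigma>(a := s)) (\<tau>(a := t)) \<Gamma>'"
proof -
  have mI: "inst_mor T \<Theta> \<Delta> \<theta> I \<Gamma> \<sigma> \<Gamma>'" and mJ: "inst_mor T \<Theta> \<Delta> \<theta> J \<Gamma> \<tau> \<Gamma>'"
    using m by (auto simp: eq_mor_def)
  have "derivable T \<Theta> \<Gamma>' (JTh (EqTmJ ((\<sigma>(a := s)) c) ((\<tau>(a := t)) c) (act I (\<sigma>(a := s)) C)))"
    if "(c, C) \<in> set (\<Gamma> @ [(a, A)])" for c C
  proof (cases "c = a")
    case True
    then have "C = A" using that a by force
    then show ?thesis using A True a e by (simp add: act_fun_upd)
  next
    case False
    then have "(c, C) \<in> set \<Gamma>" using that by auto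
    moreover from this have "act I (\<sigma>(a := s)) C = act I \<sigma> C"
      using inst_mor_dom[OF mI] a by (intro act_fun_upd[where \<gamma> = "fst ` set \<Gamma>"]) (auto intro: wsc_vctx_mem)
    ultimately show ?thesis using False m by (auto simp: eq_mor_def)
  qed
  then show ?thesis
    using inst_mor_insert[OF T mI A a s] inst_mor_insert[OF T mJ A a t]
    unfolding eq_mor_def by blast
qed

text \<open>In the target the new variable has the left type. The equation of the two translated
  types is needed to convert it to the right type, so that it also extends the right
  morphism.\<close>

lemma eq_mor_snoc:
  assumes T: "wsc_theory T" "wsc_mctx \<Theta>" and m: "eq_mor T \<Theta> \<Delta> \<theta> I J \<Gamma> \<sigma> \<tau> \<Gamma>'"
    and A: "wsc \<theta> (fst ` set \<Gamma>) 0 0 A" and a: "a \<notin> fst ` set \<Gamma>"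
    and e: "derivable T \<Theta> \<Gamma>' (JTh (EqTyJ (act I \<sigma> A) (act J \<tau> A)))"
  shows "eq_mor T \<Theta> \<Delta> \<theta> I J (\<Gamma> @ [(a, A)]) (\<sigma>(a := FV b)) (\<tau>(a := FV b)) (\<Gamma>' @ [(b, act I \<sigma> A)])"
proof -
  let ?\<Gamma> = "\<Gamma>' @ [(b, act I \<sigma> A)]"
  have mI: "inst_mor T \<Theta> \<Delta> \<theta> I \<Gamma> \<sigma> \<Gamma>'" using m by (auto simp: eq_mor_def)
  have w: "wsc_vctx (depths \<Theta>) ?\<Gamma>"
    using inst_mor_cod[OF mI] wsc_act[OF inst_mor_act_ok[OF mI] A] by (rule wsc_vctx_snoc)
  have b: "derivable T \<Theta> ?\<Gamma> (JTh (TmJ (FV b) (act I \<sigma> A)))"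
    by (simp add: derivable_derivable_bdry.var)
  have "derivable T \<Theta> ?\<Gamma> (JTh (EqTyJ (act I \<sigma> A) (act J \<tau> A)))"
    using e by (intro weakening[OF T inst_mor_cod[OF mI] w]) auto
  then have "derivable T \<Theta> ?\<Gamma> (JTh (TmJ (FV b) (act J \<tau> A)))"
    using b by (rule conv_tm[rotated])
  moreover have "eq_mor T \<Theta> \<Delta> \<theta> I J \<Gamma> \<sigma> \<tau> ?\<Gamma>"
    using w by (intro eq_mor_weaken[OF T m]) auto
  ultimately show ?thesis using b by (intro eq_mor_insert[OF T _ A a] eqtm_refl)
qed

lemma wsc_jdg_eq:
  "act_ok \<theta> \<gamma> \<theta>' \<gamma>' I \<sigma> \<Longrightarrow> act_ok \<theta> \<gamma> \<theta>' \<gamma>' J \<tau> \<Longrightarrow> wsc_jdg \<theta> \<gamma> k \<J> \<Longrightarrow> obj_jdg \<J> \<Longrightarrow>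
    wsc_jdg \<theta>' \<gamma>' k (jdg_eq (act I \<sigma>) (act J \<tau>) \<J>)"
proof (induction \<J> arbitrary: k)
  case (JTh j)
  then show ?case by (cases j) (auto simp: wsc_act)
qed (auto simp: wsc_act)

lemma jdg_eq_abstr:
  assumes ok: "act_ok \<theta> (insert a \<gamma>) \<theta>' \<gamma>' I (\<sigma>(a := t))" "act_ok \<theta> (insert a \<gamma>) \<theta>' \<gamma>' J (\<tau>(a := t))"
    and J: "wsc_jdg \<theta> \<gamma> (Suc 0) \<J>" "obj_jdg \<J>" and a: "a \<notin> \<gamma>"
  shows "jdg_eq (act I (\<sigma>(a := t))) (act J (\<tau>(a := t))) (jdg_bsubst 0 (FV a) \<J>) =
    jdg_bsubst 0 t (jdg_eq (act I \<sigma>) (act J \<tau>) \<J>)"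
proof -
  have "jdg_eq (act I (\<sigma>(a := t))) (act J (\<tau>(a := t))) (jdg_bsubst 0 (FV a) \<J>) =
      jdg_bsubst 0 (act I (\<sigma>(a := t)) (FV a)) (jdg_eq (act I (\<sigma>(a := t))) (act J (\<tau>(a := t))) \<J>)"
    using J(2) by (intro jdg_eq_bsubst[where k = 0, OF ok] wsc_jdg_mono[OF J(1)]) auto
  moreover have "jdg_eq (act I (\<sigma>(a := t))) (act J (\<tau>(a := t))) \<J> = jdg_eq (act I \<sigma>) (act J \<tau>) \<J>"
    using a by (intro jdg_eq_act_cong[OF _ _ J]) auto
  ultimately show ?thesis by simp
qed

lemma act_abstr:
  assumes ok: "act_ok \<theta> (insert a \<gamma>) \<theta>' \<gamma>' I (\<sigma>(a := t))"
    and e: "wsc \<theta> \<gamma> (Suc 0) n e" and a: "a \<notin> \<gamma>"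
  shows "act I (\<sigma>(a := t)) (bsubst 0 (FV a) e) = bsubst 0 t (act I \<sigma> e)"
proof -
  have "act I (\<sigma>(a := t)) (bsubst 0 (FV a) e) =
      bsubst 0 (act I (\<sigma>(a := t)) (FV a)) (act I (\<sigma>(a := t)) e)"
    by (rule act_bsubst[where k = 0, OF ok wsc_mono[OF e]]) auto
  moreover have "act I (\<sigma>(a := t)) e = act I \<sigma> e"
    using a e by (rule act_fun_upd)
  ultimately show ?thesis by simp
qed

text \<open>The congruence clauses of \<open>head_ok\<close> in a heterogeneous form: two heads, and
  two boundaries, each spine being typed by its own boundary.\<close>

definition eq_head_ok ::
  "'s rule set \<Rightarrow> 's mctx \<Rightarrow> 's vctx \<Rightarrow> 's expr bdry \<Rightarrow> 's expr bdry \<Rightarrow>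
    ('s expr list \<Rightarrow> 's expr) \<Rightarrow> ('s expr list \<Rightarrow> 's expr) \<Rightarrow> bool" where
  "eq_head_ok T \<Theta> \<Gamma> B B' h h' \<longleftrightarrow>
    (\<forall>ss ts. typed T \<Theta> \<Gamma> B ss \<longrightarrow> typed T \<Theta> \<Gamma> B' ts \<longrightarrow> typed_eq T \<Theta> \<Gamma> B ss ts \<longrightarrow>
      (bdry_app B ss = BTh TyB \<longrightarrow> derivable T \<Theta> \<Gamma> (JTh (EqTyJ (h ss) (h' ts)))) \<and>
      (\<forall>C C'. bdry_app B ss = BTh (TmB C) \<longrightarrow> bdry_app B' ts = BTh (TmB C') \<longrightarrow>
        derivable T \<Theta> \<Gamma> (JTh (EqTyJ C C')) \<longrightarrow> derivable T \<Theta> \<Gamma> (JTh (EqTmJ (h ss) (h' ts) C))))"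

lemma eq_head_ok_ty:
  "eq_head_ok T \<Theta> \<Gamma> B B' h h' \<Longrightarrow> typed T \<Theta> \<Gamma> B ss \<Longrightarrow> typed T \<Theta> \<Gamma> B' ts \<Longrightarrow> typed_eq T \<Theta> \<Gamma> B ss ts \<Longrightarrow>
    bdry_app B ss = BTh TyB \<Longrightarrow> derivable T \<Theta> \<Gamma> (JTh (EqTyJ (h ss) (h' ts)))"
  unfolding eq_head_ok_def by blast

lemma eq_head_ok_tm:
  "eq_head_ok T \<Theta> \<Gamma> B B' h h' \<Longrightarrow> typed T \<Theta> \<Gamma> B ss \<Longrightarrow> typed T \<Theta> \<Gamma> B' ts \<Longrightarrow> typed_eq T \<Theta> \<Gamma> B ss ts \<Longrightarrow>
    bdry_app B ss = BTh (TmB C) \<Longrightarrow> bdry_app B' ts = BTh (TmB C') \<Longrightarrow>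
    derivable T \<Theta> \<Gamma> (JTh (EqTyJ C C')) \<Longrightarrow> derivable T \<Theta> \<Gamma> (JTh (EqTmJ (h ss) (h' ts) C))"
  unfolding eq_head_ok_def by blast

lemma head_ok_eq: "head_ok T \<Theta> \<Gamma> B h \<Longrightarrow> eq_head_ok T \<Theta> \<Gamma> B B h h"
  unfolding head_ok_def eq_head_ok_def by blast

lemma obj_bdry_app: "obj_bdry (bdry_app B ts) = obj_bdry B"
proof (induction ts arbitrary: B)
  case (Cons t ts)
  then show ?case by (cases B) auto
qed simp

lemma bdry_app_core:
  "length ts = bdry_depth B \<Longrightarrow> \<exists>b. bdry_app B ts = BTh b \<and> bthesis_class b = fst (bdry_arity B)"
proof (induction ts arbitrary: B)
  case Nil
  then show ?case by (cases B) auto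
next
  case (Cons t ts)
  show ?case
  proof (cases B)
    case (BAbs A B')
    then show ?thesis using Cons.IH[of "bdry_bsubst 0 t B'"] Cons.prems by simp
  qed (use Cons.prems in auto)
qed

text \<open>\<open>left\<close> and \<open>right\<close> are the stability results for either side.
  \<open>head\<close> concerns object boundaries, as equations are not compared, and must hold in
  every context above \<open>\<Delta>\<close>, since binders enlarge the target.\<close>

locale eq_translation =
  fixes T :: "'s rule set" and \<Xi> \<Theta> :: "'s mctx" and \<Delta> :: "'s vctx"
    and \<theta> :: "mvar \<Rightarrow> nat option" and I J :: "'s inst"
  assumes T: "wsc_theory T" and \<Xi>: "wsc_mctx \<Xi>" and \<theta>: "depths \<Xi> \<subseteq>\<^sub>m \<theta>" and \<Theta>: "wsc_mctx \<Theta>"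
    and left: "derivable T \<Xi> \<Gamma> \<J> \<Longrightarrow> inst_mor T \<Theta> \<Delta> \<theta> I \<Gamma> \<sigma> \<Gamma>' \<Longrightarrow>
      derivable T \<Theta> \<Gamma>' (map_jdg (act I \<sigma>) \<J>)"
    and right: "derivable T \<Xi> \<Gamma> \<J> \<Longrightarrow> inst_mor T \<Theta> \<Delta> \<theta> J \<Gamma> \<sigma> \<Gamma>' \<Longrightarrow>
      derivable T \<Theta> \<Gamma>' (map_jdg (act J \<sigma>) \<J>)"
    and head: "set \<Delta> \<subseteq> set \<Gamma>' \<Longrightarrow> wsc_vctx (depths \<Theta>) \<Gamma>' \<Longrightarrow> (M, B) \<in> set \<Xi> \<Longrightarrow> obj_bdry B \<Longrightarrow>
      eq_head_ok T \<Theta> \<Gamma>' (map_bdry (act I FV) B) (map_bdry (act J FV) B) (mapp I M) (mapp J M)"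
begin

abbreviation "mor \<equiv> eq_mor T \<Theta> \<Delta> \<theta> I J"

lemma mor_left: "mor \<Gamma> \<sigma> \<tau> \<Gamma>' \<Longrightarrow> inst_mor T \<Theta> \<Delta> \<theta> I \<Gamma> \<sigma> \<Gamma>'"
  and mor_right: "mor \<Gamma> \<sigma> \<tau> \<Gamma>' \<Longrightarrow> inst_mor T \<Theta> \<Delta> \<theta> J \<Gamma> \<tau> \<Gamma>'"
  by (auto simp: eq_mor_def)

text \<open>\<open>P\<close> stands for the induction hypothesis. The first three conclusions are
  the instantiation premises of the congruence rule for a specific rule; the last two bring its
  conclusion into the required form.\<close>

lemma specific_inst_holds:
  assumes K: "inst_holds (\<lambda>\<J>. derivable T \<Xi> \<Gamma> \<J> \<and> P \<J>) \<Phi> K" and \<Phi>: "wsc_mctx \<Phi>"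
    and m: "mor \<Gamma> \<sigma> \<tau> \<Gamma>'" and j: "wsc_jdg (depths \<Phi>) {} 0 (JTh j)"
    and P: "\<And>\<J>. P \<J> \<Longrightarrow> obj_jdg \<J> \<Longrightarrow> derivable T \<Theta> \<Gamma>' (jdg_eq (act I \<sigma>) (act J \<tau>) \<J>)"
  shows "inst_holds (derivable T \<Theta> \<Gamma>') \<Phi> (act_inst I \<sigma> K)"
    and "inst_holds (derivable T \<Theta> \<Gamma>') \<Phi> (act_inst J \<tau> K)"
    and "inst_eq_holds (derivable T \<Theta> \<Gamma>') \<Phi> (act_inst I \<sigma> K) (act_inst J \<tau> K)"
    and "e \<in> set_jthesis j \<Longrightarrow> act I \<sigma> (inst_expr K e) = inst_expr (act_inst I \<sigma> K) e"
    and "e \<in> set_jthesis j \<Longrightarrow> act J \<tau> (inst_expr K e) = inst_expr (act_inst J \<tau> K) e"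
proof -
  note mI = mor_left[OF m] and mJ = mor_right[OF m]
  note okI = inst_mor_act_ok[OF mI] and okJ = inst_mor_act_ok[OF mJ]
  note D = derivable_wsc(1)[OF T _ \<Xi> \<theta> inst_mor_dom[OF mI]]
  have K': "act_ok (depths \<Phi>) {} \<theta> (fst ` set \<Gamma>) K FV"
    using \<Phi> D by (intro inst_holds_act_ok[OF K]) (auto simp: wsc_mctx_def)
  have f: "map fst K = map fst \<Phi>" using K by (simp add: inst_holds_def)
  show "inst_holds (derivable T \<Theta> \<Gamma>') \<Phi> (act_inst I \<sigma> K)"
    using mI by (intro inst_holds_act[OF K \<Phi> _ okI]) (auto intro: D left)
  show "inst_holds (derivable T \<Theta> \<Gamma>') \<Phi> (act_inst J \<tau> K)"
    using mJ by (intro inst_holds_act[OF K \<Phi> _ okJ]) (auto intro: D right)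
  show "inst_eq_holds (derivable T \<Theta> \<Gamma>') \<Phi> (act_inst I \<sigma> K) (act_inst J \<tau> K)"
    using P by (intro inst_eq_holds_of_inst_holds[OF K \<Phi> _ okI]) (auto intro: D)
  assume "e \<in> set_jthesis j"
  then have "wsc (depths \<Phi>) {} 0 0 e" using j by simp
  then show "act I \<sigma> (inst_expr K e) = inst_expr (act_inst I \<sigma> K) e"
    "act J \<tau> (inst_expr K e) = inst_expr (act_inst J \<tau> K) e"
    by (auto intro: act_inst_expr[OF K' f okI] act_inst_expr[OF K' f okJ])
qed

text \<open>The claim about a term boundary is part of the induction because congruence rules for
  terms demand an equation of types, and the boundary premise of the compared rule is what provides
  it.\<close>

lemma derivable_eq_act_aux:
  "derivable T X \<Gamma> \<J> \<Longrightarrow> X = \<Xi> \<longrightarrow> obj_jdg \<J> \<longrightarrow>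
    (\<forall>\<sigma> \<tau> \<Gamma>'. mor \<Gamma> \<sigma> \<tau> \<Gamma>' \<longrightarrow> derivable T \<Theta> \<Gamma>' (jdg_eq (act I \<sigma>) (act J \<tau>) \<J>))"
  "derivable_bdry T X \<Gamma> B \<Longrightarrow> X = \<Xi> \<longrightarrow> (\<forall>A. B = BTh (TmB A) \<longrightarrow>
    (\<forall>\<sigma> \<tau> \<Gamma>'. mor \<Gamma> \<sigma> \<tau> \<Gamma>' \<longrightarrow> derivable T \<Theta> \<Gamma>' (JTh (EqTyJ (act I \<sigma> A) (act J \<tau> A)))))"
proof (induct rule: derivable_derivable_bdry.inducts)
  case (var a A \<Gamma> X)
  then show ?case by (auto simp: eq_mor_def)
next
  case (meta_obj M B X ts \<Gamma> b j)
  show ?case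
  proof (intro allI impI)
    fix \<sigma> \<tau> \<Gamma>' assume X: "X = \<Xi>" and m: "mor \<Gamma> \<sigma> \<tau> \<Gamma>'"
    note mI = mor_left[OF m] and mJ = mor_right[OF m]
    note okI = inst_mor_act_ok[OF mI] and okJ = inst_mor_act_ok[OF mJ]
    have M: "(M, B) \<in> set \<Xi>" using meta_obj(1) X by simp
    have B: "wsc_bdry \<theta> {} 0 B"
      using wsc_bdry_mono[OF wsc_mctx_mem[OF \<Xi> M]] \<theta> by auto
    have w: "\<forall>j < length ts. wsc \<theta> (fst ` set \<Gamma>) 0 0 (ts ! j)"
      using meta_obj(3) X by (intro wsc_typed_args[OF T \<Xi> \<theta> inst_mor_dom[OF mI]]) auto
    then have w': "\<forall>t\<in>set ts. wsc \<theta> (fst ` set \<Gamma>) 0 0 t" by (auto simp: in_set_conv_nth)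
    have tI: "typed T \<Theta> \<Gamma>' (map_bdry (act I FV) B) (map (act I \<sigma>) ts)"
      using w meta_obj(3) X left[OF _ mI] by (intro typed_act[OF okI B meta_obj(2)]) fastforce
    have tJ: "typed T \<Theta> \<Gamma>' (map_bdry (act J FV) B) (map (act J \<tau>) ts)"
      using w meta_obj(3) X right[OF _ mJ] by (intro typed_act[OF okJ B meta_obj(2)]) fastforce
    have e: "typed_eq T \<Theta> \<Gamma>' (map_bdry (act I FV) B) (map (act I \<sigma>) ts) (map (act J \<tau>) ts)"
      using w meta_obj(3) X m by (intro typed_eq_act[OF okI B meta_obj(2)]) auto
    have "obj_bdry B" using meta_obj(4,5) obj_bdry_app[of B ts] by simp
    note h = head[OF inst_mor_base[OF mI] inst_mor_cod[OF mI] M this]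
    show "derivable T \<Theta> \<Gamma>' (jdg_eq (act I \<sigma>) (act J \<tau>) (JTh j))"
    proof (cases b)
      case TyB
      then have "j = TyJ (MApp M ts)" using meta_obj(8) by simp
      then show ?thesis
        using eq_head_ok_ty[OF h tI tJ e] TyB meta_obj(4) bdry_app_act[OF okI B w'] by (simp add: act_MApp del: act.simps)
    next
      case (TmB C)
      then have "j = TmJ (MApp M ts) C" using meta_obj(8) by simp
      \<comment> \<open>The boundary premise of the metavariable rule is \<open>TmB C\<close>, and
        the second half of the induction turns it into this equation.\<close>
      moreover have "derivable T \<Theta> \<Gamma>' (JTh (EqTyJ (act I \<sigma> C) (act J \<tau> C)))"
        using meta_obj(7) X TmB m by blast
      ultimately show ?thesis
        using eq_head_ok_tm[OF h tI tJ e] TmB meta_obj(4) bdry_app_act[OF okI B w'] bdry_app_act[OF okJ B w']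
        by (simp add: act_MApp del: act.simps)
    qed (use meta_obj(5) in auto)
  qed
next
  case (meta_eq M B X ts \<Gamma> b j)
  then show ?case by (cases j) auto
next
  case (abstr X \<Gamma> A a \<J>)
  show ?case
  proof (intro allI impI)
    fix \<sigma> \<tau> \<Gamma>' assume X: "X = \<Xi>" and o: "obj_jdg (JAbs A \<J>)" and m: "mor \<Gamma> \<sigma> \<tau> \<Gamma>'"
    note mI = mor_left[OF m] and mJ = mor_right[OF m]
    note okI = inst_mor_act_ok[OF mI] and okJ = inst_mor_act_ok[OF mJ]
    note w = abstr_wsc[OF T \<Xi> \<theta> inst_mor_dom[OF mI] abstr(1)[unfolded X] abstr(4,5)[unfolded X]]
    obtain b where b: "b \<notin> fst ` set \<Gamma>'" using ex_fresh_var by blast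
    have A: "derivable T \<Theta> \<Gamma>' (JTh (EqTyJ (act I \<sigma> A) (act J \<tau> A)))"
      using abstr(2) X m by auto
    note m' = eq_mor_snoc[OF T \<Theta> m w(1) abstr(3) A, of b]
    have "jdg_eq (act I (\<sigma>(a := FV b))) (act J (\<tau>(a := FV b))) (jdg_bsubst 0 (FV a) \<J>) =
        jdg_bsubst 0 (FV b) (jdg_eq (act I \<sigma>) (act J \<tau>) \<J>)"
      using inst_mor_act_ok[OF mor_left[OF m']] inst_mor_act_ok[OF mor_right[OF m']] w o abstr(3)
      by (intro jdg_eq_abstr) auto
    then have "derivable T \<Theta> (\<Gamma>' @ [(b, act I \<sigma> A)]) (jdg_bsubst 0 (FV b) (jdg_eq (act I \<sigma>) (act J \<tau>) \<J>))"
      using abstr(6) m' X o by (metis obj_jdg.simps(2) obj_jdg_bsubst)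
    moreover have "b \<notin> fv_jdg (jdg_eq (act I \<sigma>) (act J \<tau>) \<J>)"
      using wsc_jdg_fv[OF wsc_jdg_eq[OF okI okJ w(2)]] b o by auto
    moreover have "derivable T \<Theta> \<Gamma>' (JTh (TyJ (act I \<sigma> A)))"
      using left[OF abstr(1)[unfolded X] mI] by simp
    ultimately show "derivable T \<Theta> \<Gamma>' (jdg_eq (act I \<sigma>) (act J \<tau>) (JAbs A \<J>))"
      using b by (auto intro: derivable_derivable_bdry.abstr)
  qed
next
  \<comment> \<open>The translated term equation carries the left type, so it suffices to translate
    the type equation along the left morphism.\<close>
  case (conv_tm X \<Gamma> t A B)
  then show ?case
    using left[of \<Gamma> "JTh (EqTyJ A B)"] by simp (meson conv_eqtm mor_left)
next
  case (specific \<Phi> j X \<Gamma> K)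
  show ?case
  proof (intro allI impI)
    fix \<sigma> \<tau> \<Gamma>'
    assume X: "X = \<Xi>" and o: "obj_jdg (JTh (inst_jthesis K j))" and m: "mor \<Gamma> \<sigma> \<tau> \<Gamma>'"
    note r = wsc_theory_rule[OF T specific(1)]
    note h = specific_inst_holds[OF specific(2)[unfolded X] conjunct1[OF r] m conjunct2[OF conjunct2[OF r]]]
    show "derivable T \<Theta> \<Gamma>' (jdg_eq (act I \<sigma>) (act J \<tau>) (JTh (inst_jthesis K j)))"
    proof (cases j)
      case (TyJ A)
      have "derivable T \<Theta> \<Gamma>' (JTh (EqTyJ (inst_expr (act_inst I \<sigma> K) A) (inst_expr (act_inst J \<tau> K) A)))"
        using specific(1) TyJ m h(1-3) by (intro specific_cong_ty) auto
      moreover have "act I \<sigma> (inst_expr K A) = inst_expr (act_inst I \<sigma> K) A"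
        "act J \<tau> (inst_expr K A) = inst_expr (act_inst J \<tau> K) A"
        using TyJ m h(4,5)[of A] by auto
      ultimately show ?thesis using TyJ by simp
    next
      case (TmJ t A)
      have e: "act I \<sigma> (inst_expr K A) = inst_expr (act_inst I \<sigma> K) A"
        "act J \<tau> (inst_expr K A) = inst_expr (act_inst J \<tau> K) A"
        "act I \<sigma> (inst_expr K t) = inst_expr (act_inst I \<sigma> K) t"
        "act J \<tau> (inst_expr K t) = inst_expr (act_inst J \<tau> K) t"
        using TmJ m h(4,5)[of A] h(4,5)[of t] by auto
      \<comment> \<open>Again from the boundary premise, here of the specific rule.\<close>
      have "derivable T \<Theta> \<Gamma>' (JTh (EqTyJ (act I \<sigma> (inst_expr K A)) (act J \<tau> (inst_expr K A))))"
        using specific(4) X m TmJ by simp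
      then have "derivable T \<Theta> \<Gamma>' (JTh (EqTmJ (inst_expr (act_inst I \<sigma> K) t)
          (inst_expr (act_inst J \<tau> K) t) (inst_expr (act_inst I \<sigma> K) A)))"
        using specific(1) TmJ m h(1-3) e by (intro specific_cong_tm) auto
      then show ?thesis using TmJ e by simp
    qed (use o in auto)
  qed
qed auto

lemma derivable_eq_act:
  "derivable T \<Xi> \<Gamma> \<J> \<Longrightarrow> obj_jdg \<J> \<Longrightarrow> mor \<Gamma> \<sigma> \<tau> \<Gamma>' \<Longrightarrow>
    derivable T \<Theta> \<Gamma>' (jdg_eq (act I \<sigma>) (act J \<tau>) \<J>)"
  using derivable_eq_act_aux(1) by blast

text \<open>The binder types of a derivable boundary are compared one at a time. Both morphisms are
  extended by the same \<open>t\<close>, which equals itself by reflexivity, and this is why a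
  single \<open>\<sigma>\<close> suffices on both sides.\<close>

lemma bdry_eq_act:
  "derivable_bdry T \<Xi> \<Gamma> B \<Longrightarrow> mor \<Gamma> \<sigma> \<sigma> \<Gamma>' \<Longrightarrow> typed T \<Theta> \<Gamma>' (map_bdry (act J \<sigma>) B) ts \<Longrightarrow>
    typed T \<Theta> \<Gamma>' (map_bdry (act I \<sigma>) B) ts \<and>
    (\<forall>C C'. bdry_app (map_bdry (act I \<sigma>) B) ts = BTh (TmB C) \<longrightarrow>
      bdry_app (map_bdry (act J \<sigma>) B) ts = BTh (TmB C') \<longrightarrow> derivable T \<Theta> \<Gamma>' (JTh (EqTyJ C C')))"
proof (induction ts arbitrary: \<Gamma> B \<sigma>)
  case Nil
  have "derivable T \<Theta> \<Gamma>' (JTh (EqTyJ (act I \<sigma> A) (act J \<sigma> A)))" if "B = BTh (TmB A)" for A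
    using Nil(1,2) derivable_eq_act_aux(2) that by blast
  moreover obtain b where "B = BTh b" using Nil(3) by (cases B) (auto simp: typed_Nil)
  ultimately show ?case using Nil(3) by (cases b) (auto simp: typed_Nil)
next
  case (Cons t ts)
  obtain A B' where B: "B = BAbs A B'"
    using Cons.prems(3) by (cases B) (auto simp: typed_def)
  from Cons.prems(1)[unfolded B] show ?case
  proof cases
    case (bdry_abstr a)
    note m = Cons.prems(2)
    note mI = mor_left[OF m] and mJ = mor_right[OF m]
    note w = bdry_abstr_wsc[OF T \<Xi> \<theta> inst_mor_dom[OF mI] bdry_abstr(1,3,4)]
    have A: "derivable T \<Theta> \<Gamma>' (JTh (EqTyJ (act I \<sigma> A) (act J \<sigma> A)))"
      using derivable_eq_act[OF bdry_abstr(1) _ m] by simp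
    have tJ: "derivable T \<Theta> \<Gamma>' (JTh (TmJ t (act J \<sigma> A)))"
      using Cons.prems(3) B by (simp add: typed_Cons)
    \<comment> \<open>The conversion of an argument from the right domain to the left one, on which
      the comparison of instantiations rests.\<close>
    then have tI: "derivable T \<Theta> \<Gamma>' (JTh (TmJ t (act I \<sigma> A)))"
      using A by (blast intro: conv_tm eqty_sym)
    note m' = eq_mor_insert[OF T \<Theta> m w(1) bdry_abstr(2) tI tJ eqtm_refl[OF tI]]
    have eI: "map_bdry (act I (\<sigma>(a := t))) (bdry_bsubst 0 (FV a) B') = bdry_bsubst 0 t (map_bdry (act I \<sigma>) B')"
      using inst_mor_act_ok[OF mor_left[OF m']] by (intro map_bdry_abstr[OF _ w(2) bdry_abstr(2)]) simp
    have eJ: "map_bdry (act J (\<sigma>(a := t))) (bdry_bsubst 0 (FV a) B') = bdry_bsubst 0 t (map_bdry (act J \<sigma>) B')"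
      using inst_mor_act_ok[OF mor_right[OF m']] by (intro map_bdry_abstr[OF _ w(2) bdry_abstr(2)]) simp
    show ?thesis
      using Cons.IH[OF bdry_abstr(4) m', unfolded eI eJ] Cons.prems(3) tI unfolding B by (simp add: typed_Cons)
  qed
qed

end

subsection \<open>Equality of substitutions\<close>

text \<open>With empty instantiations a metavariable stays in place on both sides, and its own
  congruence rules provide \<open>head\<close>.\<close>

lemma eq_translation_sub:
  assumes "wsc_theory T" "wsc_mctx \<Theta>"
  shows "eq_translation T \<Theta> \<Theta> [] (depths \<Theta>) [] []"
  by unfold_locales
    (use assms in \<open>auto simp: wsc_mctx_bdry_ident intro: substitution head_ok_eq head_ok_MApp\<close>)

text \<open>The binders of \<open>e\<close> are opened one after the other into
  \<open>\<Gamma>\<close>, sent to the entries of \<open>ss\<close> on the left and of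
  \<open>ts\<close> on the right. When none is left, equality of substitutions compares the two
  bodies. Starting from general \<open>\<sigma>\<close> and \<open>\<tau>\<close> is what lets the
  induction on the spine proceed.\<close>

lemma derivable_fill_spine_cong:
  assumes th: "wsc_theory T" "wsc_mctx \<Theta>"
  shows "eq_mor T \<Theta> [] (depths \<Theta>) [] [] \<Gamma> \<sigma> \<tau> \<Gamma>' \<Longrightarrow> derivable T \<Theta> \<Gamma> \<J> \<Longrightarrow> fill B e = Some \<J> \<Longrightarrow> obj_bdry B \<Longrightarrow>
    typed T \<Theta> \<Gamma>' (map_bdry (act [] \<sigma>) B) ss \<Longrightarrow> typed T \<Theta> \<Gamma>' (map_bdry (act [] \<tau>) B) ts \<Longrightarrow>
    typed_eq T \<Theta> \<Gamma>' (map_bdry (act [] \<sigma>) B) ss ts \<Longrightarrow> bdry_app (map_bdry (act [] \<sigma>) B) ss = BTh b \<Longrightarrow>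
    \<exists>\<J>'. fill_eq (BTh b) (arg_app (act [] \<sigma> e) ss) (arg_app (act [] \<tau> e) ts) = Some \<J>' \<and> derivable T \<Theta> \<Gamma>' \<J>'"
proof (induction ss arbitrary: ts \<Gamma> \<sigma> \<tau> B e \<J>)
  case Nil
  interpret eq_translation T \<Theta> \<Theta> "[]" "depths \<Theta>" "[]" "[]" by (rule eq_translation_sub[OF th])
  have "ts = []" using Nil.prems(5,6) by (auto simp: typed_def)
  moreover have "obj_jdg \<J>" using fill_obj Nil.prems by blast
  ultimately show ?case
    using fill_eq_of_fill[OF Nil.prems(3,4), of "[]" \<sigma> "[]" \<tau>] Nil.prems(8)
      derivable_eq_act[OF Nil.prems(2) _ Nil.prems(1)] by auto
next
  case (Cons s ss)
  interpret eq_translation T \<Theta> \<Theta> "[]" "depths \<Theta>" "[]" "[]" by (rule eq_translation_sub[OF th])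
  obtain A B' where B: "B = BAbs A B'"
    using Cons.prems(5) by (cases B) (auto simp: typed_def)
  with Cons.prems obtain e' \<J>' where e: "e = Abs e'" "\<J> = JAbs A \<J>'" "fill B' e' = Some \<J>'"
    by (cases e) auto
  obtain t ts' where ts: "ts = t # ts'"
    using Cons.prems(5,6) by (cases ts) (auto simp: typed_def)
  from Cons.prems(2)[unfolded e] show ?case
  proof cases
    case (abstr a)
    note m = Cons.prems(1)
    note w = abstr_wsc[OF th map_le_refl inst_mor_dom[OF mor_left[OF m]] abstr(1,3,4)]
    have m': "eq_mor T \<Theta> [] (depths \<Theta>) [] [] (\<Gamma> @ [(a, A)]) (\<sigma>(a := s)) (\<tau>(a := t)) \<Gamma>'"
      using Cons.prems(5-7) B ts
      by (intro eq_mor_insert[OF th m w(1) abstr(2)]) (auto simp: typed_Cons typed_eq_Cons)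
    note okI = inst_mor_act_ok[OF mor_left[OF m'], simplified] and okJ = inst_mor_act_ok[OF mor_right[OF m'], simplified]
    have wB: "wsc_bdry (depths \<Theta>) (fst ` set \<Gamma>) (Suc 0) B'" "wsc (depths \<Theta>) (fst ` set \<Gamma>) (Suc 0) (bdry_depth B') e'"
      using w(2) fill_wsc[OF e(3)] by auto
    note eqs = map_bdry_abstr[OF okI wB(1) abstr(2)] map_bdry_abstr[OF okJ wB(1) abstr(2)]
      act_abstr[OF okI wB(2) abstr(2)] act_abstr[OF okJ wB(2) abstr(2)]
    show ?thesis
      using Cons.IH[OF m' abstr(4) fill_bsubst[OF e(3)], of ts', unfolded eqs] Cons.prems(4-8) B e ts
      by (simp add: typed_Cons typed_eq_Cons)
  qed
qed

text \<open>A derivable argument behaves like a metavariable with its boundary: substitution gives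
  the introduction clause, and equality of substitutions, started at the identity, gives both
  congruence clauses.\<close>

lemma head_ok_arg_app:
  assumes T: "wsc_theory T" "wsc_mctx \<Theta>" and \<Gamma>: "wsc_vctx (depths \<Theta>) \<Gamma>"
    and J: "derivable T \<Theta> \<Gamma> \<J>" and f: "fill B e = Some \<J>"
  shows "head_ok T \<Theta> \<Gamma> B (arg_app e)"
proof -
  have "wsc_jdg (depths \<Theta>) (fst ` set \<Gamma>) 0 \<J>"
    using derivable_wsc(1)[OF T(1) J T(2) _ \<Gamma>] by simp
  then have "wsc_bdry (depths \<Theta>) (fst ` set \<Gamma>) 0 B" "wsc (depths \<Theta>) (fst ` set \<Gamma>) 0 (bdry_depth B) e"
    using fill_wsc[OF f] by auto
  then have id: "map_bdry (act [] FV) B = B" "act [] FV e = e"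
    by (auto intro: map_bdry_act_ident act_ident)
  have m: "eq_mor T \<Theta> [] (depths \<Theta>) [] [] \<Gamma> FV FV \<Gamma>"
    using sub_mor_id[OF \<Gamma>, of T] unfolding eq_mor_def inst_mor_def by (auto intro: eqtm_refl)
  have cong: "\<exists>\<J>'. fill_eq (BTh b) (arg_app e ss) (arg_app e ts) = Some \<J>' \<and> derivable T \<Theta> \<Gamma> \<J>'"
    if "typed T \<Theta> \<Gamma> B ss" "typed T \<Theta> \<Gamma> B ts" "typed_eq T \<Theta> \<Gamma> B ss ts" "bdry_app B ss = BTh b"
      "obj_bthesis b" for ss ts b
    using derivable_fill_spine_cong[OF T m J f, of ss ts b] that obj_bdry_app[of B ss] by (simp add: id)
  show ?thesis unfolding head_ok_def
  proof (intro conjI allI impI)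
    fix ts b j
    assume ts: "typed T \<Theta> \<Gamma> B ts" "bdry_app B ts = BTh b"
      and j: "if obj_bthesis b then fill_thesis b (arg_app e ts) = Some j else bthesis_of j = b"
    obtain j' where j': "fill_thesis b (arg_app e ts) = Some j'" "derivable T \<Theta> \<Gamma> (JTh j')"
      using derivable_fill_spine[OF T \<Gamma> J f ts] by blast
    \<comment> \<open>An object thesis is determined by boundary and head; an equation is determined
      by its boundary alone, its head being the star.\<close>
    have "j = j'" using j j'(1) by (cases b; cases j) (auto split: if_splits)
    then show "derivable T \<Theta> \<Gamma> (JTh j)" using j' by simp
  next
    fix ss ts
    assume "typed T \<Theta> \<Gamma> B ss" "typed T \<Theta> \<Gamma> B ts" "typed_eq T \<Theta> \<Gamma> B ss ts" "bdry_app B ss = BTh TyB"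
    then show "derivable T \<Theta> \<Gamma> (JTh (EqTyJ (arg_app e ss) (arg_app e ts)))"
      using cong by fastforce
  next
    fix ss ts C C'
    assume "typed T \<Theta> \<Gamma> B ss" "typed T \<Theta> \<Gamma> B ts" "typed_eq T \<Theta> \<Gamma> B ss ts" "bdry_app B ss = BTh (TmB C)"
    then show "derivable T \<Theta> \<Gamma> (JTh (EqTmJ (arg_app e ss) (arg_app e ts) C))"
      using cong by fastforce
  qed
qed

subsection \<open>Equality of instantiations\<close>

text \<open>The boundary mentions earlier metavariables only, and on these the restricted
  instantiation and the full one agree.\<close>

lemma inst_bdry_take:
  assumes K: "inst_holds D \<Xi> K" and \<Xi>: "wsc_mctx \<Xi>" and k: "k < length \<Xi>"
  shows "inst_bdry (take k K) (snd (\<Xi> ! k)) = map_bdry (act K FV) (snd (\<Xi> ! k))"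
  unfolding inst_expr_eq_act
proof (rule map_bdry_act_cong)
  show "wsc_bdry (depths (take k \<Xi>)) {} 0 (snd (\<Xi> ! k))"
    using \<Xi> k by (simp add: wsc_mctx_def)
  fix M n assume "depths (take k \<Xi>) M = Some n"
  then have "M \<in> fst ` set (take k \<Xi>)" by (metis depths_None option.distinct(1))
  moreover have "map fst (take k K) = map fst (take k \<Xi>)"
    using K by (simp add: inst_holds_def take_map[symmetric])
  ultimately have "M \<in> fst ` set (take k K)" by (metis list.set_map)
  then show "map_of (take k K) M = map_of K M" by (rule map_of_take)
qed simp

lemma inst_holds_map_of:
  assumes K: "inst_holds D \<Xi> K" and d: "distinct (map fst \<Xi>)" and k: "k < length \<Xi>"
  shows "map_of K (fst (\<Xi> ! k)) = Some (snd (K ! k))"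
proof -
  have f: "map fst K = map fst \<Xi>" using K by (simp add: inst_holds_def)
  then have "k < length K" "fst (K ! k) = fst (\<Xi> ! k)"
    using k by (metis length_map, metis length_map nth_map)
  then show ?thesis using d f by (metis map_of_is_SomeI nth_mem prod.collapse)
qed

lemma head_ok_inst:
  assumes T: "wsc_theory T" "wsc_mctx \<Theta>" and \<Xi>: "wsc_mctx \<Xi>"
    and \<Delta>: "wsc_vctx (depths \<Theta>) \<Delta>" and I: "inst_holds (derivable T \<Theta> \<Delta>) \<Xi> I"
    and \<Gamma>: "set \<Delta> \<subseteq> set \<Gamma>" "wsc_vctx (depths \<Theta>) \<Gamma>" and M: "(M, B) \<in> set \<Xi>"
  shows "head_ok T \<Theta> \<Gamma> (map_bdry (act I FV) B) (mapp I M)"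
proof -
  obtain k where k: "k < length \<Xi>" "\<Xi> ! k = (M, B)" using M by (auto simp: in_set_conv_nth)
  obtain \<J> where J: "fill (inst_bdry (take k I) B) (snd (I ! k)) = Some \<J>" "derivable T \<Theta> \<Delta> \<J>"
    using I k unfolding inst_holds_def by fastforce
  have "inst_bdry (take k I) B = map_bdry (act I FV) B"
    using inst_bdry_take[OF I \<Xi> k(1)] k by simp
  moreover have "mapp I M = arg_app (snd (I ! k))"
    using inst_holds_map_of[OF I _ k(1)] \<Xi> k(2) by (simp add: mapp_def fun_eq_iff wsc_mctx_def)
  ultimately show ?thesis
    using head_ok_arg_app[OF T \<Gamma>(2) weakening[OF T \<Delta> \<Gamma>(2,1) J(2)]] J(1) by simp
qed

lemma derivable_instantiation:
  assumes "wsc_theory T" "wsc_mctx \<Theta>" "wsc_mctx \<Xi>" "depths \<Xi> \<subseteq>\<^sub>m \<theta>"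
    and "wsc_vctx (depths \<Theta>) \<Delta>" "inst_holds (derivable T \<Theta> \<Delta>) \<Xi> I"
    and "derivable T \<Xi> \<Gamma> \<J>" "inst_mor T \<Theta> \<Delta> \<theta> I \<Gamma> \<sigma> \<Gamma>'"
  shows "derivable T \<Theta> \<Gamma>' (map_jdg (act I \<sigma>) \<J>)"
  by (rule translation.derivable_act[OF translation_inst_mor[OF assms(1,3,4,2)] assms(7,8)])
    (rule head_ok_inst[OF assms(1,2,3,5,6)])

text \<open>The derivability part of \<open>wf_mctx\<close>, indexed by position so that it passes
  to prefixes, as induction on the length requires.\<close>

definition bdrys_derivable :: "'s rule set \<Rightarrow> 's mctx \<Rightarrow> bool" where
  "bdrys_derivable T \<Xi> \<longleftrightarrow> (\<forall>k < length \<Xi>. derivable_bdry T (take k \<Xi>) [] (snd (\<Xi> ! k)))"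

text \<open>The instance for the metavariables before \<open>M\<close> is used solely to compare the
  two translations of the boundary of \<open>M\<close>. The case of \<open>M\<close> then chains
  congruence of one argument on two spines with equality of two arguments on one spine.\<close>

lemma eq_translation_inst:
  assumes T: "wsc_theory T" "wsc_mctx \<Theta>" and \<Delta>: "wsc_vctx (depths \<Theta>) \<Delta>"
  shows "wsc_mctx \<Xi> \<Longrightarrow> bdrys_derivable T \<Xi> \<Longrightarrow> depths \<Xi> \<subseteq>\<^sub>m \<theta> \<Longrightarrow>
    inst_holds (derivable T \<Theta> \<Delta>) \<Xi> I \<Longrightarrow> inst_holds (derivable T \<Theta> \<Delta>) \<Xi> J \<Longrightarrow>
    inst_eq_holds (derivable T \<Theta> \<Delta>) \<Xi> I J \<Longrightarrow> eq_translation T \<Xi> \<Theta> \<Delta> \<theta> I J"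
proof (induction "length \<Xi>" arbitrary: \<Xi> I J \<theta> rule: less_induct)
  case less
  note \<Xi> = less.prems(1) and I = less.prems(4) and J = less.prems(5)
  have d: "distinct (map fst \<Xi>)" using \<Xi> by (simp add: wsc_mctx_def)
  show ?case
  proof (unfold_locales, goal_cases)
    case (7 \<Gamma>' M B)
    then obtain m where m: "m < length \<Xi>" "\<Xi> ! m = (M, B)" by (auto simp: in_set_conv_nth)
    let ?BI = "map_bdry (act I FV) B" and ?BJ = "map_bdry (act J FV) B"
    let ?e = "snd (I ! m)" and ?f = "snd (J ! m)"
    have BI: "inst_bdry (take m I) B = ?BI" using inst_bdry_take[OF I \<Xi> m(1)] m by simp
    have BJ: "inst_bdry (take m J) B = ?BJ" using inst_bdry_take[OF J \<Xi> m(1)] m by simp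
    have hI: "mapp I M = arg_app ?e" and hJ: "mapp J M = arg_app ?f"
      using inst_holds_map_of[OF I d m(1)] inst_holds_map_of[OF J d m(1)] m(2)
      by (simp_all add: mapp_def fun_eq_iff)
    obtain \<J> where \<J>: "fill_eq ?BI ?e ?f = Some \<J>" "derivable T \<Theta> \<Delta> \<J>"
      using less.prems(6) m 7(4) BI unfolding inst_eq_holds_def by fastforce
    have D: "derivable T \<Theta> \<Gamma>' \<J>" using weakening[OF T \<Delta> 7(2,1) \<J>(2)] .
    \<comment> \<open>The first link of the chain: one head \<open>?e\<close> on the spines
      \<open>ss\<close> and \<open>ts\<close>, once both are typed by the left boundary.\<close>
    have cong: "eq_head_ok T \<Theta> \<Gamma>' ?BI ?BI (arg_app ?e) (arg_app ?e)"
      using head_ok_eq[OF head_ok_inst[OF T \<Xi> \<Delta> I 7(1-3)]] hI by simp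
    interpret E: eq_translation T "take m \<Xi>" \<Theta> \<Delta> "depths (take m \<Xi>)" "take m I" "take m J"
    proof (rule less.hyps)
      show "bdrys_derivable T (take m \<Xi>)"
        using less.prems(2) m by (auto simp: bdrys_derivable_def min_def)
    qed (use m less.prems wsc_mctx_take inst_holds_take inst_eq_holds_take in auto)
    have ok: "act_ok (depths (take m \<Xi>)) {} (depths \<Theta>) (fst ` set \<Gamma>') (take m K) FV"
      if "inst_holds (derivable T \<Theta> \<Delta>) \<Xi> K" for K
    proof (rule inst_holds_act_ok[OF inst_holds_take[OF that]])
      show "wsc_jdg (depths \<Theta>) (fst ` set \<Gamma>') 0 \<J>" if "derivable T \<Theta> \<Delta> \<J>" for \<J>
        using derivable_wsc(1)[OF T(1) weakening[OF T \<Delta> 7(2,1) that] T(2) _ 7(2)] by simp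
      show "distinct (map fst (take m \<Xi>))" using d by (simp add: take_map[symmetric])
    qed
    \<comment> \<open>The boundary of \<open>M\<close> is derivable in the empty variable context,
      so the two morphisms to be compared have no variables to type, and any target above
      \<open>\<Delta>\<close> will do.\<close>
    have mor: "E.mor [] FV FV \<Gamma>'"
      using 7(1,2) ok[OF I] ok[OF J] by (simp add: eq_mor_def inst_mor_def sub_ok_def)
    have "derivable_bdry T (take m \<Xi>) [] B"
      using less.prems(2) m by (auto simp: bdrys_derivable_def)
    note bd = E.bdry_eq_act[OF this mor, folded inst_expr_eq_act, unfolded BI BJ]
    show ?case unfolding hI hJ eq_head_ok_def
    proof (intro allI impI conjI)
      fix ss ts
      assume ss: "typed T \<Theta> \<Gamma>' ?BI ss" and ts: "typed T \<Theta> \<Gamma>' ?BJ ts" and e: "typed_eq T \<Theta> \<Gamma>' ?BI ss ts"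
      \<comment> \<open>The spine \<open>ts\<close> was typed by the right boundary; the comparison
        of boundaries moves it to the left one.\<close>
      have ts': "typed T \<Theta> \<Gamma>' ?BI ts" using bd[OF ts] by blast
      obtain b where b: "bdry_app ?BI ts = BTh b" "bthesis_class b = fst (bdry_arity ?BI)"
        using bdry_app_core[of ts ?BI] ts' unfolding typed_def by blast
      have b': "bdry_app ?BI ss = BTh c \<Longrightarrow> bthesis_class b = bthesis_class c" for c
        using b(2) bdry_app_core[of ss ?BI] ss by (auto simp: typed_def)
      obtain \<J>' where \<J>': "fill_eq (BTh b) (arg_app ?e ts) (arg_app ?f ts) = Some \<J>'" "derivable T \<Theta> \<Gamma>' \<J>'"
        using derivable_fill_eq_spine[OF T 7(2) D \<J>(1) ts' b(1)] by blast
      show "derivable T \<Theta> \<Gamma>' (JTh (EqTyJ (arg_app ?e ss) (arg_app ?f ts)))"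
        if "bdry_app ?BI ss = BTh TyB"
      proof -
        have "b = TyB" using b'[OF that] by (cases b) auto
        then show ?thesis using \<J>' eq_head_ok_ty[OF cong ss ts' e that] by (auto intro: eqty_trans)
      qed
      show "derivable T \<Theta> \<Gamma>' (JTh (EqTmJ (arg_app ?e ss) (arg_app ?f ts) C))"
        if C: "bdry_app ?BI ss = BTh (TmB C)" and C': "bdry_app ?BJ ts = BTh (TmB C')"
        and CC: "derivable T \<Theta> \<Gamma>' (JTh (EqTyJ C C'))" for C C'
      proof -
      \<comment> \<open>Three types meet here: \<open>C\<close> from the left boundary at
        \<open>ss\<close>, \<open>C'\<close> from the right one at \<open>ts\<close>, and
        \<open>C''\<close> from the left one at \<open>ts\<close>. As \<open>C\<close> equals
        \<open>C'\<close> by assumption and \<open>C''\<close> equals \<open>C'\<close> by comparing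
        boundaries, everything can be brought to \<open>C\<close>.\<close>
      obtain C'' where b'': "b = TmB C''" using b'[OF C] by (cases b) auto
      then have "derivable T \<Theta> \<Gamma>' (JTh (EqTyJ C'' C'))" using bd[OF ts] b(1) C' by blast
      then have CC'': "derivable T \<Theta> \<Gamma>' (JTh (EqTyJ C C''))"
        using CC by (blast intro: eqty_trans eqty_sym)
      then have "derivable T \<Theta> \<Gamma>' (JTh (EqTmJ (arg_app ?e ss) (arg_app ?e ts) C))"
        using eq_head_ok_tm[OF cong ss ts' e C] b(1) b'' by blast
      moreover have "derivable T \<Theta> \<Gamma>' (JTh (EqTmJ (arg_app ?e ts) (arg_app ?f ts) C))"
        using \<J>' b'' CC'' by (auto intro: conv_eqtm eqty_sym)
      ultimately show ?thesis by (rule eqtm_trans)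
      qed
    qed
  qed (use T \<Delta> less.prems derivable_instantiation in blast)+
qed

section \<open>Well-formed contexts, and the variable context as a morphism to itself\<close>

lemma wf_mctx_wsc:
  assumes "wsc_theory T"
  shows "wf_mctx T \<Xi> \<Longrightarrow> wsc_mctx \<Xi> \<and> bdrys_derivable T \<Xi>"
proof (induction rule: wf_mctx.induct)
  case (2 \<Theta> B M)
  then have "wsc_bdry (depths \<Theta>) {} 0 B"
    using derivable_wsc(2)[OF assms 2(2)] by simp
  then show ?case
    using 2 by (auto intro: wsc_mctx_snoc simp: bdrys_derivable_def nth_append less_Suc_eq)
qed (simp add: wsc_mctx_Nil bdrys_derivable_def)

lemma wf_vctx_wsc:
  assumes "wsc_theory T" "wsc_mctx \<Theta>"
  shows "wf_vctx T \<Theta> \<Gamma> \<Longrightarrow> wsc_vctx (depths \<Theta>) \<Gamma>"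
proof (induction rule: wf_vctx.induct)
  case (2 \<Gamma> A a)
  then show ?case
    using derivable_wsc(1)[OF assms(1) 2(2) assms(2)] by (auto intro: wsc_vctx_snoc)
qed simp

text \<open>Allows the types of \<open>\<Gamma>\<close>, scoped over \<open>\<Theta>\<close>, to be
  read over a depth map that differs from it at metavariables they do not mention.\<close>

lemma wsc_change_mvars:
  "wsc \<theta> \<gamma> k n e \<Longrightarrow> \<forall>M\<in>mvars e. \<theta> M = \<theta>' M \<Longrightarrow> wsc \<theta>' \<gamma> k n e"
proof (induction e arbitrary: k n)
  case (Sym S es)
  then show ?case by simp blast
qed auto

theorem mainTheorem4:
  fixes \<Sigma> :: "'s signature" and T :: "'s rule set"
    and \<Theta> \<Xi> :: "'s mctx" and \<Gamma> :: "'s vctx"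
    and I J :: "'s inst" and \<J> :: "'s expr jdg"
  assumes "raw_type_theory \<Sigma> T"
    and "raw_mctx \<Sigma> \<Theta>"
    and "derivable_inst T \<Theta> \<Gamma> \<Xi> I"
    and "derivable_inst T \<Theta> \<Gamma> \<Xi> J"
    and "equal_inst T \<Theta> \<Gamma> \<Xi> I J"
    and "wf_mctx T \<Xi>"
    and "wf_vctx T \<Theta> \<Gamma>"
    and "mvars_vctx \<Gamma> \<inter> fst ` set \<Xi> = {}"
    and "obj_jdg \<J>"
    and "derivable T \<Xi> \<Gamma> \<J>"
  shows "derivable T \<Theta> \<Gamma> (inst_eq I J \<J>)"
proof -
  have T: "wsc_theory T" and \<Theta>: "wsc_mctx \<Theta>"
    using assms(1,2) raw_type_theory_wsc raw_mctx_wsc by auto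
  have \<Xi>: "wsc_mctx \<Xi>" "bdrys_derivable T \<Xi>" using wf_mctx_wsc[OF T assms(6)] by auto
  have \<Gamma>: "wsc_vctx (depths \<Theta>) \<Gamma>" using wf_vctx_wsc[OF T \<Theta> assms(7)] .
  have I: "inst_holds (derivable T \<Theta> \<Gamma>) \<Xi> I" and J: "inst_holds (derivable T \<Theta> \<Gamma>) \<Xi> J"
    and IJ: "inst_eq_holds (derivable T \<Theta> \<Gamma>) \<Xi> I J"
    using assms(3-5) by (auto simp: derivable_inst_def equal_inst_def)
  have none: "map_of K M = None" if "inst_holds (derivable T \<Theta> \<Gamma>) \<Xi> K" "depths \<Xi> M = None" for K M
  proof -
    have "fst ` set K = fst ` set \<Xi>" using that(1) by (metis inst_holds_def list.set_map)
    then show ?thesis using that(2) by (simp add: depths_None map_of_eq_None_iff)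
  qed
  \<comment> \<open>The derivation uses metavariables of \<open>\<Xi>\<close> and the types in
    \<open>\<Gamma>\<close> those of \<open>\<Theta>\<close>. At a name declared in both,
    \<open>\<Xi>\<close> wins; \<open>\<Gamma>\<close> does not mention such names.\<close>
  define \<theta> where "\<theta> = depths \<Theta> ++ depths \<Xi>"
  have \<theta>: "depths \<Xi> \<subseteq>\<^sub>m \<theta>" by (simp add: \<theta>_def)
  have \<Gamma>_mvars: "depths \<Xi> M = None" if "(a, A) \<in> set \<Gamma>" "M \<in> mvars A" for a A M
    using assms(8) that by (force simp: depths_None mvars_vctx_def)
  have \<Gamma>\<theta>: "wsc_vctx \<theta> \<Gamma>"
    unfolding wsc_vctx_def
  proof safe
    fix a A assume A: "(a, A) \<in> set \<Gamma>"
    show "wsc \<theta> (fst ` set \<Gamma>) 0 0 A"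
      by (rule wsc_change_mvars[OF wsc_vctx_mem[OF \<Gamma> A]]) (simp add: \<theta>_def map_add_def \<Gamma>_mvars[OF A])
  qed
  \<comment> \<open>Because \<open>\<Gamma>\<close> mentions no metavariable of
    \<open>\<Xi>\<close>, an instantiation of \<open>\<Xi>\<close> fixes its types, and the identity
    on variables is a morphism from \<open>\<Gamma>\<close> over \<open>\<Xi>\<close> to
    \<open>\<Gamma>\<close> over \<open>\<Theta>\<close>.\<close>
  have mor: "inst_mor T \<Theta> \<Gamma> \<theta> K \<Gamma> FV \<Gamma>" if K: "inst_holds (derivable T \<Theta> \<Gamma>) \<Xi> K" for K
  proof -
    have "act_ok (depths \<Xi>) {} (depths \<Theta>) (fst ` set \<Gamma>) K FV"
      using derivable_wsc(1)[OF T _ \<Theta> map_le_refl \<Gamma>] \<Xi>(1)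
      by (intro inst_holds_act_ok[OF K]) (auto simp: wsc_mctx_def)
    then have "act_ok \<theta> (fst ` set \<Gamma>) (depths \<Theta>) (fst ` set \<Gamma>) K FV"
      using none[OF K] by (auto simp: act_ok_def \<theta>_def map_add_def split: option.splits)
    moreover have "act K FV A = A" if A: "(a, A) \<in> set \<Gamma>" for a A
    proof (rule act_ident)
      \<comment> \<open>The names of \<open>\<Xi>\<close> are removed from the depth map, so that
        every metavariable still in scope is one that \<open>K\<close> leaves alone, as
        \<open>act_ident\<close> demands.\<close>
      show "wsc (\<lambda>M. if depths \<Xi> M = None then depths \<Theta> M else None) (fst ` set \<Gamma>) 0 0 A"
        by (rule wsc_change_mvars[OF wsc_vctx_mem[OF \<Gamma> A]]) (simp add: \<Gamma>_mvars[OF A])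
    qed (use none[OF K] in \<open>auto split: if_splits\<close>)
    ultimately show ?thesis
      using \<Gamma> \<Gamma>\<theta> by (auto simp: inst_mor_def sub_ok_def intro: var)
  qed
  interpret eq_translation T \<Xi> \<Theta> \<Gamma> \<theta> I J
    using eq_translation_inst[OF T \<Theta> \<Gamma> \<Xi> \<theta> I J IJ] .
  \<comment> \<open>Both morphisms are the identity on variables, so their equality on
    \<open>\<Gamma>\<close> is reflexivity; all the difference lies in the instantiations.\<close>
  have "eq_mor T \<Theta> \<Gamma> \<theta> I J \<Gamma> FV FV \<Gamma>"
    using mor[OF I] mor[OF J] unfolding eq_mor_def inst_mor_def by (auto intro: eqtm_refl)
  then show ?thesis
    using derivable_eq_act[OF assms(10,9)] inst_eq_eq_jdg_eq[OF assms(9)] by simp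
qed

end
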